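(* For every integer $k\ge 1$, the set of odd integers $s$ such that $\operatorname{Po}(K_s)$ contains a subgroup isomorphic to $(\mathbb{Z}/5\mathbb{Z})^k$ has positive density, in the sense that $$\liminf_{x\to\infty}\frac{\#\{s\in\mathbb{Z}\cap[1,x] : s \text{ odd},\ (\mathbb{Z}/5\mathbb{Z})^k\subseteq \operatorname{Po}(K_s)\}}{x}>0 .$$
   Context: For $s\in\mathbb{Q}$ the Lecacheux quintic polynomial is $f_s(X)=X^5+a_4(s)X^4+a_3(s)X^3+a_2(s)X^2+a_1(s)X+a_0(s)\in\mathbb{Q}[X]$, where $a_4(s)=s^5-3$, $a_3(s)=-s^9-2s^8-3s^7-5s^6-6s^5-2s^4+s^3-s^2+3$, $a_2(s)=s^{10}+2s^9+4s^8+6s^7+10s^6+9s^5+4s^4-2s^3+2s^2-1$, $a_1(s)=-s^2(s^7+2s^6+3s^5+5s^4+5s^3+2s^2-s+1)$, $a_0(s)=s^5$. If $f_s$ is irreducible over $\mathbb{Q}$ (known to hold for every odd integer $s$), then $K_s=\mathbb{Q}(\theta_s)$, with $\theta_s$ a root of $f_s$, is a cyclic quintic field, called a Lecacheux quintic field. For a number field $K$ with ring of integers $\mathcal{O}_K$ and class group $\operatorname{Cl}(K)$, let $\operatorname{Int}(\mathcal{O}_K)=\{f\in K[X] : f(\mathcal{O}_K)\subseteq\mathcal{O}_K\}$. For $n\ge 1$ let $\mathfrak{J}_n(K)$ be the fractional ideal consisting of $0$ and the leading coefficients of the elements of $\operatorname{Int}(\mathcal{O}_K)$ of degree $n$. The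 Pólya group $\operatorname{Po}(K)$ is the subgroup of $\operatorname{Cl}(K)$ generated by the classes $[\mathfrak{J}_n(K)]$, $n\ge1$. *)

theory Defs
  imports
    "HOL-Algebra.Algebra"
    "HOL-Algebra.Algebraic_Closure_Type"
    "HOL-Library.Extended_Real"
begin

definition lecacheux_poly :: "rat \<Rightarrow> rat Polynomial.poly" where
  "lecacheux_poly s =
    [: s^5,
       - (s^2 * (s^7 + 2*s^6 + 3*s^5 + 5*s^4 + 5*s^3 + 2*s^2 - s + 1)),
       s^10 + 2*s^9 + 4*s^8 + 6*s^7 + 10*s^6 + 9*s^5 + 4*s^4 - 2*s^3 + 2*s^2 - 1,
       - (s^9) - 2*s^8 - 3*s^7 - 5*s^6 - 6*s^5 - 2*s^4 + s^3 - s^2 + 3,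
       s^5 - 3,
       1 :]"

text \<open>Number fields are represented as subsets of the field of complex numbers.\<close>

abbreviation complex_field :: "complex ring" where
  "complex_field \<equiv> ring_of_type_algebra"

text \<open>The subfield generated by \<open>\<theta>\<close> contains the prime field, so it is \<open>\<rat>(\<theta>)\<close>.\<close>

definition rat_adjoin :: "complex \<Rightarrow> complex set" where
  "rat_adjoin \<theta> = generate_field complex_field {\<theta>}"

definition ring_of_integers :: "complex set \<Rightarrow> complex set" where
  "ring_of_integers K = {x \<in> K. algebraic_int x}"

definition fractional_ideal :: "complex set \<Rightarrow> complex set \<Rightarrow> bool" where
  "fractional_ideal K I \<longleftrightarrow>
     I \<subseteq> K \<and> 0 \<in> I \<and> I \<noteq> {0} \<and>
     (\<forall>x\<in>I. \<forall>y\<in>I. x + y \<in> I) \<and>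
     (\<forall>a\<in>ring_of_integers K. \<forall>x\<in>I. a * x \<in> I) \<and>
     (\<exists>d\<in>ring_of_integers K. d \<noteq> 0 \<and> (\<forall>x\<in>I. d * x \<in> ring_of_integers K))"

text \<open>
  The product \<^const>\<open>ideal_prod\<close> only uses the ring operations, so \<open>ideal_prod complex_field I J\<close>
  is the set of all finite sums of products of an element of \<open>I\<close> and an element of \<open>J\<close>.
\<close>

definition fractional_ideal_group :: "complex set \<Rightarrow> complex set monoid" where
  "fractional_ideal_group K =
     \<lparr>carrier = {I. fractional_ideal K I},
      monoid.mult = ideal_prod complex_field,
      one = ring_of_integers K\<rparr>"

definition principal_fractional_ideals :: "complex set \<Rightarrow> complex set set" where
  "principal_fractional_ideals K =
     {(\<lambda>x. a * x) ` ring_of_integers K | a. a \<in> K \<and> a \<noteq> 0}"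

definition class_group :: "complex set \<Rightarrow> complex set set monoid" where
  "class_group K = fractional_ideal_group K Mod principal_fractional_ideals K"

definition ideal_class :: "complex set \<Rightarrow> complex set \<Rightarrow> complex set set" where
  "ideal_class K I = principal_fractional_ideals K #>\<^bsub>fractional_ideal_group K\<^esub> I"

definition int_valued_polys :: "complex set \<Rightarrow> complex Polynomial.poly set" where
  "int_valued_polys K =
     {f. (\<forall>i. Polynomial.coeff f i \<in> K) \<and>
         (\<forall>x\<in>ring_of_integers K. poly f x \<in> ring_of_integers K)}"

definition characteristic_ideal :: "complex set \<Rightarrow> nat \<Rightarrow> complex set" where
  "characteristic_ideal K n =
     insert 0 {Polynomial.lead_coeff f | f.
       f \<in> int_valued_polys K \<and> Polynomial.degree f = n}"

definition polya_group :: "complex set \<Rightarrow> complex set set monoid" where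
  "polya_group K =
     subgroup_generated (class_group K) {ideal_class K (characteristic_ideal K n) | n. n \<ge> 1}"

definition has_subgroup_isomorphic_to ::
    "('a, 'c) monoid_scheme \<Rightarrow> ('b, 'd) monoid_scheme \<Rightarrow> bool" where
  "has_subgroup_isomorphic_to G A \<longleftrightarrow> (\<exists>H. subgroup H G \<and> G\<lparr>carrier := H\<rparr> \<cong> A)"

end

theory Submission
  imports Defs "Jordan_Normal_Form.Char_Poly" "HOL-Number_Theory.Cong"
begin

text \<open>
  Let \<open>q \<noteq> 5\<close> be a prime that divides the value at \<open>s\<close> of the quartic \<open>s ^ 4 - 2 * s ^ 3 + 4 * s ^ 2 - 3 * s + 1\<close>
  exactly once. After the substitution \<open>y = 5 * x + a\<^sub>4(s)\<close>, the quintic \<open>f\<^sub>s\<close> becomes an Eisenstein polynomial at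
  \<open>q\<close> (\<open>eisenstein_depressed\<close>). So \<open>K\<^sub>s\<close> has degree five, and \<open>(q)\<close> is the fifth power of a prime ideal \<open>Q\<close>
  with residue field of \<open>q\<close> elements (\<open>ramified_ideal_power\<close>, \<open>congruent_integer\<close>).

  The class of \<open>Q\<close> belongs to the Polya group, because the characteristic ideals satisfy
  \<open>Q \<cdot> J\<^sub>q = J\<^sub>q\<^sub>-\<^sub>1\<close> (\<open>ramified_ideal_mult_J\<close>). This identity is local at \<open>q\<close>: a forward difference shows
  that \<open>q\<close> maps \<open>J\<^sub>q\<close> into \<open>J\<^sub>q\<^sub>-\<^sub>1\<close>, and away from \<open>q\<close> the denominator \<open>(q - 1)!\<close> is harmless. To
  divide by \<open>J\<^sub>q\<close> one needs that fractional ideals are invertible (\<open>fractional_ideal_invertible\<close>), which follows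
  from Dedekind's Prague theorem on the coefficients of products of polynomials.

  The classes of several such ideals generate a group of exponent five. A relation between them is a principal ideal
  generated by some \<open>\<alpha>\<close> such that \<open>\<alpha> ^ 5\<close> is a unit times a product of the primes \<open>q\<close>. If there were six independent
  relations, the six units would be multiplicatively dependent by the easy half of Dirichlet's unit theorem
  (\<open>unit_relation\<close>, a pigeonhole argument). A combination of the six numbers \<open>\<alpha>\<close> would then be a fifth root of a
  rational number, hence rational, since \<open>K\<^sub>s\<close> is totally real for \<open>s \<ge> 100\<close> (\<open>depressed_totally_real\<close>); this contradicts
  unique factorization of integers. So \<open>k + 5\<close> ramified primes yield a subgroup isomorphic to \<open>(\<int>/5\<int>)\<^sup>k\<close>
  (\<open>polya_group_large\<close>).

  Finally, there are infinitely many primes \<open>q\<close> for which the divisibility condition can be met, and for each of them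
  it is a congruence condition on \<open>s\<close> modulo \<open>q ^ 2\<close>. Prescribing \<open>k + 5\<close> of these conditions together with
  parity leaves a whole residue class of integers \<open>s\<close>, which has positive density.
\<close>

section \<open>Algebraic integers\<close>

definition zspan :: "'a::comm_ring_1 set \<Rightarrow> 'a set" where
  "zspan B = {\<Sum>b\<in>B. of_int (n b) * b | n. True}"

lemma zspan_base: "finite B \<Longrightarrow> b \<in> B \<Longrightarrow> b \<in> zspan B"
  unfolding zspan_def
  by (rule CollectI, rule exI[of _ "\<lambda>c. if c = b then 1 else 0"])
     (simp add: if_distrib[of of_int] if_distribR if_distrib[of "\<lambda>x. x * _"] sum.delta cong: if_cong)

lemma zspan_add: "x \<in> zspan B \<Longrightarrow> y \<in> zspan B \<Longrightarrow> x + y \<in> zspan B"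
proof -
  assume "x \<in> zspan B" "y \<in> zspan B"
  then obtain m n where "x = (\<Sum>b\<in>B. of_int (m b) * b)" "y = (\<Sum>b\<in>B. of_int (n b) * b)"
    unfolding zspan_def by auto
  then have "x + y = (\<Sum>b\<in>B. of_int (m b + n b) * b)"
    by (simp add: sum.distrib ring_distribs)
  then show ?thesis unfolding zspan_def
    by (intro CollectI exI[of _ "\<lambda>b. m b + n b"]) auto
qed

lemma zspan_scale: "x \<in> zspan B \<Longrightarrow> of_int k * x \<in> zspan B"
proof -
  assume "x \<in> zspan B"
  then obtain m where "x = (\<Sum>b\<in>B. of_int (m b) * b)"
    unfolding zspan_def by auto
  then have "of_int k * x = (\<Sum>b\<in>B. of_int (k * m b) * b)"
    by (simp add: sum_distrib_left mult.assoc)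
  then show ?thesis unfolding zspan_def
    by (intro CollectI exI[of _ "\<lambda>b. k * m b"]) auto
qed

lemma zspan_0: "0 \<in> zspan B"
  unfolding zspan_def by (rule CollectI, rule exI[of _ "\<lambda>_. 0"]) auto

lemma zspan_sum: "(\<And>i. i \<in> I \<Longrightarrow> f i \<in> zspan B) \<Longrightarrow> (\<Sum>i\<in>I. f i) \<in> zspan B"
  by (induction I rule: infinite_finite_induct) (auto simp: zspan_0 zspan_add)

lemma zspan_mult_closed:
  assumes "x \<in> zspan B" "\<And>b. b \<in> B \<Longrightarrow> c * b \<in> zspan C"
  shows "c * x \<in> zspan C"
proof -
  obtain m where "x = (\<Sum>b\<in>B. of_int (m b) * b)"
    using assms(1) unfolding zspan_def by auto
  then have "c * x = (\<Sum>b\<in>B. of_int (m b) * (c * b))"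
    by (simp add: sum_distrib_left mult_ac)
  then show ?thesis using assms(2) by (auto intro!: zspan_sum zspan_scale)
qed

text \<open>
  Multiplication by \<open>x\<close> acts on the finite generating set through an integer matrix, and the generators form
  an eigenvector for the eigenvalue \<open>x\<close>. The characteristic polynomial of that matrix is monic with
  integer coefficients.
\<close>

lemma algebraic_int_if_stable_zspan:
  fixes x :: "'a::field_char_0"
  assumes fin: "finite B" and nz: "\<exists>b\<in>B. b \<noteq> 0" and stable: "\<And>b. b \<in> B \<Longrightarrow> x * b \<in> zspan B"
  shows "algebraic_int x"
proof -
  define n where "n = card B"
  obtain f where f: "bij_betw f {..<n} B"
    using fin ex_bij_betw_nat_finite[of B] unfolding n_def by (auto simp: atLeast0LessThan)
  have "\<exists>c. \<forall>b\<in>B. x * b = (\<Sum>d\<in>B. of_int (c b d) * d)"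
  proof -
    have "\<forall>b\<in>B. \<exists>m. x * b = (\<Sum>d\<in>B. of_int (m d) * d)"
      using stable unfolding zspan_def by auto
    then show ?thesis by metis
  qed
  then obtain c where c: "\<And>b. b \<in> B \<Longrightarrow> x * b = (\<Sum>d\<in>B. of_int (c b d) * d)" by auto
  define A :: "int mat" where "A = mat n n (\<lambda>(i, j). c (f i) (f j))"
  define A' :: "'a mat" where "A' = map_mat of_int A"
  define v where "v = vec n f"
  have A: "A \<in> carrier_mat n n" unfolding A_def by auto
  have A': "A' \<in> carrier_mat n n" unfolding A'_def using A by auto
  have fB: "i < n \<Longrightarrow> f i \<in> B" for i using f by (auto simp: bij_betw_def)
  have "A' *\<^sub>v v = x \<cdot>\<^sub>v v"
  proof (rule eq_vecI)
    fix i assume "i < dim_vec (x \<cdot>\<^sub>v v)"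
    then have i: "i < n" unfolding v_def by simp
    have "(A' *\<^sub>v v) $ i = (\<Sum>j<n. of_int (c (f i) (f j)) * f j)"
      using i unfolding A'_def A_def v_def
      by (auto simp: scalar_prod_def atLeast0LessThan intro!: sum.cong)
    also have "\<dots> = (\<Sum>d\<in>B. of_int (c (f i) d) * d)"
      by (rule sum.reindex_bij_betw[OF f])
    also have "\<dots> = (x \<cdot>\<^sub>v v) $ i" using c[OF fB[OF i]] i unfolding v_def by simp
    finally show "(A' *\<^sub>v v) $ i = (x \<cdot>\<^sub>v v) $ i" .
  qed (auto simp: A'_def A_def v_def)
  moreover have "v \<noteq> 0\<^sub>v n"
  proof
    assume "v = 0\<^sub>v n"
    then have "\<And>i. i < n \<Longrightarrow> f i = 0" unfolding v_def by (metis index_vec index_zero_vec(1))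
    then show False using nz f by (auto simp: bij_betw_def)
  qed
  ultimately have "eigenvector A' v x"
    unfolding eigenvector_def using A' by (auto simp: v_def)
  then have "poly (char_poly A') x = 0"
    using eigenvalue_root_char_poly[OF A'] unfolding eigenvalue_def by auto
  moreover have "char_poly A' = map_poly of_int (char_poly A)"
    unfolding A'_def by (rule of_int_hom.char_poly_hom[OF A])
  moreover have "lead_coeff (char_poly A) = 1" using degree_monic_char_poly[OF A] by auto
  ultimately show ?thesis unfolding algebraic_int_altdef_ipoly by metis
qed

lemma monic_root_power_expansion:
  fixes x :: "'a::comm_ring_1"
  assumes "poly p x = 0" "lead_coeff p = 1"
  shows "x ^ degree p = - (\<Sum>i<degree p. coeff p i * x ^ i)"
proof -
  have "poly p x = (\<Sum>i\<le>degree p. coeff p i * x ^ i)" by (simp add: poly_altdef)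
  also have "\<dots> = x ^ degree p + (\<Sum>i<degree p. coeff p i * x ^ i)"
    using assms(2) by (simp add: lessThan_Suc_atMost[symmetric])
  finally show ?thesis using assms(1) by (simp add: eq_neg_iff_add_eq_0)
qed

text \<open>
  The products \<open>b * x ^ i\<close> with \<open>i < d\<close> span a module that \<open>x\<close> maps to itself: multiplication by \<open>x\<close>
  raises the exponent, and the monic equation brings the exponent \<open>d\<close> back below \<open>d\<close>. Whatever acted
  on the span of \<open>B\<close> still acts on the larger span, so finitely many algebraic integers can be treated
  one after the other.
\<close>

lemma stable_zspan_adjoin_root:
  fixes x :: "'a::field_char_0"
  assumes B: "finite B" "\<exists>b\<in>B. b \<noteq> 0" and d: "d > 0"
    and coeffs: "\<And>i b. i < d \<Longrightarrow> b \<in> B \<Longrightarrow> a i * b \<in> zspan B"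
    and root: "x ^ d = (\<Sum>i<d. a i * x ^ i)"
  defines "C \<equiv> (\<lambda>(b, i). b * x ^ i) ` (B \<times> {..<d})"
  shows "finite C" "\<exists>b\<in>C. b \<noteq> 0" "\<And>b. b \<in> C \<Longrightarrow> x * b \<in> zspan C"
    "\<And>c. (\<And>b. b \<in> B \<Longrightarrow> c * b \<in> zspan B) \<Longrightarrow> (\<And>b. b \<in> C \<Longrightarrow> c * b \<in> zspan C)"
proof -
  show finC: "finite C" unfolding C_def using B by auto
  obtain b where "b \<in> B" "b \<noteq> 0" using B by auto
  then have "b * x ^ 0 \<in> C" unfolding C_def using d by (intro image_eqI[of _ _ "(b, 0)"]) auto
  then show "\<exists>b\<in>C. b \<noteq> 0" using \<open>b \<noteq> 0\<close> by auto
  have pw: "x ^ i * y \<in> zspan C" if "i < d" "y \<in> zspan B" for i y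
  proof (rule zspan_mult_closed[OF that(2)])
    fix b assume "b \<in> B"
    then show "x ^ i * b \<in> zspan C"
      using that(1) finC by (intro zspan_base) (auto simp: C_def mult.commute intro!: image_eqI[of _ _ "(b, i)"])
  qed
  show "c * b \<in> zspan C" if c: "\<And>b. b \<in> B \<Longrightarrow> c * b \<in> zspan B" and "b \<in> C" for b c
  proof -
    obtain b' i where b: "b = b' * x ^ i" "b' \<in> B" "i < d" using \<open>b \<in> C\<close> unfolding C_def by auto
    have "x ^ i * (c * b') \<in> zspan C" using c b by (intro pw) auto
    then show ?thesis unfolding b by (simp add: mult_ac)
  qed
  show "x * b \<in> zspan C" if "b \<in> C" for b
  proof -
    obtain b' i where b: "b = b' * x ^ i" "b' \<in> B" "i < d" using \<open>b \<in> C\<close> unfolding C_def by auto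
    show ?thesis
    proof (cases "Suc i < d")
      case True
      then have "x ^ Suc i * b' \<in> zspan C" using b B by (intro pw zspan_base) auto
      then show ?thesis unfolding b by (simp add: mult_ac)
    next
      case False
      then have "Suc i = d" using b by auto
      then have "x * b = x ^ d * b'" unfolding b by (auto simp: mult_ac)
      also have "\<dots> = (\<Sum>i<d. x ^ i * (a i * b'))"
        unfolding root sum_distrib_right by (simp add: mult_ac)
      also have "\<dots> \<in> zspan C" using coeffs b by (intro zspan_sum pw) auto
      finally show ?thesis .
    qed
  qed
qed

text \<open>
  One finite module serves all elements of \<open>S\<close> simultaneously. Sums and products of elements of \<open>S\<close> then
  act on it as well, which is how they inherit integrality.
\<close>

lemma algebraic_ints_stable_zspan:
  fixes S :: "'a::field_char_0 set"
  assumes "finite S" "\<And>x. x \<in> S \<Longrightarrow> algebraic_int x"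
  shows "\<exists>B. finite B \<and> (\<exists>b\<in>B. b \<noteq> 0) \<and> (\<forall>x\<in>S. \<forall>b\<in>B. x * b \<in> zspan B)"
  using assms
proof (induction S rule: finite_induct)
  case empty
  show ?case by (rule exI[of _ "{1}"]) auto
next
  case (insert x S)
  then obtain B where B: "finite B" "\<exists>b\<in>B. b \<noteq> 0" "\<And>y b. y \<in> S \<Longrightarrow> b \<in> B \<Longrightarrow> y * b \<in> zspan B"
    by auto
  obtain p where p: "poly (map_poly of_int p) x = 0" "lead_coeff p = 1"
    using insert.prems[of x] unfolding algebraic_int_altdef_ipoly by auto
  define d where "d = degree p"
  have "d > 0"
  proof (rule ccontr)
    assume "\<not> d > 0"
    then obtain c where "p = [:c:]" unfolding d_def using degree_eq_zeroE by blast
    then show False using p by auto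
  qed
  have root: "x ^ d = (\<Sum>i<d. of_int (- coeff p i) * x ^ i)"
    using monic_root_power_expansion[OF p(1)] p(2)
    by (simp add: d_def degree_map_poly coeff_map_poly sum_negf)
  have co: "of_int (- coeff p i) * b \<in> zspan B" if "b \<in> B" for i b
    using that B(1) zspan_base zspan_scale by blast
  note C = stable_zspan_adjoin_root[OF B(1,2) \<open>d > 0\<close> co root]
  show ?case
    by (rule exI[of _ "(\<lambda>(b, i). b * x ^ i) ` (B \<times> {..<d})"])
       (use C B(3) in blast)
qed

lemma algebraic_int_root_of_algebraic_ints:
  fixes x :: "'a::field_char_0"
  assumes "\<And>i. i < d \<Longrightarrow> algebraic_int (a i)" "d > 0" "x ^ d = (\<Sum>i<d. a i * x ^ i)"
  shows "algebraic_int x"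
proof -
  obtain B where B: "finite B" "\<exists>b\<in>B. b \<noteq> 0" "\<forall>y\<in>a ` {..<d}. \<forall>b\<in>B. y * b \<in> zspan B"
    using algebraic_ints_stable_zspan[of "a ` {..<d}"] assms(1) by auto
  have "a i * b \<in> zspan B" if "i < d" "b \<in> B" for i b using B(3) that by simp
  note C = stable_zspan_adjoin_root(1-3)[OF B(1,2) assms(2) this assms(3)]
  show ?thesis by (rule algebraic_int_if_stable_zspan[OF C])
qed

lemma
  fixes x y :: "'a::field_char_0"
  assumes "algebraic_int x" "algebraic_int y"
  shows algebraic_int_plus: "algebraic_int (x + y)"
    and algebraic_int_times: "algebraic_int (x * y)"
proof -
  obtain B where B: "finite B" "\<exists>b\<in>B. b \<noteq> 0" "\<forall>z\<in>{x, y}. \<forall>b\<in>B. z * b \<in> zspan B"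
    using algebraic_ints_stable_zspan[of "{x, y}"] assms by auto
  show "algebraic_int (x + y)"
    by (rule algebraic_int_if_stable_zspan[OF B(1,2)]) (use B(3) in \<open>auto simp: ring_distribs intro!: zspan_add\<close>)
  show "algebraic_int (x * y)"
  proof (rule algebraic_int_if_stable_zspan[OF B(1,2)])
    fix b assume "b \<in> B"
    then have "x * (y * b) \<in> zspan B" using B(3) by (intro zspan_mult_closed[of "y * b" B]) auto
    then show "x * y * b \<in> zspan B" by (simp add: mult.assoc)
  qed
qed

lemma algebraic_int_diff:
  "algebraic_int x \<Longrightarrow> algebraic_int y \<Longrightarrow> algebraic_int (x - y :: 'a::field_char_0)"
  using algebraic_int_plus[of x "- y"] by auto

lemma algebraic_int_sum:
  "(\<And>i. i \<in> I \<Longrightarrow> algebraic_int (f i :: 'a::field_char_0)) \<Longrightarrow> algebraic_int (\<Sum>i\<in>I. f i)"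
  by (induction I rule: infinite_finite_induct) (auto intro: algebraic_int_plus)

lemma algebraic_int_prod:
  "(\<And>i. i \<in> I \<Longrightarrow> algebraic_int (f i :: 'a::field_char_0)) \<Longrightarrow> algebraic_int (\<Prod>i\<in>I. f i)"
  by (induction I rule: infinite_finite_induct) (auto intro: algebraic_int_times)

lemma algebraic_int_power: "algebraic_int x \<Longrightarrow> algebraic_int (x ^ n :: 'a::field_char_0)"
  by (induction n) (auto intro: algebraic_int_times)

lemma algebraic_int_poly:
  fixes x :: "'a::field_char_0"
  assumes "\<And>i. algebraic_int (coeff p i)" "algebraic_int x"
  shows "algebraic_int (poly p x)"
  unfolding poly_altdef
  by (intro algebraic_int_sum algebraic_int_times algebraic_int_power assms)

lemma algebraic_int_coeff_mult:
  fixes p q :: "'a::field_char_0 poly"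
  assumes "\<And>i. algebraic_int (coeff p i)" "\<And>i. algebraic_int (coeff q i)"
  shows "algebraic_int (coeff (p * q) i)"
  unfolding coeff_mult by (intro algebraic_int_sum algebraic_int_times assms)

section \<open>Dedekind's Prague theorem\<close>

text \<open>
  Multiplying \<open>h(x) = 0\<close> by \<open>c ^ (d - 1)\<close>, where \<open>c\<close> is the leading coefficient and \<open>d\<close> the degree,
  gives a monic equation for \<open>c * x\<close>.
\<close>

lemma algebraic_int_lead_coeff_mult_root:
  fixes x :: "'a::field_char_0"
  assumes "\<And>i. algebraic_int (coeff h i)" "poly h x = 0" "h \<noteq> 0"
  shows "algebraic_int (lead_coeff h * x)"
proof -
  define c where "c = lead_coeff h"
  define d where "d = degree h"
  have "d > 0"
  proof (rule ccontr)
    assume "\<not> d > 0"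
    then obtain c where "h = [:c:]" unfolding d_def using degree_eq_zeroE by blast
    then show False using assms by auto
  qed
  have top: "c * x ^ d * c ^ (d - 1) = (c * x) ^ d"
    using \<open>d > 0\<close> by (cases d) (auto simp: power_mult_distrib)
  have "0 = poly h x * c ^ (d - 1)" using assms by simp
  also have "\<dots> = (\<Sum>i\<le>d. coeff h i * x ^ i * c ^ (d - 1))"
    by (simp add: poly_altdef d_def sum_distrib_right)
  also have "\<dots> = (c * x) ^ d + (\<Sum>i<d. coeff h i * x ^ i * c ^ (d - 1))"
    unfolding lessThan_Suc_atMost[symmetric] using top by (simp add: c_def d_def)
  also have "(\<Sum>i<d. coeff h i * x ^ i * c ^ (d - 1)) =
      - (\<Sum>i<d. - (coeff h i * c ^ (d - 1 - i)) * (c * x) ^ i)"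
    unfolding sum_negf[symmetric]
  proof (rule sum.cong)
    fix i assume "i \<in> {..<d}"
    then have "c ^ (d - 1) = c ^ (d - 1 - i) * c ^ i" by (simp flip: power_add)
    then show "coeff h i * x ^ i * c ^ (d - 1)
        = - (- (coeff h i * c ^ (d - 1 - i)) * (c * x) ^ i)"
      by (simp add: power_mult_distrib mult_ac)
  qed simp
  finally have "(c * x) ^ d = (\<Sum>i<d. - (coeff h i * c ^ (d - 1 - i)) * (c * x) ^ i)"
    by simp
  then have "algebraic_int (c * x)"
    by (rule algebraic_int_root_of_algebraic_ints[rotated 2])
       (use \<open>d > 0\<close> assms in \<open>auto simp: c_def intro!: algebraic_int_times algebraic_int_power\<close>)
  then show ?thesis unfolding c_def .
qed

text \<open>
  Let \<open>c\<close> be the leading coefficient of \<open>k\<close>. Both \<open>c\<close> and \<open>c * r\<close> are algebraic integers, so subtracting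
  \<open>c * X ^ deg k\<close> from \<open>k\<close> preserves the hypothesis and lowers the degree.
\<close>

lemma algebraic_int_coeffs_cancel_linear:
  fixes k :: "'a::field_char_0 poly"
  assumes "\<And>i. algebraic_int (coeff ([:- r, 1:] * k) i)"
  shows "algebraic_int (coeff k i)"
  using assms
proof (induction "degree k" arbitrary: k i rule: less_induct)
  case less
  show ?case
  proof (cases "k = 0")
    case False
    define c where "c = lead_coeff k"
    define t where "t = monom c (degree k)"
    have lc: "lead_coeff ([:- r, 1:] * k) = c" unfolding lead_coeff_mult c_def by simp
    have "poly ([:- r, 1:] * k) r = 0" by simp
    moreover have "[:- r, 1:] * k \<noteq> 0"
      using False by (metis mult_eq_0_iff pCons_eq_0_iff one_neq_zero)
    ultimately have cr: "algebraic_int (c * r)"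
      using algebraic_int_lead_coeff_mult_root[OF less.prems, of r] unfolding lc by simp
    have c: "algebraic_int c" using less.prems lc by metis
    have "[:- r, 1:] * t = monom (- (c * r)) (degree k) + monom c (Suc (degree k))"
      by (simp add: t_def smult_monom monom_Suc mult.commute)
    then have t: "algebraic_int (coeff ([:- r, 1:] * t) i)" for i
      using c cr by simp
    have "algebraic_int (coeff ([:- r, 1:] * (k - t)) i)" for i
      unfolding right_diff_distrib coeff_diff by (intro algebraic_int_diff less.prems t)
    moreover have "k - t = 0 \<or> degree (k - t) < degree k"
    proof (cases "degree k = 0")
      case True
      then obtain e where "k = [:e:]" using degree_eq_zeroE by blast
      then show ?thesis by (simp add: t_def c_def monom_0)
    next
      case False
      have "degree (k - t) \<le> degree k" unfolding t_def
        by (intro degree_diff_le) (auto simp: degree_monom_le)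
      moreover have "coeff (k - t) (degree k) = 0" by (simp add: t_def c_def)
      ultimately show ?thesis by (metis leading_coeff_0_iff order_le_imp_less_or_eq)
    qed
    ultimately have "algebraic_int (coeff (k - t) i)"
      using less.hyps[of "k - t" i] algebraic_int_0 coeff_0 by metis
    then have "algebraic_int (coeff (k - t) i + coeff t i)"
      by (rule algebraic_int_plus) (use c in \<open>auto simp: t_def\<close>)
    then show ?thesis by simp
  qed auto
qed

text \<open>
  Induction on the degree of \<open>f\<close>. Split off a root, \<open>f = (X - r) * k\<close>. Then \<open>k * g\<close> has integral
  coefficients, and so has \<open>r * k * g = X * k * g - f * g\<close>. The induction hypothesis for the pairs \<open>(k, g)\<close>
  and \<open>(k, r * g)\<close> gives the integrality of \<open>k_i * g_j\<close> and \<open>r * k_i * g_j\<close>, whose differences are the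
  products \<open>f_i * g_j\<close>.
\<close>

theorem dedekind_prague:
  fixes f g :: "complex poly"
  assumes "\<And>i. algebraic_int (coeff (f * g) i)"
  shows "algebraic_int (coeff f i * coeff g j)"
  using assms
proof (induction "degree f" arbitrary: f g i j)
  case 0
  then obtain c where f: "f = [:c:]" by (metis degree_eq_zeroE)
  show ?case using 0(2)[of j] unfolding f by (cases i) auto
next
  case (Suc d)
  obtain r where r: "poly f r = 0"
    using Suc(2) by (metis constant_degree fundamental_theorem_of_algebra nat.distinct(1))
  then obtain k where k: "f = [:- r, 1:] * k" by (metis dvdE poly_eq_0_iff_dvd)
  have "k \<noteq> 0" using Suc(2) k by auto
  then have "degree f = degree [:- r, 1:] + degree k" unfolding k by (intro degree_mult_eq) auto
  then have dk: "d = degree k" using Suc(2) by simp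
  have kg: "algebraic_int (coeff (k * g) i)" for i
    using Suc(3) unfolding k mult.assoc by (rule algebraic_int_coeffs_cancel_linear)
  have "algebraic_int (coeff (k * smult r g) i)" for i
  proof -
    have "k * smult r g = pCons 0 (k * g) - f * g" unfolding k by (simp add: left_diff_distrib)
    then show ?thesis
      using algebraic_int_diff[OF _ Suc(3)] kg by (auto simp: coeff_pCons split: nat.splits)
  qed
  then have rkg: "algebraic_int (coeff k i * (r * coeff g j))" for i j
    using Suc(1)[OF dk, of "smult r g" i j] by simp
  have kg': "algebraic_int (coeff k i * coeff g j)" for i j
    by (rule Suc(1)[OF dk kg])
  have f: "f = pCons 0 k - smult r k" unfolding k by simp
  have "algebraic_int (coeff (pCons 0 k) i * coeff g j)"
    using kg' by (cases i) auto
  from algebraic_int_diff[OF this rkg[of i j]]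
  show ?case unfolding f by (simp add: algebra_simps)
qed

hide_const (open) Divisibility.prime

interpretation of_rat_poly_hom: map_poly_inj_idom_hom of_rat ..

section \<open>The number field generated by a root\<close>

definition ev :: "complex \<Rightarrow> rat poly \<Rightarrow> complex" where
  "ev z R = poly (map_poly of_rat R) z"

lemma ev_simps [simp]:
  "ev z (R + S) = ev z R + ev z S" "ev z (R - S) = ev z R - ev z S"
  "ev z (- R) = - ev z R" "ev z (R * S) = ev z R * ev z S"
  "ev z 0 = 0" "ev z 1 = 1" "ev z [:c:] = of_rat c" "ev z (smult c R) = of_rat c * ev z R"
  "ev z (R ^ k) = ev z R ^ k" "ev z [:0, 1:] = z"
  unfolding ev_def
  by (simp_all add: of_rat_poly_hom.hom_add of_rat_poly_hom.hom_minus of_rat_poly_hom.hom_uminus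
      of_rat_poly_hom.hom_mult of_rat_hom.map_poly_hom_smult of_rat_poly_hom.hom_power of_rat_hom.map_poly_pCons_hom)

lemma ev_of_int: "ev z (map_poly of_int P) = poly (map_poly of_int P) z"
  unfolding ev_def by (simp add: map_poly_map_poly o_def)

lemma ev_pcompose: "ev z (pcompose P R) = ev (ev z R) P"
  unfolding ev_def by (simp add: of_rat_hom.map_poly_pcompose poly_pcompose)

lemma common_denominator:
  fixes R :: "rat poly"
  obtains d :: int and P :: "int poly" where "d > 0" "map_poly of_int P = smult (of_int d) R"
proof -
  have "\<exists>d>0. \<exists>P. map_poly of_int P = smult (of_int d :: rat) R"
  proof (induction R)
    case 0
    show ?case by (intro exI[of _ 1] conjI exI[of _ 0]) auto
  next
    case (pCons a R)
    then obtain d P where d: "d > 0" "map_poly of_int P = smult (of_int d :: rat) R" by auto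
    obtain u v where a: "a = of_int u / of_int v" "v > 0" by (metis quotient_of_denom_pos' quotient_of_div surj_pair prod.collapse)
    show ?case
      by (rule exI[of _ "d * v"], intro conjI exI[of _ "pCons (d * u) (smult v P)"])
         (use d a in \<open>auto simp: of_int_hom.map_poly_pCons_hom of_int_hom.map_poly_hom_smult mult_ac\<close>)
  qed
  then show ?thesis using that by blast
qed

text \<open>
  A nonzero algebraic integer divides a nonzero integer inside \<open>\<int>[x]\<close>: the constant coefficient of an
  integer polynomial that vanishes at \<open>x\<close> and not at \<open>0\<close>.
\<close>

lemma algebraic_int_cofactor:
  fixes x :: "'a::field_char_0"
  assumes "algebraic_int x" "x \<noteq> 0"
  obtains P :: "int poly" and N :: int where "N \<noteq> 0" "x * poly (map_poly of_int P) x = of_int N"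
proof -
  have "\<exists>P N. N \<noteq> 0 \<and> x * poly (map_poly of_int P) x = of_int N"
    if "p \<noteq> 0" "poly (map_poly of_int p) x = 0" for p :: "int poly"
    using that
  proof (induction p)
    case (pCons a p)
    show ?case
    proof (cases "a = 0")
      case True
      then show ?thesis using pCons assms(2) by (auto simp: of_int_hom.map_poly_pCons_hom)
    next
      case False
      have "x * poly (map_poly of_int p) x = of_int (- a)"
        using pCons(4) by (simp add: of_int_hom.map_poly_pCons_hom add_eq_0_iff)
      then show ?thesis using False by (intro exI[of _ p] exI[of _ "- a"]) auto
    qed
  qed auto
  moreover obtain p where "poly (map_poly of_int p) x = 0" "lead_coeff p = 1"
    using assms(1) unfolding algebraic_int_altdef_ipoly by auto
  ultimately show ?thesis using that by (metis leading_coeff_0_iff zero_neq_one)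
qed

lemma of_real_of_rat: "of_real (of_rat r) = (of_rat r :: complex)"
proof -
  obtain u v where r: "r = of_int u / of_int v"
    by (metis quotient_of_div surj_pair)
  show ?thesis unfolding r of_rat_divide by simp
qed

lemma algebraic_int_of_int_poly:
  "algebraic_int (x :: 'a::field_char_0) \<Longrightarrow> algebraic_int (poly (map_poly of_int P) x)"
  by (rule algebraic_int_poly) auto

lemma complex_field_simps:
  "\<one>\<^bsub>complex_field\<^esub> = 1" "\<zero>\<^bsub>complex_field\<^esub> = 0"
  "x \<otimes>\<^bsub>complex_field\<^esub> y = x * y" "x \<oplus>\<^bsub>complex_field\<^esub> y = x + y"
  "\<ominus>\<^bsub>complex_field\<^esub> x = - x" "x \<noteq> 0 \<Longrightarrow> inv\<^bsub>complex_field\<^esub> x = inverse x"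
proof -
  interpret C: field complex_field by (rule field_from_type_algebra)
  have ops [simp]: "carrier complex_field = UNIV" "\<one>\<^bsub>complex_field\<^esub> = 1" "\<zero>\<^bsub>complex_field\<^esub> = 0"
    "x \<otimes>\<^bsub>complex_field\<^esub> y = x * y" "x \<oplus>\<^bsub>complex_field\<^esub> y = x + y" for x y
    by (simp_all add: ring_of_type_algebra_def)
  show "\<one>\<^bsub>complex_field\<^esub> = 1" "\<zero>\<^bsub>complex_field\<^esub> = 0"
    "x \<otimes>\<^bsub>complex_field\<^esub> y = x * y" "x \<oplus>\<^bsub>complex_field\<^esub> y = x + y" by simp_all
  show "\<ominus>\<^bsub>complex_field\<^esub> x = - x" using C.minus_equality[of "- x" x] by simp
  show "inv\<^bsub>complex_field\<^esub> x = inverse x" if "x \<noteq> 0"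
    using C.comm_inv_char[of x "inverse x"] that by simp
qed

lemma rat_adjoin_closed:
  "1 \<in> rat_adjoin z" "z \<in> rat_adjoin z"
  "x \<in> rat_adjoin z \<Longrightarrow> y \<in> rat_adjoin z \<Longrightarrow> x + y \<in> rat_adjoin z"
  "x \<in> rat_adjoin z \<Longrightarrow> y \<in> rat_adjoin z \<Longrightarrow> x * y \<in> rat_adjoin z"
  "x \<in> rat_adjoin z \<Longrightarrow> - x \<in> rat_adjoin z"
  "x \<in> rat_adjoin z \<Longrightarrow> x \<noteq> 0 \<Longrightarrow> inverse x \<in> rat_adjoin z"
  unfolding rat_adjoin_def
  using generate_field.one[where R = complex_field and H = "{z}"]
    generate_field.incl[where R = complex_field and H = "{z}" and h = z]
    generate_field.eng_add[where R = complex_field and H = "{z}" and ?h1.0 = x and ?h2.0 = y]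
    generate_field.eng_mult[where R = complex_field and H = "{z}" and ?h1.0 = x and ?h2.0 = y]
    generate_field.a_inv[where R = complex_field and H = "{z}" and h = x]
    generate_field.m_inv[where R = complex_field and H = "{z}" and h = x]
  by (simp_all add: complex_field_simps)

lemma rat_adjoin_of_rat: "of_rat r \<in> rat_adjoin z"
proof -
  have 0: "0 \<in> rat_adjoin z"
    using rat_adjoin_closed(1)[of z] rat_adjoin_closed(3)[of 1 z "- 1"] rat_adjoin_closed(5)[of 1 z] by simp
  have nat: "of_nat m \<in> rat_adjoin z" for m by (induction m) (auto intro: 0 rat_adjoin_closed)
  have int: "of_int k \<in> rat_adjoin z" for k
    by (cases k) (auto intro: nat rat_adjoin_closed simp del: of_nat_Suc)
  obtain u v where r: "r = of_int u / of_int v" "v > 0"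
    by (metis quotient_of_denom_pos' quotient_of_div surj_pair prod.collapse)
  have "of_rat r = (of_int u :: complex) / of_int v"
    unfolding r(1) of_rat_divide of_rat_of_int_eq ..
  then have "of_rat r = of_int u * inverse (of_int v :: complex)" by (simp only: divide_inverse)
  then show ?thesis using rat_adjoin_closed(4,6) int r(2) by simp
qed

text \<open>
  A number field given by a generator \<open>\<eta>\<close>. The assumption \<open>minimal\<close> says that \<open>F\<close> is the minimal
  polynomial of \<open>\<eta>\<close>; it is phrased with degrees because a descent on integer polynomials proves it in
  this form for Eisenstein polynomials.
\<close>

locale number_field_root =
  fixes F :: "int poly" and \<eta> :: complex
  assumes monic: "lead_coeff F = 1"
    and root: "poly (map_poly of_int F) \<eta> = 0"
    and minimal: "\<And>R. degree R < degree F \<Longrightarrow> ev \<eta> R = 0 \<Longrightarrow> R = 0"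
    and separable: "card {z::complex. poly (map_poly of_int F) z = 0} = degree F"
begin

definition K :: "complex set" where "K = range (ev \<eta>)"

abbreviation OK :: "complex set" where "OK \<equiv> ring_of_integers K"

abbreviation n :: nat where "n \<equiv> degree F"

definition Z :: "complex set" where "Z = {z. poly (map_poly of_int F) z = 0}"

lemma F_nonzero: "F \<noteq> 0" using monic by auto

lemma degree_pos: "n > 0"
proof (rule ccontr)
  assume "\<not> n > 0"
  then obtain c where "F = [:c:]" using degree_eq_zeroE by blast
  then show False using monic root by auto
qed

lemma root_in_Z: "\<eta> \<in> Z" using root by (simp add: Z_def)

lemma finite_Z: "finite Z" and card_Z: "card Z = n"
  using separable degree_pos by (auto simp: Z_def card_ge_0_finite)

lemma algebraic_int_Z: "z \<in> Z \<Longrightarrow> algebraic_int z"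
  unfolding algebraic_int_altdef_ipoly Z_def using monic by auto

lemma reduced_representative: "\<exists>S. degree S < n \<and> (\<forall>z\<in>Z. ev z S = ev z R)"
proof -
  define G :: "rat poly" where "G = map_poly of_int F"
  have dG: "degree G = n" unfolding G_def by (simp add: degree_map_poly)
  have "G \<noteq> 0" using dG degree_pos by auto
  have "ev z G = 0" if "z \<in> Z" for z using that unfolding G_def ev_of_int Z_def by simp
  then have "ev z (R div G * G + R mod G) = ev z (R mod G)" if "z \<in> Z" for z
    using that by (simp only: ev_simps) simp
  then have "\<forall>z\<in>Z. ev z (R mod G) = ev z R" by simp
  moreover have "degree (R mod G) < n"
    using degree_mod_less[OF \<open>G \<noteq> 0\<close>, of R] dG degree_pos by auto
  ultimately show ?thesis by blast
qed

text \<open>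
  Since \<open>F\<close> is the minimal polynomial of \<open>\<eta>\<close>, a polynomial identity at \<open>\<eta>\<close> holds at every root of \<open>F\<close>. This
  makes the embeddings of \<open>K\<close> well defined.
\<close>

lemma ev_eq_transfer:
  assumes "ev \<eta> R = ev \<eta> S" "z \<in> Z"
  shows "ev z R = ev z S"
proof -
  obtain T where T: "degree T < n" "\<forall>z\<in>Z. ev z T = ev z (R - S)"
    using reduced_representative by blast
  have "ev \<eta> T = 0" using bspec[OF T(2) root_in_Z] assms(1) by simp
  then have "T = 0" by (rule minimal[OF T(1)])
  then show ?thesis using bspec[OF T(2) assms(2)] by simp
qed

lemma K_representative:
  assumes "x \<in> K"
  obtains R where "degree R < n" "ev \<eta> R = x"
proof -
  obtain R where "ev \<eta> R = x" using assms unfolding K_def by auto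
  moreover obtain S where "degree S < n" "\<forall>z\<in>Z. ev z S = ev z R"
    using reduced_representative by blast
  ultimately show ?thesis using root_in_Z by (intro that[of S]) auto
qed

lemma K_closed:
  "0 \<in> K" "1 \<in> K" "of_rat r \<in> K" "of_int k \<in> K" "of_nat m \<in> K" "\<eta> \<in> K"
  "x \<in> K \<Longrightarrow> - x \<in> K"
  "x \<in> K \<Longrightarrow> y \<in> K \<Longrightarrow> x + y \<in> K"
  "x \<in> K \<Longrightarrow> y \<in> K \<Longrightarrow> x - y \<in> K"
  "x \<in> K \<Longrightarrow> y \<in> K \<Longrightarrow> x * y \<in> K"
  "x \<in> K \<Longrightarrow> x ^ m \<in> K"
proof -
  have im: "ev \<eta> R \<in> K" for R unfolding K_def by simp
  show r: "of_rat r \<in> K" for r using im[of "[:r:]"] by simp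
  show "0 \<in> K" "1 \<in> K" "of_int k \<in> K" "of_nat m \<in> K"
    using r[of 0] r[of 1] r[of "of_int k"] r[of "of_nat m"] by auto
  show "\<eta> \<in> K" using im[of "[:0, 1:]"] by simp
  show "- x \<in> K" if x: "x \<in> K"
  proof -
    obtain R where "x = ev \<eta> R" using x unfolding K_def by auto
    then show ?thesis using im[of "- R"] by simp
  qed
  show "x ^ m \<in> K" if x: "x \<in> K"
  proof -
    obtain R where "x = ev \<eta> R" using x unfolding K_def by auto
    then show ?thesis using im[of "R ^ m"] by simp
  qed
  assume "x \<in> K" "y \<in> K"
  then obtain R S where "x = ev \<eta> R" "y = ev \<eta> S" unfolding K_def by auto
  then show "x + y \<in> K" "x - y \<in> K" "x * y \<in> K"
    using im[of "R + S"] im[of "R - S"] im[of "R * S"] by simp_all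
qed

lemma K_sum: "(\<And>i. i \<in> I \<Longrightarrow> f i \<in> K) \<Longrightarrow> sum f I \<in> K"
  by (induction I rule: infinite_finite_induct) (auto intro: K_closed)

lemma K_prod: "(\<And>i. i \<in> I \<Longrightarrow> f i \<in> K) \<Longrightarrow> prod f I \<in> K"
  by (induction I rule: infinite_finite_induct) (auto intro: K_closed)

lemma OK_iff: "x \<in> OK \<longleftrightarrow> x \<in> K \<and> algebraic_int x"
  by (simp add: ring_of_integers_def)

lemma OK_closed:
  "0 \<in> OK" "1 \<in> OK" "of_int k \<in> OK" "of_nat m \<in> OK" "\<eta> \<in> OK"
  "x \<in> OK \<Longrightarrow> - x \<in> OK"
  "x \<in> OK \<Longrightarrow> y \<in> OK \<Longrightarrow> x + y \<in> OK"
  "x \<in> OK \<Longrightarrow> y \<in> OK \<Longrightarrow> x - y \<in> OK"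
  "x \<in> OK \<Longrightarrow> y \<in> OK \<Longrightarrow> x * y \<in> OK"
  "x \<in> OK \<Longrightarrow> x ^ m \<in> OK"
  using algebraic_int_Z[OF root_in_Z]
  by (auto simp: OK_iff intro: K_closed algebraic_int_plus algebraic_int_times algebraic_int_diff algebraic_int_power)

lemma OK_subset_K: "OK \<subseteq> K" by (auto simp: OK_iff)

lemma OK_sum: "(\<And>i. i \<in> I \<Longrightarrow> f i \<in> OK) \<Longrightarrow> sum f I \<in> OK"
  by (induction I rule: infinite_finite_induct) (auto intro: OK_closed)

lemma OK_prod: "(\<And>i. i \<in> I \<Longrightarrow> f i \<in> OK) \<Longrightarrow> prod f I \<in> OK"
  by (induction I rule: infinite_finite_induct) (auto intro: OK_closed)

lemma OK_int_poly: "x \<in> OK \<Longrightarrow> poly (map_poly of_int P) x \<in> OK"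
  unfolding poly_altdef by (intro OK_sum OK_closed) (auto intro: OK_closed simp: coeff_map_poly)

lemma OK_cofactor:
  assumes "x \<in> OK" "x \<noteq> 0"
  obtains y N where "y \<in> OK" "N \<noteq> 0" "x * y = of_int N"
  using assms algebraic_int_cofactor[of x] OK_int_poly unfolding OK_iff by metis

lemma K_integral_multiple:
  assumes "x \<in> K"
  obtains d :: int where "d > 0" "of_int d * x \<in> OK"
proof -
  obtain R where R: "ev \<eta> R = x" using assms unfolding K_def by auto
  obtain d P where d: "d > 0" "map_poly of_int P = smult (of_int d) R"
    using common_denominator by blast
  have "of_int d * x = ev \<eta> (smult (of_int d) R)" using R by simp
  also have "\<dots> = poly (map_poly of_int P) \<eta>" unfolding d(2)[symmetric] by (rule ev_of_int)
  also have "\<dots> \<in> OK" by (intro OK_int_poly OK_closed)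
  finally show ?thesis using d(1) that by blast
qed

lemma K_inverse:
  assumes "x \<in> K"
  shows "inverse x \<in> K"
proof (cases "x = 0")
  case False
  obtain d :: int where d: "d > 0" "of_int d * x \<in> OK" using K_integral_multiple[OF assms] .
  then obtain y N where y: "y \<in> OK" "N \<noteq> 0" "of_int d * x * y = of_int N"
    using OK_cofactor[of "of_int d * x"] False by auto
  then have "x * (of_int d * y * of_rat (1 / of_int N)) = 1"
    by (simp add: of_rat_divide field_simps)
  then have "inverse x = of_int d * y * of_rat (1 / of_int N)" by (metis inverse_unique)
  moreover have "\<dots> \<in> K" using y(1) OK_iff by (intro K_closed) auto
  ultimately show ?thesis by simp
qed (simp add: K_closed)

lemma K_divide: "x \<in> K \<Longrightarrow> y \<in> K \<Longrightarrow> x / y \<in> K"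
  unfolding divide_inverse by (intro K_closed K_inverse)

lemma rat_adjoin_subset:
  assumes "x \<in> K"
  shows "rat_adjoin x \<subseteq> K"
proof
  fix y assume "y \<in> rat_adjoin x"
  then have "y \<in> generate_field complex_field {x}" by (simp add: rat_adjoin_def)
  then show "y \<in> K"
    by induction (auto simp: complex_field_simps assms intro: K_closed K_inverse)
qed

lemma K_subset_rat_adjoin:
  assumes "\<eta> \<in> rat_adjoin x"
  shows "K \<subseteq> rat_adjoin x"
proof -
  have "ev \<eta> R \<in> rat_adjoin x" for R
  proof (induction R)
    case 0
    show ?case using rat_adjoin_of_rat[of 0 x] by simp
  next
    case (pCons a R)
    have "ev \<eta> (pCons a R) = of_rat a + \<eta> * ev \<eta> R" by (simp add: ev_def of_rat_hom.map_poly_pCons_hom)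
    then show ?case using pCons rat_adjoin_of_rat rat_adjoin_closed(3,4) assms by simp
  qed
  then show ?thesis unfolding K_def by auto
qed

subsection \<open>Conjugates\<close>

text \<open>
  The field embedding that sends \<open>\<eta>\<close> to the root \<open>z\<close>; by \<open>ev_eq_transfer\<close> the chosen representative does
  not matter.
\<close>

definition embed :: "complex \<Rightarrow> complex \<Rightarrow> complex" where
  "embed z x = ev z (SOME R. ev \<eta> R = x)"

lemma embed_ev: "z \<in> Z \<Longrightarrow> embed z (ev \<eta> R) = ev z R"
  unfolding embed_def by (rule ev_eq_transfer, rule someI) auto

lemma embed_hom:
  assumes z: "z \<in> Z"
  shows "embed z (of_rat r) = of_rat r"
    "x \<in> K \<Longrightarrow> y \<in> K \<Longrightarrow> embed z (x * y) = embed z x * embed z y"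
proof -
  show "embed z (of_rat r) = of_rat r" using embed_ev[OF z, of "[:r:]"] by simp
  assume "x \<in> K" "y \<in> K"
  then obtain R S where "x = ev \<eta> R" "y = ev \<eta> S" unfolding K_def by auto
  then show "embed z (x * y) = embed z x * embed z y"
    using embed_ev[OF z, of "R * S"] embed_ev[OF z, of R] embed_ev[OF z, of S] by simp
qed

lemma embed_1: "z \<in> Z \<Longrightarrow> embed z 1 = 1"
  using embed_hom(1)[of z 1] by simp

lemma embed_nonzero: "z \<in> Z \<Longrightarrow> x \<in> K \<Longrightarrow> x \<noteq> 0 \<Longrightarrow> embed z x \<noteq> 0"
  using embed_hom(2)[of z x "inverse x"] K_inverse embed_1 by auto

lemma embed_inverse: "z \<in> Z \<Longrightarrow> x \<in> K \<Longrightarrow> x \<noteq> 0 \<Longrightarrow> embed z (inverse x) = inverse (embed z x)"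
  using embed_hom(2)[of z x "inverse x"] K_inverse embed_1 by (simp add: inverse_unique)

lemma algebraic_int_embed:
  assumes "z \<in> Z" "x \<in> OK"
  shows "algebraic_int (embed z x)"
proof -
  have "x \<in> K" using assms(2) OK_iff by simp
  then obtain R where R: "ev \<eta> R = x" unfolding K_def by auto
  obtain p where p: "poly (map_poly of_int p) x = 0" "lead_coeff p = 1"
    using assms(2) unfolding OK_iff algebraic_int_altdef_ipoly by auto
  have "ev \<eta> (pcompose (map_poly of_int p) R) = ev \<eta> 0"
    unfolding ev_pcompose ev_of_int R using p by simp
  from ev_eq_transfer[OF this assms(1)]
  have "poly (map_poly of_int p) (ev z R) = 0" unfolding ev_pcompose ev_of_int by simp
  moreover have "ev z R = embed z x" using embed_ev[OF assms(1), of R] R by simp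
  ultimately show ?thesis using p(2) unfolding algebraic_int_altdef_ipoly by auto
qed

definition lagrange :: "complex \<Rightarrow> complex poly" where
  "lagrange z = (\<Prod>w\<in>Z - {z}. [:- w, 1:])"

definition node_diff :: "complex \<Rightarrow> complex" where
  "node_diff z = (\<Prod>w\<in>Z - {z}. z - w)"

lemma node_diff_nonzero: "node_diff z \<noteq> 0"
  unfolding node_diff_def using finite_Z by simp

lemma lagrange_interpolation:
  assumes "degree R < n"
  shows "map_poly of_rat R = (\<Sum>z\<in>Z. smult (ev z R / node_diff z) (lagrange z))"
proof (rule poly_eqI_degree)
  show "card Z > degree (map_poly of_rat R :: complex poly)"
    using assms card_Z by (simp add: degree_map_poly)
  have "degree (smult (ev z R / node_diff z) (lagrange z)) \<le> n - 1" if "z \<in> Z" for z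
  proof -
    have "degree (lagrange z) \<le> (\<Sum>w\<in>Z - {z}. degree [:- w, 1:])"
      unfolding lagrange_def using degree_prod_sum_le[of "Z - {z}" "\<lambda>w. [:- w, 1:]"] finite_Z
      by (simp add: o_def)
    also have "\<dots> = n - 1" using that card_Z finite_Z by simp
    finally show ?thesis using degree_smult_le le_trans by blast
  qed
  then have "degree (\<Sum>z\<in>Z. smult (ev z R / node_diff z) (lagrange z)) \<le> n - 1"
    by (intro degree_sum_le) (use finite_Z in auto)
  then show "card Z > degree (\<Sum>z\<in>Z. smult (ev z R / node_diff z) (lagrange z))"
    using degree_pos card_Z by simp
next
  fix x assume x: "x \<in> Z"
  have "poly (lagrange z) x = (if z = x then node_diff x else 0)" if "z \<in> Z" for z
    using that x finite_Z unfolding lagrange_def node_diff_def by (auto simp: poly_prod)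
  then have "poly (\<Sum>z\<in>Z. smult (ev z R / node_diff z) (lagrange z)) x
      = (\<Sum>z\<in>Z. if z = x then ev x R else 0)"
    using node_diff_nonzero by (auto simp: poly_sum intro!: sum.cong)
  also have "\<dots> = ev x R" using x finite_Z by simp
  finally show "poly (map_poly of_rat R) x
      = poly (\<Sum>z\<in>Z. smult (ev z R / node_diff z) (lagrange z)) x"
    by (simp add: ev_def)
qed

lemma ev_expand: "degree R < n \<Longrightarrow> ev z R = (\<Sum>i<n. of_rat (coeff R i) * z ^ i)"
proof -
  assume R: "degree R < n"
  have "ev z R = (\<Sum>i\<le>degree R. of_rat (coeff R i) * z ^ i)"
    by (simp add: ev_def poly_altdef degree_map_poly coeff_map_poly)
  also have "\<dots> = (\<Sum>i<n. of_rat (coeff R i) * z ^ i)"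
    by (rule sum.mono_neutral_left) (use R in \<open>auto simp: coeff_eq_0\<close>)
  finally show ?thesis .
qed

text \<open>
  Lagrange interpolation at the roots of \<open>F\<close> recovers the coefficients of \<open>R\<close> from the conjugates of
  \<open>R(\<eta>)\<close>, which are algebraic integers. The only denominators are the differences of the roots, and \<open>D\<close>
  is a rational integer divisible by the product of all of them.
\<close>

lemma integral_denominator:
  obtains D :: int where "D > 0"
    "\<And>R i. degree R < n \<Longrightarrow> ev \<eta> R \<in> OK \<Longrightarrow> \<exists>c. of_int D * coeff R i = of_int c"
proof -
  define \<Delta> where "\<Delta> = (\<Prod>z\<in>Z. node_diff z)"
  have node: "algebraic_int (node_diff z)" if "z \<in> Z" for z
    unfolding node_diff_def using that by (intro algebraic_int_prod algebraic_int_diff algebraic_int_Z) auto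
  have "algebraic_int \<Delta>" unfolding \<Delta>_def using node by (intro algebraic_int_prod)
  moreover have "\<Delta> \<noteq> 0" unfolding \<Delta>_def using node_diff_nonzero finite_Z by simp
  ultimately obtain P N where P: "N \<noteq> 0" "\<Delta> * poly (map_poly of_int P) \<Delta> = of_int N"
    using algebraic_int_cofactor by blast
  have lag: "algebraic_int (coeff (lagrange z) i)" for z i
  proof -
    have "algebraic_int (coeff (\<Prod>w\<in>Y. [:- w, 1:]) i)" if "Y \<subseteq> Z" for Y i
      using that
    proof (induction Y arbitrary: i rule: infinite_finite_induct)
      case (insert w Y)
      have "algebraic_int (coeff [:- w, 1:] i)" for i
        using insert.prems algebraic_int_Z by (auto simp: coeff_pCons split: nat.splits)
      moreover have "algebraic_int (coeff (\<Prod>w\<in>Y. [:- w, 1:]) i)" for i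
        using insert by auto
      ultimately show ?case
        unfolding prod.insert[OF insert.hyps(1,2)] by (rule algebraic_int_coeff_mult)
    qed (auto simp: coeff_pCons split: nat.splits)
    then show ?thesis unfolding lagrange_def by auto
  qed
  have main: "\<exists>c. of_int N * coeff R i = of_int c" if R: "degree R < n" "ev \<eta> R \<in> OK" for R i
  proof -
    have "algebraic_int (of_int N * (ev z R / node_diff z * coeff (lagrange z) i))" if z: "z \<in> Z" for z
    proof -
      have "\<Delta> = node_diff z * (\<Prod>w\<in>Z - {z}. node_diff w)"
        unfolding \<Delta>_def using z finite_Z by (simp add: prod.remove)
      then have "of_int N * (ev z R / node_diff z * coeff (lagrange z) i)
          = (\<Prod>w\<in>Z - {z}. node_diff w) * poly (map_poly of_int P) \<Delta> * ev z R * coeff (lagrange z) i"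
        using P(2) node_diff_nonzero[of z] by (simp add: field_simps)
      moreover have "algebraic_int (ev z R)" using algebraic_int_embed[OF z R(2)] embed_ev[OF z] by simp
      ultimately show ?thesis
        using lag node z \<open>algebraic_int \<Delta>\<close>
        by (auto intro!: algebraic_int_times algebraic_int_prod algebraic_int_of_int_poly)
    qed
    then have "algebraic_int (\<Sum>z\<in>Z. of_int N * (ev z R / node_diff z * coeff (lagrange z) i))"
      by (rule algebraic_int_sum)
    also have "(\<Sum>z\<in>Z. of_int N * (ev z R / node_diff z * coeff (lagrange z) i))
        = of_int N * coeff (map_poly of_rat R) i"
      unfolding lagrange_interpolation[OF R(1)] by (simp add: coeff_sum sum_distrib_left)
    also have "\<dots> = of_rat (of_int N * coeff R i)" by (simp add: coeff_map_poly of_rat_mult)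
    finally have "(of_rat (of_int N * coeff R i) :: complex) \<in> \<int>"
      by (rule rational_algebraic_int_is_int) auto
    then obtain c where "of_rat (of_int N * coeff R i) = (of_rat (of_int c) :: complex)"
      by (auto elim!: Ints_cases)
    then show ?thesis unfolding of_rat_eq_iff by blast
  qed
  show ?thesis
  proof (rule that[of "\<bar>N\<bar>"])
    show "\<bar>N\<bar> > 0" using P(1) by simp
    fix R i assume "degree R < n" "ev \<eta> R \<in> OK"
    then obtain c where c: "of_int N * coeff R i = of_int c" using main by blast
    show "\<exists>c. of_int \<bar>N\<bar> * coeff R i = of_int c"
      by (rule exI[of _ "sgn N * c"]) (use c in \<open>auto simp: abs_if sgn_if\<close>)
  qed
qed

text \<open>
  The ring of integers lies between \<open>\<int>[\<eta>]\<close> and \<open>(1/D) \<int>[\<eta>]\<close>. Hence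
  its residue classes modulo a nonzero integer are finite in number, and an element is determined by
  integer coordinates.
\<close>

lemma OK_integer_coordinates:
  "\<exists>D::int. D > 0 \<and> (\<forall>x\<in>OK. \<exists>c::nat \<Rightarrow> int. of_int D * x = (\<Sum>i<n. of_int (c i) * \<eta> ^ i))"
proof -
  obtain D :: int where D: "D > 0"
    "\<And>R i. degree R < n \<Longrightarrow> ev \<eta> R \<in> OK \<Longrightarrow> \<exists>c. of_int D * coeff R i = of_int c"
    using integral_denominator by blast
  have "\<exists>c::nat \<Rightarrow> int. of_int D * x = (\<Sum>i<n. of_int (c i) * \<eta> ^ i)" if x: "x \<in> OK" for x
  proof -
    obtain R where R: "degree R < n" "ev \<eta> R = x" using K_representative[of x] x OK_iff by blast
    then have "\<forall>i. \<exists>c. of_int D * coeff R i = of_int c" using D(2)[OF R(1)] x by simp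
    then obtain c where c: "\<And>i. of_int D * coeff R i = of_int (c i)" by metis
    have "of_int D * x = (\<Sum>i<n. of_rat (of_int D * coeff R i) * \<eta> ^ i)"
      unfolding R(2)[symmetric] ev_expand[OF R(1)] by (simp add: sum_distrib_left of_rat_mult mult.assoc)
    also have "\<dots> = (\<Sum>i<n. of_int (c i) * \<eta> ^ i)" unfolding c by simp
    finally show ?thesis by blast
  qed
  then show ?thesis using D(1) by blast
qed

text \<open>
  Interpolation turns a bound on all conjugates into a bound on the coordinates with respect to the
  powers of \<open>\<eta>\<close>, and these coordinates have a common denominator.
\<close>

lemma finite_bounded_integers:
  fixes B :: real
  shows "finite {x \<in> OK. \<forall>z\<in>Z. cmod (embed z x) \<le> B}"
proof -
  obtain D :: int where D: "D > 0"
    "\<And>R i. degree R < n \<Longrightarrow> ev \<eta> R \<in> OK \<Longrightarrow> \<exists>c. of_int D * coeff R i = of_int c"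
    using integral_denominator by blast
  define M where "M = Max ((\<lambda>i. \<Sum>z\<in>Z. \<bar>B\<bar> * cmod (coeff (lagrange z) i / node_diff z)) ` {..n})"
  define L where "L = \<lceil>of_int D * M\<rceil>"
  define h where "h = (\<lambda>c. (\<Sum>i<n. of_int (c i) * \<eta> ^ i) / of_int D)"
  have "{x \<in> OK. \<forall>z\<in>Z. cmod (embed z x) \<le> B} \<subseteq> h ` ({..<n} \<rightarrow>\<^sub>E {- L..L})"
  proof
    fix x assume x: "x \<in> {x \<in> OK. \<forall>z\<in>Z. cmod (embed z x) \<le> B}"
    then obtain R where R: "degree R < n" "ev \<eta> R = x" using K_representative OK_iff by auto
    have "ev \<eta> R \<in> OK" using x R(2) by simp
    then have "\<forall>i. \<exists>c. of_int D * coeff R i = of_int c" using D(2)[OF R(1)] by blast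
    then obtain c where c: "\<And>i. of_int D * coeff R i = of_int (c i)" by metis
    have bd: "\<bar>of_rat (coeff R i)\<bar> \<le> M" if "i < n" for i
    proof -
      have "complex_of_real (of_rat (coeff R i)) = coeff (map_poly of_rat R) i"
        by (simp add: coeff_map_poly of_real_of_rat)
      also have "\<dots> = (\<Sum>z\<in>Z. ev z R * (coeff (lagrange z) i / node_diff z))"
        unfolding lagrange_interpolation[OF R(1)] by (simp add: coeff_sum)
      finally have "cmod (complex_of_real (of_rat (coeff R i)))
          \<le> (\<Sum>z\<in>Z. cmod (ev z R * (coeff (lagrange z) i / node_diff z)))"
        by (simp only: norm_sum)
      also have "\<dots> \<le> (\<Sum>z\<in>Z. \<bar>B\<bar> * cmod (coeff (lagrange z) i / node_diff z))"
      proof (rule sum_mono)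
        fix z assume z: "z \<in> Z"
        have "cmod (ev z R) \<le> B" using x z R(2) embed_ev[OF z, of R] by auto
        then have "cmod (ev z R) \<le> \<bar>B\<bar>" by simp
        then show "cmod (ev z R * (coeff (lagrange z) i / node_diff z))
            \<le> \<bar>B\<bar> * cmod (coeff (lagrange z) i / node_diff z)"
          unfolding norm_mult by (intro mult_right_mono) auto
      qed
      also have "\<dots> \<le> M" unfolding M_def using that by (intro Max_ge) auto
      finally show ?thesis by simp
    qed
    have "c i \<in> {- L..L}" if "i < n" for i
    proof -
      have "real_of_int (c i) = of_rat (of_int (c i))" by simp
      also have "\<dots> = of_int D * of_rat (coeff R i)" unfolding c[symmetric] by (simp add: of_rat_mult)
      finally have "\<bar>real_of_int (c i)\<bar> = of_int D * \<bar>of_rat (coeff R i)\<bar>"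
        using D(1) by (simp add: abs_mult)
      also have "\<dots> \<le> of_int D * M" using bd[OF that] D(1) by (intro mult_left_mono) auto
      also have "\<dots> \<le> of_int L" unfolding L_def by simp
      finally show ?thesis by (simp add: abs_le_iff)
    qed
    then have "restrict c {..<n} \<in> {..<n} \<rightarrow>\<^sub>E {- L..L}" by auto
    moreover have "x = h (restrict c {..<n})"
    proof -
      have "of_int D * x = (\<Sum>i<n. of_rat (of_int D * coeff R i) * \<eta> ^ i)"
        unfolding R(2)[symmetric] ev_expand[OF R(1)] by (simp add: sum_distrib_left of_rat_mult mult.assoc)
      also have "\<dots> = (\<Sum>i<n. of_int (c i) * \<eta> ^ i)" unfolding c by simp
      finally show ?thesis unfolding h_def using D(1) by (simp add: field_simps)
    qed
    ultimately show "x \<in> h ` ({..<n} \<rightarrow>\<^sub>E {- L..L})" by blast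
  qed
  moreover have "finite ({..<n} \<rightarrow>\<^sub>E {- L..L})" by (intro finite_PiE) auto
  ultimately show ?thesis using finite_surj by blast
qed

text \<open>
  The conjugates of \<open>x\<close> are real and have the same odd power, hence they coincide. A polynomial of
  degree less than \<open>n\<close> that takes a single value at the \<open>n\<close> roots of \<open>F\<close> is constant.
\<close>

lemma odd_root_of_rational:
  assumes real: "Z \<subseteq> \<real>" and m: "odd m" and x: "x \<in> K" "x ^ m = of_rat r"
  shows "x \<in> \<rat>"
proof -
  obtain R where R: "degree R < n" "ev \<eta> R = x" using K_representative[OF x(1)] .
  have pow: "ev z R ^ m = of_rat r" if "z \<in> Z" for z
    using ev_eq_transfer[of "R ^ m" "[:r:]" z] that R(2) x(2) by simp
  have real_ev: "ev z R \<in> \<real>" if "z \<in> Z" for z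
  proof -
    have "z \<in> \<real>" using that real by auto
    then show ?thesis unfolding ev_expand[OF R(1)]
      by (intro sum_in_Reals Reals_mult Reals_power) (auto simp flip: of_real_of_rat)
  qed
  have "ev z R = ev \<eta> R" if z: "z \<in> Z" for z
  proof -
    obtain u v where uv: "ev z R = of_real u" "ev \<eta> R = of_real v"
      using real_ev[OF z] real_ev[OF root_in_Z] by (auto elim!: Reals_cases)
    have "complex_of_real (u ^ m) = of_real (v ^ m)" using pow[OF z] pow[OF root_in_Z] uv by simp
    then have "u ^ m = v ^ m" by (simp only: of_real_eq_iff)
    then show ?thesis using m uv by (metis odd_real_root_power_cancel)
  qed
  then have "map_poly of_rat R = [:x:]"
    using R card_Z by (intro poly_eqI_degree[of Z]) (auto simp: ev_def degree_map_poly)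
  then have "x = coeff (map_poly of_rat R) 0" by simp
  then show ?thesis by (simp add: coeff_map_poly)
qed

end

section \<open>Fractional ideals form a group\<close>

abbreviation ideal_mult :: "complex set \<Rightarrow> complex set \<Rightarrow> complex set" (infixl "\<star>" 70) where
  "I \<star> J \<equiv> ideal_prod complex_field I J"

lemma ideal_mult_intro: "i \<in> I \<Longrightarrow> j \<in> J \<Longrightarrow> i * j \<in> I \<star> J"
  using ideal_prod.prod[of i I j J complex_field] by (simp add: ring_of_type_algebra_def)

lemma ideal_mult_add: "x \<in> I \<star> J \<Longrightarrow> y \<in> I \<star> J \<Longrightarrow> x + y \<in> I \<star> J"
  using ideal_prod.sum[of x complex_field I J y] by (simp add: ring_of_type_algebra_def)

lemma ideal_mult_induct [consumes 1, case_names mult add]: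
  assumes "x \<in> I \<star> J" "\<And>i j. i \<in> I \<Longrightarrow> j \<in> J \<Longrightarrow> P (i * j)"
    "\<And>x y. P x \<Longrightarrow> P y \<Longrightarrow> P (x + y)"
  shows "P x"
  using assms(1) by induction (use assms(2,3) in \<open>auto simp: ring_of_type_algebra_def\<close>)

lemma ideal_mult_commute: "I \<star> J = J \<star> I"
proof -
  have "I \<star> J \<subseteq> J \<star> I" for I J
  proof
    fix x assume "x \<in> I \<star> J"
    then show "x \<in> J \<star> I"
    proof (induction rule: ideal_mult_induct)
      case (mult i j)
      then show ?case using ideal_mult_intro[of j J i I] by (simp add: mult.commute)
    qed (rule ideal_mult_add)
  qed
  then show ?thesis by blast
qed

lemma ideal_mult_assoc: "(I \<star> J) \<star> L = I \<star> (J \<star> L)"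
proof -
  have *: "(I \<star> J) \<star> L \<subseteq> I \<star> (J \<star> L)" for I J L
  proof
    fix x assume "x \<in> (I \<star> J) \<star> L"
    then show "x \<in> I \<star> (J \<star> L)"
    proof (induction rule: ideal_mult_induct)
      case (mult y l)
      from mult(1) show ?case
      proof (induction rule: ideal_mult_induct)
        case (mult i j)
        then show ?case using \<open>l \<in> L\<close> by (simp add: mult.assoc ideal_mult_intro)
      next
        case (add x y)
        then show ?case by (simp add: distrib_right ideal_mult_add)
      qed
    qed (rule ideal_mult_add)
  qed
  have "I \<star> (J \<star> L) = (L \<star> J) \<star> I" by (simp add: ideal_mult_commute)
  also have "\<dots> \<subseteq> L \<star> (J \<star> I)" by (rule *)
  also have "\<dots> = (I \<star> J) \<star> L" by (simp add: ideal_mult_commute)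
  finally show ?thesis using * by blast
qed

lemma ideal_mult_mono: "I \<subseteq> I' \<Longrightarrow> J \<subseteq> J' \<Longrightarrow> I \<star> J \<subseteq> I' \<star> J'"
proof
  fix x assume "I \<subseteq> I'" "J \<subseteq> J'" "x \<in> I \<star> J"
  from this(3) show "x \<in> I' \<star> J'"
  proof (induction rule: ideal_mult_induct)
    case (mult i j)
    then show ?case using \<open>I \<subseteq> I'\<close> \<open>J \<subseteq> J'\<close> by (auto intro: ideal_mult_intro)
  qed (rule ideal_mult_add)
qed

text \<open>
  The root is a quotient of two algebraic integers, namely \<open>c * r\<close> by the leading coefficient \<open>c\<close>, and \<open>c\<close>
  divides a rational integer.
\<close>

lemma integer_root_polynomial:
  fixes f :: "complex poly"
  assumes "\<And>i. algebraic_int (coeff f i)" "f \<noteq> 0" "poly f r = 0"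
  shows "\<exists>p :: int poly. p \<noteq> 0 \<and> poly (map_poly of_int p) r = 0"
proof -
  define c where "c = lead_coeff f"
  have c: "algebraic_int c" "c \<noteq> 0" using assms by (auto simp: c_def)
  obtain P N where P: "N \<noteq> 0" "c * poly (map_poly of_int P) c = of_int N"
    using algebraic_int_cofactor[OF c] by blast
  have "algebraic_int (c * r * poly (map_poly of_int P) c)"
    unfolding c_def using assms
    by (intro algebraic_int_times algebraic_int_lead_coeff_mult_root algebraic_int_of_int_poly)
  also have "c * r * poly (map_poly of_int P) c = of_int N * r"
    unfolding P(2)[symmetric] by simp
  finally obtain q where q: "poly (map_poly of_int q) (of_int N * r) = 0" "lead_coeff q = 1"
    unfolding algebraic_int_altdef_ipoly by auto
  have "poly (map_poly of_int (pcompose q [:0, N:])) r = 0"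
    using q(1) by (simp add: of_int_hom.map_poly_pcompose poly_pcompose of_int_hom.map_poly_pCons_hom mult.commute)
  moreover have "pcompose q [:0, N:] \<noteq> 0"
  proof
    assume "pcompose q [:0, N:] = 0"
    moreover have "lead_coeff (pcompose q [:0, N:]) = lead_coeff q * lead_coeff [:0, N:] ^ degree q"
      by (rule lead_coeff_comp) (use P(1) in simp)
    ultimately show False using q(2) P(1) by simp
  qed
  ultimately show ?thesis by blast
qed

lemma divides_integer_polynomial:
  fixes f :: "complex poly"
  assumes "f \<noteq> 0" "\<And>r. poly f r = 0 \<Longrightarrow> \<exists>p :: int poly. p \<noteq> 0 \<and> poly (map_poly of_int p) r = 0"
  shows "\<exists>h :: int poly. h \<noteq> 0 \<and> f dvd map_poly of_int h"
  using assms
proof (induction "degree f" arbitrary: f)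
  case 0
  then obtain c where "f = [:c:]" by (metis degree_eq_zeroE)
  then have "f dvd map_poly of_int 1" using 0 by (simp add: const_poly_dvd_iff)
  then show ?case by (metis one_neq_zero)
next
  case (Suc d)
  obtain r where r: "poly f r = 0"
    using Suc(2) by (metis constant_degree fundamental_theorem_of_algebra nat.distinct(1))
  then obtain k where k: "f = [:- r, 1:] * k" by (metis dvdE poly_eq_0_iff_dvd)
  have "k \<noteq> 0" using Suc(2) k by auto
  then have "degree f = degree [:- r, 1:] + degree k" unfolding k by (intro degree_mult_eq) auto
  then have dk: "d = degree k" using Suc(2) by simp
  have "poly f s = 0" if "poly k s = 0" for s using that unfolding k by simp
  then obtain h :: "int poly" where h: "h \<noteq> 0" "k dvd map_poly of_int h"
    using Suc(1)[OF dk \<open>k \<noteq> 0\<close>] Suc(4) by auto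
  obtain p :: "int poly" where p: "p \<noteq> 0" "poly (map_poly of_int p) r = 0" using Suc(4) r by blast
  have "f dvd map_poly of_int (p * h)"
    unfolding k of_int_poly_hom.hom_mult
    by (rule mult_dvd_mono) (use h p in \<open>auto simp: poly_eq_0_iff_dvd\<close>)
  then show ?case using h p by (metis mult_eq_0_iff)
qed

lemma bezout_finite:
  fixes a :: "nat \<Rightarrow> int"
  assumes "finite S"
  shows "\<exists>c m. (\<Sum>k\<in>S. m k * a k) = c \<and> (\<forall>k\<in>S. c dvd a k)"
  using assms
proof (induction S rule: finite_induct)
  case (insert x S)
  then obtain m where m: "\<forall>k\<in>S. (\<Sum>k\<in>S. m k * a k) dvd a k" by blast
  define c where "c = (\<Sum>k\<in>S. m k * a k)"
  obtain u v where uv: "u * a x + v * c = gcd (a x) c" using bezout_int by blast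
  define m' where "m' = (\<lambda>k. if k = x then u else v * m k)"
  have "(\<Sum>k\<in>S. m' k * a k) = (\<Sum>k\<in>S. v * (m k * a k))"
    using insert(2) by (intro sum.cong) (auto simp: m'_def)
  then have "(\<Sum>k\<in>insert x S. m' k * a k) = gcd (a x) c"
    using insert(1,2) uv by (simp add: sum_distrib_left[symmetric] c_def m'_def)
  moreover have "\<forall>k\<in>insert x S. gcd (a x) c dvd a k"
    using m unfolding c_def by (auto intro: gcd_dvdI1 gcd_dvdI2)
  ultimately show ?case by blast
qed auto

context number_field_root
begin

lemma fractional_idealD:
  assumes "fractional_ideal K I"
  shows "x \<in> I \<Longrightarrow> x \<in> K" "0 \<in> I" "I \<noteq> {0}" "x \<in> I \<Longrightarrow> y \<in> I \<Longrightarrow> x + y \<in> I"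
    "a \<in> OK \<Longrightarrow> x \<in> I \<Longrightarrow> a * x \<in> I"
    "\<exists>d\<in>OK. d \<noteq> 0 \<and> (\<forall>x\<in>I. d * x \<in> OK)"
  using assms unfolding fractional_ideal_def by blast+

lemma fractional_ideal_sum:
  assumes "fractional_ideal K I" "\<And>i. i \<in> S \<Longrightarrow> f i \<in> I"
  shows "sum f S \<in> I"
  using assms(2)
  by (induction S rule: infinite_finite_induct) (auto intro: fractional_idealD(2,4)[OF assms(1)])

lemma fractional_ideal_bezout:
  assumes I: "fractional_ideal K I" and ab: "coprime a b" and x: "of_int a * x \<in> I" "of_int b * x \<in> I"
  shows "x \<in> I"
proof -
  obtain u v where "u * a + v * b = 1" using ab bezout_int[of a b] by (auto simp: coprime_iff_gcd_eq_1)
  then have "x = of_int (u * a + v * b) * x" by simp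
  also have "\<dots> = of_int u * (of_int a * x) + of_int v * (of_int b * x)" by (simp add: algebra_simps)
  also have "\<dots> \<in> I" by (intro fractional_idealD(4,5)[OF I] OK_closed x)
  finally show ?thesis .
qed

lemma fractional_ideal_OK: "fractional_ideal K OK"
  unfolding fractional_ideal_def using OK_subset_K OK_closed
  by (auto intro!: bexI[of _ 1])

lemma fractional_ideal_ex_nonzero:
  assumes "fractional_ideal K I" obtains x where "x \<in> I" "x \<noteq> 0"
  using fractional_idealD(2,3)[OF assms] by blast

lemma OK_mult: 
  assumes "fractional_ideal K I"
  shows "OK \<star> I = I"
proof
  show "OK \<star> I \<subseteq> I"
  proof
    fix x assume "x \<in> OK \<star> I"
    then show "x \<in> I"
      by (induction rule: ideal_mult_induct) (auto intro: fractional_idealD(4,5)[OF assms])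
  qed
  show "I \<subseteq> OK \<star> I" using ideal_mult_intro[of 1 OK _ I] OK_closed(2) by auto
qed

lemma ideal_mult_OK_closed:
  assumes "\<And>a x. a \<in> OK \<Longrightarrow> x \<in> J \<Longrightarrow> a * x \<in> J" "a \<in> OK" "x \<in> I \<star> J"
  shows "a * x \<in> I \<star> J"
  using assms(3)
proof (induction rule: ideal_mult_induct)
  case (mult i j)
  have "i * (a * j) \<in> I \<star> J" using mult assms(1,2) by (intro ideal_mult_intro) auto
  then show ?case by (simp add: mult_ac)
next
  case (add x y)
  then show ?case by (simp add: distrib_left ideal_mult_add)
qed

lemma fractional_ideal_mult:
  assumes I: "fractional_ideal K I" and J: "fractional_ideal K J"
  shows "fractional_ideal K (I \<star> J)"
proof -
  have "I \<star> J \<subseteq> K"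
  proof
    fix x assume "x \<in> I \<star> J"
    then show "x \<in> K"
      by (induction rule: ideal_mult_induct)
         (auto intro: K_closed fractional_idealD(1)[OF I] fractional_idealD(1)[OF J])
  qed
  moreover have "0 \<in> I \<star> J"
    using ideal_mult_intro[OF fractional_idealD(2)[OF I] fractional_idealD(2)[OF J]] by simp
  moreover have "I \<star> J \<noteq> {0}"
  proof -
    obtain i j where "i \<in> I" "i \<noteq> 0" "j \<in> J" "j \<noteq> 0"
      using fractional_ideal_ex_nonzero[OF I] fractional_ideal_ex_nonzero[OF J] by metis
    then have "i * j \<in> I \<star> J" "i * j \<noteq> 0" by (auto intro: ideal_mult_intro)
    then show ?thesis by blast
  qed
  moreover have "\<exists>d\<in>OK. d \<noteq> 0 \<and> (\<forall>x\<in>I \<star> J. d * x \<in> OK)"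
  proof -
    obtain d e where d: "d \<in> OK" "d \<noteq> 0" "\<And>x. x \<in> I \<Longrightarrow> d * x \<in> OK"
      and e: "e \<in> OK" "e \<noteq> 0" "\<And>x. x \<in> J \<Longrightarrow> e * x \<in> OK"
      using fractional_idealD(6)[OF I] fractional_idealD(6)[OF J] by blast
    have "d * e * x \<in> OK" if "x \<in> I \<star> J" for x
      using that
    proof (induction rule: ideal_mult_induct)
      case (mult i j)
      have "(d * i) * (e * j) \<in> OK" using OK_closed(9)[OF d(3)[OF mult(1)] e(3)[OF mult(2)]] .
      then show ?case by (simp add: mult_ac)
    next
      case (add x y)
      then show ?case by (simp add: distrib_left OK_closed)
    qed
    then show ?thesis using d e by (intro bexI[of _ "d * e"]) (auto intro: OK_closed)
  qed
  ultimately show ?thesis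
    unfolding fractional_ideal_def
    using ideal_mult_add ideal_mult_OK_closed fractional_idealD(5)[OF J] by blast
qed

definition principal :: "complex \<Rightarrow> complex set" where
  "principal a = (\<lambda>x. a * x) ` OK"

lemma principal_mult:
  assumes "fractional_ideal K I"
  shows "principal a \<star> I = (\<lambda>x. a * x) ` I"
proof
  show "principal a \<star> I \<subseteq> (\<lambda>x. a * x) ` I"
  proof
    fix x assume "x \<in> principal a \<star> I"
    then show "x \<in> (\<lambda>x. a * x) ` I"
    proof (induction rule: ideal_mult_induct)
      case (mult i j)
      then show ?case using fractional_idealD(5)[OF assms] by (auto simp: principal_def mult.assoc)
    next
      case (add x y)
      then show ?case using fractional_idealD(4)[OF assms]
        by (auto simp: distrib_left[symmetric])
    qed
  qed
  show "(\<lambda>x. a * x) ` I \<subseteq> principal a \<star> I"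
    using ideal_mult_intro[of a "principal a" _ I] OK_closed(2) by (force simp: principal_def)
qed

lemma fractional_ideal_principal:
  assumes "a \<in> K" "a \<noteq> 0"
  shows "fractional_ideal K (principal a)"
proof -
  obtain d :: int where d: "d > 0" "of_int d * a \<in> OK" using K_integral_multiple[OF assms(1)] .
  have "\<exists>d\<in>OK. d \<noteq> 0 \<and> (\<forall>x\<in>principal a. d * x \<in> OK)"
    using d by (intro bexI[of _ "of_int d"])
      (auto simp: principal_def mult.assoc[symmetric] intro: OK_closed)
  moreover have "a \<in> principal a" using OK_closed(2) by (force simp: principal_def)
  ultimately show ?thesis
    unfolding fractional_ideal_def principal_def using assms OK_closed OK_subset_K
    by (auto simp: distrib_left[symmetric] mult.left_commute intro!: K_closed)
qed

lemma principal_subset_iff: "fractional_ideal K I \<Longrightarrow> principal a \<subseteq> I \<longleftrightarrow> a \<in> I"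
  unfolding principal_def using OK_closed(2) fractional_idealD(5) by (force simp: mult.commute)

lemma principal_1: "principal 1 = OK" by (simp add: principal_def)

lemma principal_mult_principal:
  "b \<in> K \<Longrightarrow> b \<noteq> 0 \<Longrightarrow> principal a \<star> principal b = principal (a * b)"
  by (subst principal_mult) (auto simp: fractional_ideal_principal, auto simp: principal_def image_image mult.assoc)

lemma principal_eq_imp_unit:
  assumes "principal a = principal b" "b \<noteq> 0" "a \<noteq> 0"
  shows "a / b \<in> OK" "b / a \<in> OK"
proof -
  have "a \<in> principal b" "b \<in> principal a"
    using assms(1) OK_closed(2) by (force simp: principal_def)+
  then obtain x y where "x \<in> OK" "a = b * x" "y \<in> OK" "b = a * y" unfolding principal_def by blast
  moreover have "a / b = x" "b / a = y" using calculation assms(2,3) by (auto simp: field_simps)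
  ultimately show "a / b \<in> OK" "b / a \<in> OK" by simp_all
qed

text \<open>
  Up to scaling, the ideal contains a nonzero integer \<open>N\<close>, and only finitely many classes modulo \<open>N\<close> occur
  since coordinates with respect to the powers of \<open>\<eta>\<close> have a common denominator. The element \<open>b\<close>
  corresponds to \<open>N\<close>, and \<open>A\<close> represents the classes.
\<close>

lemma fractional_ideal_finitely_generated:
  assumes I: "fractional_ideal K I"
  obtains A b where "finite A" "A \<subseteq> I" "b \<in> I" "b \<noteq> 0" "\<And>x. x \<in> I \<Longrightarrow> \<exists>a\<in>A. \<exists>y\<in>OK. x = a + y * b"
proof -
  obtain d where d: "d \<in> OK" "d \<noteq> 0" "\<And>x. x \<in> I \<Longrightarrow> d * x \<in> OK"
    using fractional_idealD(6)[OF I] by blast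
  obtain x0 where x0: "x0 \<in> I" "x0 \<noteq> 0" using fractional_ideal_ex_nonzero[OF I] .
  obtain y N where y: "y \<in> OK" "N \<noteq> 0" "d * x0 * y = of_int N"
    using OK_cofactor[OF d(3)[OF x0(1)]] d(2) x0(2) by auto
  define b where "b = y * x0"
  have b: "b \<in> I" "d * b = of_int N" unfolding b_def using fractional_idealD(5)[OF I y(1) x0(1)] y(3)
    by (auto simp: mult_ac)
  obtain D :: int where D: "D > 0"
    "\<forall>x\<in>OK. \<exists>c::nat \<Rightarrow> int. of_int D * x = (\<Sum>i<n. of_int (c i) * \<eta> ^ i)"
    using OK_integer_coordinates by blast
  have "\<forall>x\<in>I. \<exists>c :: nat \<Rightarrow> int. of_int D * (d * x) = (\<Sum>i<n. of_int (c i) * \<eta> ^ i)"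
    using D(2) d(3) by blast
  then obtain c :: "complex \<Rightarrow> nat \<Rightarrow> int" where
    c: "\<And>x. x \<in> I \<Longrightarrow> of_int D * (d * x) = (\<Sum>i<n. of_int (c x i) * \<eta> ^ i)" by metis
  define M where "M = D * N"
  have "M \<noteq> 0" using D(1) y(2) by (simp add: M_def)
  define res where "res = (\<lambda>x. restrict (\<lambda>i. c x i mod M) {..<n})"
  have "res ` I \<subseteq> {..<n} \<rightarrow>\<^sub>E {- \<bar>M\<bar>..\<bar>M\<bar>}"
  proof -
    have "k mod M \<in> {- \<bar>M\<bar>..\<bar>M\<bar>}" for k
      using \<open>M \<noteq> 0\<close> abs_mod_less[of M k] by (simp add: abs_less_iff)
    then show ?thesis unfolding res_def by auto
  qed
  moreover have "finite ({..<n} \<rightarrow>\<^sub>E {- \<bar>M\<bar>..\<bar>M\<bar>})" by (intro finite_PiE) auto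
  ultimately have fin: "finite (res ` I)" by (rule finite_subset)
  obtain A where A: "A \<subseteq> I" "finite A" "res ` I = res ` A"
    using finite_subset_image[OF fin, of res I] by auto
  have "\<exists>a\<in>A. \<exists>y\<in>OK. x = a + y * b" if x: "x \<in> I" for x
  proof -
    obtain a where a: "a \<in> A" "res x = res a" using A(3) x by (metis imageE image_eqI)
    define e where "e = (\<lambda>i. (c x i - c a i) div M)"
    have e: "c x i - c a i = M * e i" if "i < n" for i
    proof -
      have "res x i = res a i" using a(2) by simp
      then have "c x i mod M = c a i mod M" using that by (simp add: res_def)
      then have "M dvd c x i - c a i" by (simp add: mod_eq_dvd_iff)
      then show ?thesis unfolding e_def by simp
    qed
    define z where "z = (\<Sum>i<n. of_int (e i) * \<eta> ^ i)"
    have z: "z \<in> OK" unfolding z_def by (intro OK_sum OK_closed)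
    have "a \<in> I" using a(1) A(1) by blast
    have "of_int D * (d * (x - a)) = of_int D * (d * x) - of_int D * (d * a)"
      by (simp add: algebra_simps)
    also have "\<dots> = (\<Sum>i<n. of_int (c x i - c a i) * \<eta> ^ i)"
      unfolding c[OF x] c[OF \<open>a \<in> I\<close>] by (simp add: sum_subtractf left_diff_distrib)
    also have "\<dots> = (\<Sum>i<n. of_int M * (of_int (e i) * \<eta> ^ i))"
      using e by (intro sum.cong) auto
    also have "\<dots> = of_int M * z" by (simp add: z_def sum_distrib_left)
    also have "\<dots> = of_int D * (d * (z * b))" unfolding M_def using b(2) by (simp add: mult_ac)
    finally have "x - a = z * b" using D(1) d(2) by simp
    then have "x = a + z * b" by (simp add: algebra_simps)
    then show ?thesis using a(1) z by blast
  qed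
  moreover have "b \<noteq> 0" using b(2) y(2) by auto
  ultimately show ?thesis using that A(1,2) b(1) by blast
qed

text \<open>
  Kronecker's argument. Let \<open>f\<close> be a polynomial whose coefficients generate \<open>I\<close>. It divides an integer
  polynomial \<open>h = f * g\<close>; let \<open>c\<close> be the content of \<open>h\<close>. By Dedekind's Prague theorem every product
  \<open>f_i * g_j / c\<close> is integral, so the coefficients of \<open>g / c\<close> lie in the ideal of all \<open>y\<close> with
  \<open>I * y \<subseteq> OK\<close>. An integer combination of the coefficients of \<open>h\<close> equals \<open>c\<close>, which exhibits \<open>1\<close> in
  the product.
\<close>

theorem fractional_ideal_invertible:
  assumes I: "fractional_ideal K I"
  shows "\<exists>J. fractional_ideal K J \<and> I \<star> J = OK"
proof -
  obtain A b where A: "finite A" "A \<subseteq> I" "b \<in> I" "b \<noteq> 0" "\<And>x. x \<in> I \<Longrightarrow> \<exists>a\<in>A. \<exists>y\<in>OK. x = a + y * b"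
    using fractional_ideal_finitely_generated[OF I] by blast
  obtain xs where xs: "set xs = A" using finite_list[OF A(1)] by blast
  define f where "f = Poly (b # xs)"
  have fI: "coeff f i \<in> I" for i
  proof (cases "i < length (b # xs)")
    case True
    then have "coeff f i \<in> set (b # xs)"
      unfolding f_def coeff_Poly_eq nth_default_def using nth_mem[OF True] by simp
    then show ?thesis using A(2,3) xs by auto
  next
    case False
    then show ?thesis using fractional_idealD(2)[OF I]
      unfolding f_def coeff_Poly_eq nth_default_def by simp
  qed
  have f0: "coeff f 0 = b" by (simp add: f_def)
  have fA: "\<exists>i. coeff f i = a" if a: "a \<in> A" for a
  proof -
    obtain i where "i < length xs" "xs ! i = a" using a xs by (auto simp: in_set_conv_nth)
    then show ?thesis
      by (intro exI[of _ "Suc i"]) (simp add: f_def coeff_Poly_eq nth_default_def)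
  qed
  have "f \<noteq> 0" using f0 A(4) by auto
  obtain d where d: "d \<in> OK" "d \<noteq> 0" "\<And>x. x \<in> I \<Longrightarrow> d * x \<in> OK"
    using fractional_idealD(6)[OF I] by blast
  have "\<exists>p :: int poly. p \<noteq> 0 \<and> poly (map_poly of_int p) r = 0" if "poly f r = 0" for r
    by (rule integer_root_polynomial[of "smult d f"])
       (use d fI OK_iff \<open>f \<noteq> 0\<close> that in auto)
  then obtain h g where h: "h \<noteq> 0" "map_poly of_int h = f * g"
    using divides_integer_polynomial[OF \<open>f \<noteq> 0\<close>] unfolding dvd_def by blast
  have gK: "coeff g k \<in> K" for k
  proof (induction k rule: less_induct)
    case (less k)
    have "of_int (coeff h k) = (\<Sum>i\<le>k. coeff f i * coeff g (k - i))"
      using h(2) by (metis coeff_map_poly coeff_mult of_int_0)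
    also have "{..k} = insert 0 {1..k}" by auto
    also have "(\<Sum>i\<in>insert 0 {1..k}. coeff f i * coeff g (k - i))
        = b * coeff g k + (\<Sum>i=1..k. coeff f i * coeff g (k - i))"
      by (simp add: f0)
    finally have "coeff g k = (of_int (coeff h k)
        - (\<Sum>i=1..k. coeff f i * coeff g (k - i))) / b"
      using A(4) by (simp add: field_simps)
    moreover have "\<dots> \<in> K"
      by (intro K_divide K_closed K_sum less fractional_idealD(1)[OF I] fI A(3)) auto
    ultimately show ?case by simp
  qed
  obtain c m where cm: "(\<Sum>k\<le>degree h. m k * coeff h k) = c" "\<forall>k\<le>degree h. c dvd coeff h k"
    using bezout_finite[of "{..degree h}" "coeff h"] by auto
  have "c \<noteq> 0" using cm(2) h(1) by (metis dvd_0_left leading_coeff_0_iff order_refl)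
  \<comment> \<open>The content of \<open>h\<close> is divided out of \<open>g\<close>, so that \<open>f * g'\<close> is a primitive integer polynomial.\<close>
  define g' where "g' = smult (1 / of_int c) g"
  have fg': "coeff (f * g') k = of_int (coeff h k div c)" for k
  proof -
    have "c dvd coeff h k"
      using cm(2) by (cases "k \<le> degree h") (auto simp: coeff_eq_0)
    moreover have "coeff (f * g') k = of_int (coeff h k) / of_int c"
      unfolding g'_def mult_smult_right h(2)[symmetric] by (simp add: coeff_map_poly)
    ultimately show ?thesis using \<open>c \<noteq> 0\<close> by (auto elim!: dvdE)
  qed
  have prague: "algebraic_int (coeff f i * coeff g' j)" for i j
    by (rule dedekind_prague) (simp add: fg')
  have g'K: "coeff g' j \<in> K" for j
    unfolding g'_def coeff_smult by (intro K_closed K_divide gK)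
  have fg'OK: "coeff f i * coeff g' j \<in> OK" for i j
    unfolding OK_iff using prague g'K fractional_idealD(1)[OF I fI] by (auto intro: K_closed)
  define J where "J = {y \<in> K. \<forall>x\<in>I. x * y \<in> OK}"
  have g'J: "coeff g' j \<in> J" for j
  proof -
    have "x * coeff g' j \<in> OK" if x: "x \<in> I" for x
    proof -
      obtain a y where a: "a \<in> A" "y \<in> OK" "x = a + y * b" using A(5)[OF x] by blast
      obtain i where i: "coeff f i = a" using fA[OF a(1)] by blast
      have "x * coeff g' j = coeff f i * coeff g' j
          + y * (coeff f 0 * coeff g' j)"
        unfolding i f0 a(3) by (simp add: algebra_simps)
      then show ?thesis using fg'OK a(2) by (auto intro: OK_closed)
    qed
    then show ?thesis using g'K unfolding J_def by blast
  qed
  have J_closed: "a * y \<in> J" if "a \<in> OK" "y \<in> J" for a y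
  proof -
    have "x * (a * y) \<in> OK" if "x \<in> I" for x
      using OK_closed(9)[OF \<open>a \<in> OK\<close>, of "x * y"] \<open>y \<in> J\<close> that unfolding J_def
      by (simp add: mult.left_commute)
    then show ?thesis using that OK_subset_K K_closed(10) unfolding J_def by blast
  qed
  have J_add: "x + y \<in> J" if "x \<in> J" "y \<in> J" for x y
    using that unfolding J_def by (simp add: distrib_left K_closed OK_closed)
  have J: "fractional_ideal K J"
  proof -
    have "d * b \<in> OK" "d * b \<noteq> 0" using d A(3,4) by auto
    moreover have "d * b * x \<in> OK" if "x \<in> J" for x
      using that A(3) OK_closed(9)[OF d(1), of "b * x"] unfolding J_def by (simp add: mult.assoc)
    ultimately have "\<exists>e\<in>OK. e \<noteq> 0 \<and> (\<forall>x\<in>J. e * x \<in> OK)" by blast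
    moreover have "J \<subseteq> K" "0 \<in> J" unfolding J_def by (auto intro: K_closed OK_closed)
    moreover have "J \<noteq> {0}"
    proof -
      have "d \<in> J" using d OK_subset_K unfolding J_def by (auto simp: mult.commute)
      then show ?thesis using d(2) by blast
    qed
    ultimately show ?thesis unfolding fractional_ideal_def using J_closed J_add by simp
  qed
  have IJ: "fractional_ideal K (I \<star> J)" by (rule fractional_ideal_mult[OF I J])
  have hk: "of_int (coeff h k) / of_int c = (\<Sum>i\<le>k. coeff f i * coeff g' (k - i))" for k
    unfolding coeff_mult[symmetric] g'_def mult_smult_right h(2)[symmetric] by (simp add: coeff_map_poly)
  have "(1::complex) = of_int (\<Sum>k\<le>degree h. m k * coeff h k) / of_int c"
    unfolding cm(1) using \<open>c \<noteq> 0\<close> by simp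
  also have "\<dots> = (\<Sum>k\<le>degree h. of_int (m k) * (of_int (coeff h k) / of_int c))"
    by (simp add: sum_divide_distrib)
  also have "\<dots> = (\<Sum>k\<le>degree h. of_int (m k) * (\<Sum>i\<le>k. coeff f i * coeff g' (k - i)))"
    unfolding hk ..
  also have "\<dots> \<in> I \<star> J"
    by (intro fractional_ideal_sum[OF IJ] fractional_idealD(5)[OF IJ] OK_closed ideal_mult_intro fI g'J)
  finally have "1 \<in> I \<star> J" .
  then have "OK \<subseteq> I \<star> J" using fractional_idealD(5)[OF IJ, of _ 1] by auto
  moreover have "I \<star> J \<subseteq> OK"
  proof
    fix x assume "x \<in> I \<star> J"
    then show "x \<in> OK"
      by (induction rule: ideal_mult_induct) (auto simp: J_def intro: OK_closed)
  qed
  ultimately show ?thesis using J by blast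
qed

abbreviation FI :: "complex set monoid" where "FI \<equiv> fractional_ideal_group K"

lemma FI_simps [simp]:
  "carrier FI = {I. fractional_ideal K I}" "I \<otimes>\<^bsub>FI\<^esub> J = I \<star> J" "\<one>\<^bsub>FI\<^esub> = OK"
  by (simp_all add: fractional_ideal_group_def)

lemma comm_group_FI: "comm_group FI"
proof (rule comm_groupI)
  fix I J L assume "I \<in> carrier FI" "J \<in> carrier FI" "L \<in> carrier FI"
  show "I \<otimes>\<^bsub>FI\<^esub> J \<otimes>\<^bsub>FI\<^esub> L = I \<otimes>\<^bsub>FI\<^esub> (J \<otimes>\<^bsub>FI\<^esub> L)"
    by (simp add: ideal_mult_assoc)
next
  fix I J assume "I \<in> carrier FI" "J \<in> carrier FI"
  then show "I \<otimes>\<^bsub>FI\<^esub> J \<in> carrier FI" "I \<otimes>\<^bsub>FI\<^esub> J = J \<otimes>\<^bsub>FI\<^esub> I"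
    by (simp_all add: fractional_ideal_mult ideal_mult_commute)
next
  fix I assume I: "I \<in> carrier FI"
  then show "\<one>\<^bsub>FI\<^esub> \<otimes>\<^bsub>FI\<^esub> I = I" by (simp add: OK_mult)
  show "\<exists>J\<in>carrier FI. J \<otimes>\<^bsub>FI\<^esub> I = \<one>\<^bsub>FI\<^esub>"
    using fractional_ideal_invertible[of I] I ideal_mult_commute by auto
qed (simp add: fractional_ideal_OK)

end

section \<open>The class group and the Polya group\<close>

context number_field_root
begin

abbreviation Cl :: "complex set set monoid" where "Cl \<equiv> class_group K"
abbreviation Po :: "complex set set monoid" where "Po \<equiv> polya_group K"
abbreviation cls :: "complex set \<Rightarrow> complex set set" where "cls \<equiv> ideal_class K"

lemma principal_fractional_ideals_eq:
  "principal_fractional_ideals K = {principal a | a. a \<in> K \<and> a \<noteq> 0}"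
  by (simp add: principal_fractional_ideals_def principal_def)

lemma subgroup_principal: "subgroup (principal_fractional_ideals K) FI"
proof -
  interpret FI: comm_group FI by (rule comm_group_FI)
  show ?thesis
  proof (rule FI.subgroupI)
    show "principal_fractional_ideals K \<subseteq> carrier FI" "principal_fractional_ideals K \<noteq> {}"
      unfolding principal_fractional_ideals_eq using fractional_ideal_principal K_closed(2) by auto
  next
    fix I assume "I \<in> principal_fractional_ideals K"
    then obtain a where a: "I = principal a" "a \<in> K" "a \<noteq> 0" unfolding principal_fractional_ideals_eq by blast
    have a': "inverse a \<in> K" "inverse a \<noteq> 0" using a K_inverse by auto
    have "principal (inverse a) \<otimes>\<^bsub>FI\<^esub> I = \<one>\<^bsub>FI\<^esub>"
      using a by (simp add: principal_mult_principal principal_1)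
    then have "inv\<^bsub>FI\<^esub> I = principal (inverse a)"
      using a a' fractional_ideal_principal by (intro FI.inv_equality) auto
    then show "inv\<^bsub>FI\<^esub> I \<in> principal_fractional_ideals K"
      unfolding principal_fractional_ideals_eq using a' by blast
  next
    fix I J assume "I \<in> principal_fractional_ideals K" "J \<in> principal_fractional_ideals K"
    then obtain a b where "I = principal a" "a \<in> K" "a \<noteq> 0" "J = principal b" "b \<in> K" "b \<noteq> 0"
      unfolding principal_fractional_ideals_eq by blast
    moreover from this have "a * b \<in> K" "a * b \<noteq> 0" by (auto intro: K_closed)
    ultimately show "I \<otimes>\<^bsub>FI\<^esub> J \<in> principal_fractional_ideals K"
      unfolding principal_fractional_ideals_eq using principal_mult_principal by auto
  qed
qed

lemma comm_group_Cl: "comm_group Cl"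
  unfolding class_group_def by (rule comm_group.abelian_FactGroup[OF comm_group_FI subgroup_principal])

lemma cls_hom: "cls \<in> hom FI Cl"
proof -
  interpret normal "principal_fractional_ideals K" FI
    by (rule comm_group.subgroup_imp_normal[OF comm_group_FI subgroup_principal])
  show ?thesis using r_coset_hom_Mod unfolding class_group_def ideal_class_def .
qed

lemma cls_mult:
  "fractional_ideal K I \<Longrightarrow> fractional_ideal K J \<Longrightarrow> cls (I \<star> J) = cls I \<otimes>\<^bsub>Cl\<^esub> cls J"
  using hom_mult[OF cls_hom, of I J] by simp

lemma cls_carrier: "fractional_ideal K I \<Longrightarrow> cls I \<in> carrier Cl"
  using hom_carrier[OF cls_hom] by auto

lemma cls_OK: "cls OK = \<one>\<^bsub>Cl\<^esub>"
  using hom_one[OF cls_hom] comm_group_FI comm_group_Cl by (simp add: comm_group_def)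

lemma cls_trivial:
  assumes "fractional_ideal K I" "cls I = \<one>\<^bsub>Cl\<^esub>"
  shows "\<exists>a\<in>K. a \<noteq> 0 \<and> I = principal a"
proof -
  interpret FI: comm_group FI by (rule comm_group_FI)
  have "I \<in> principal_fractional_ideals K"
    using assms FI.coset_join1[of "principal_fractional_ideals K" I] subgroup_principal subgroup.subset[OF subgroup_principal]
    by (simp add: class_group_def ideal_class_def)
  then show ?thesis unfolding principal_fractional_ideals_eq by blast
qed

lemma cls_principal:
  assumes "a \<in> K" "a \<noteq> 0"
  shows "cls (principal a) = \<one>\<^bsub>Cl\<^esub>"
proof -
  interpret FI: comm_group FI by (rule comm_group_FI)
  have "principal a \<in> principal_fractional_ideals K"
    unfolding principal_fractional_ideals_eq using assms by blast
  then show ?thesis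
    using assms FI.coset_join2[of "principal a" "principal_fractional_ideals K"] subgroup_principal fractional_ideal_principal
    by (simp add: class_group_def ideal_class_def)
qed

lemma comm_group_Po: "comm_group Po"
  unfolding polya_group_def
  by (rule group.abelian_subgroup_generated[OF comm_group.axioms(2)[OF comm_group_Cl] comm_group_Cl])

lemma Po_simps [simp]: "x \<otimes>\<^bsub>Po\<^esub> y = x \<otimes>\<^bsub>Cl\<^esub> y" "\<one>\<^bsub>Po\<^esub> = \<one>\<^bsub>Cl\<^esub>"
  by (simp_all add: polya_group_def)

section \<open>Characteristic ideals\<close>

abbreviation IV :: "complex poly set" where "IV \<equiv> int_valued_polys K"
abbreviation J :: "nat \<Rightarrow> complex set" where "J \<equiv> characteristic_ideal K"

lemma IV_D: "f \<in> IV \<Longrightarrow> coeff f i \<in> K" "f \<in> IV \<Longrightarrow> x \<in> OK \<Longrightarrow> poly f x \<in> OK"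
  by (auto simp: int_valued_polys_def)

lemma IV_add: "f \<in> IV \<Longrightarrow> g \<in> IV \<Longrightarrow> f + g \<in> IV"
  by (auto simp: int_valued_polys_def K_closed OK_closed)

lemma IV_diff: "f \<in> IV \<Longrightarrow> g \<in> IV \<Longrightarrow> f - g \<in> IV"
  by (auto simp: int_valued_polys_def K_closed OK_closed)

lemma IV_smult: "a \<in> OK \<Longrightarrow> f \<in> IV \<Longrightarrow> smult a f \<in> IV"
  using OK_subset_K by (auto simp: int_valued_polys_def intro: K_closed OK_closed)

lemma IV_pCons: "f \<in> IV \<Longrightarrow> pCons 0 f \<in> IV"
  by (auto simp: int_valued_polys_def coeff_pCons K_closed OK_closed split: nat.splits)

lemma K_coeff_pcompose_shift:
  assumes "\<And>i. coeff f i \<in> K"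
  shows "coeff (pcompose f [:1, 1:]) i \<in> K"
  using assms
proof (induction f arbitrary: i)
  case (pCons a f)
  have "a \<in> K" using pCons(3)[of 0] by simp
  moreover have "coeff (pcompose f [:1, 1:]) i \<in> K" for i
    using pCons(2) pCons(3)[of "Suc _"] by simp
  moreover define q where "q = pcompose f [:1, 1:]"
  moreover have "pcompose (pCons a f) [:1, 1:] = [:a:] + (q + pCons 0 q)"
    unfolding q_def by (simp add: pcompose_pCons)
  ultimately show ?case by (simp add: coeff_pCons K_closed split: nat.splits)
qed (auto simp: K_closed)

lemma IV_shift: "f \<in> IV \<Longrightarrow> pcompose f [:1, 1:] \<in> IV"
  using K_coeff_pcompose_shift[of f] OK_closed(2,7)
  by (auto simp: int_valued_polys_def poly_pcompose)

text \<open>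
  Taking the coefficient of \<open>X ^ m\<close> instead of the leading coefficient absorbs the element \<open>0\<close> and makes
  the closure properties evident.
\<close>

lemma J_iff: "c \<in> J m \<longleftrightarrow> (\<exists>f\<in>IV. degree f \<le> m \<and> coeff f m = c)"
proof
  assume "c \<in> J m"
  moreover have "0 \<in> IV" by (auto simp: int_valued_polys_def K_closed OK_closed)
  ultimately show "\<exists>f\<in>IV. degree f \<le> m \<and> coeff f m = c"
    unfolding characteristic_ideal_def by (auto intro: bexI[of _ 0])
next
  assume "\<exists>f\<in>IV. degree f \<le> m \<and> coeff f m = c"
  then obtain f where f: "f \<in> IV" "degree f \<le> m" "coeff f m = c" by blast
  show "c \<in> J m"
  proof (cases "c = 0")
    case False
    then have "degree f = m" using f le_degree by (metis antisym)
    then show ?thesis using f unfolding characteristic_ideal_def by auto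
  qed (simp add: characteristic_ideal_def)
qed

lemma J_closed:
  "0 \<in> J m" "1 \<in> J m" "c \<in> J m \<Longrightarrow> c \<in> K" "c \<in> J m \<Longrightarrow> d \<in> J m \<Longrightarrow> c + d \<in> J m"
  "a \<in> OK \<Longrightarrow> c \<in> J m \<Longrightarrow> a * c \<in> J m"
proof -
  show "0 \<in> J m" by (simp add: characteristic_ideal_def)
  have "monom 1 m \<in> IV"
    by (auto simp: int_valued_polys_def poly_monom K_closed OK_closed)
  then show "1 \<in> J m" unfolding J_iff by (intro bexI[of _ "monom 1 m"]) (auto simp: degree_monom_le)
  show "c \<in> K" if "c \<in> J m" using that IV_D(1) unfolding J_iff by blast
  show "a * c \<in> J m" if a: "a \<in> OK" and c: "c \<in> J m"
  proof -
    obtain f where f: "f \<in> IV" "degree f \<le> m" "coeff f m = c" using c unfolding J_iff by blast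
    show ?thesis unfolding J_iff
      by (intro bexI[of _ "smult a f"] conjI IV_smult a f order.trans[OF degree_smult_le]) (use f in simp)
  qed
  assume "c \<in> J m" "d \<in> J m"
  then obtain f g where f: "f \<in> IV" "degree f \<le> m" "coeff f m = c"
    and g: "g \<in> IV" "degree g \<le> m" "coeff g m = d" unfolding J_iff by metis
  show "c + d \<in> J m" unfolding J_iff
    by (intro bexI[of _ "f + g"] conjI IV_add degree_add_le f g) (use f g in simp)
qed

lemma J_mono: "J m \<subseteq> J (Suc m)"
proof
  fix c assume "c \<in> J m"
  then obtain f where f: "f \<in> IV" "degree f \<le> m" "coeff f m = c" unfolding J_iff by blast
  then show "c \<in> J (Suc m)" unfolding J_iff
    by (intro bexI[of _ "pCons 0 f"] conjI IV_pCons) (auto simp: degree_pCons_eq_if)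
qed

text \<open>
  Proved by recursion on \<open>f = a + X * g\<close>, for which the difference operator satisfies
  \<open>\<Delta> f = X * \<Delta> g + \<Delta> g + g\<close>.
\<close>

lemma forward_difference:
  fixes f :: "'a::comm_ring_1 poly"
  assumes "degree f \<le> Suc k"
  shows "degree (pcompose f [:1, 1:] - f) \<le> k"
    "coeff (pcompose f [:1, 1:] - f) k = of_nat (Suc k) * coeff f (Suc k)"
proof -
  have "degree (pcompose f [:1, 1:] - f) \<le> k \<and>
    coeff (pcompose f [:1, 1:] - f) k = of_nat (Suc k) * coeff f (Suc k)"
    using assms
  proof (induction k arbitrary: f)
    case 0
    obtain a g where f: "f = pCons a g" by (rule pCons_cases)
    have "degree g = 0" using 0 unfolding f by (cases "g = 0") auto
    then obtain b where "g = [:b:]" using degree_eq_zeroE by blast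
    then show ?case unfolding f by (simp add: pcompose_pCons)
  next
    case (Suc k)
    obtain a g where f: "f = pCons a g" by (rule pCons_cases)
    define d where "d = pcompose g [:1, 1:] - g"
    have g: "degree g \<le> Suc k" using Suc.prems unfolding f by (cases "g = 0") auto
    from Suc.IH[OF g] have d: "degree d \<le> k" "coeff d k = of_nat (Suc k) * coeff g (Suc k)"
      unfolding d_def by auto
    have eq: "pcompose f [:1, 1:] - f = pCons 0 d + d + g"
    proof -
      have "pcompose f [:1, 1:] = [:a:] + (pcompose g [:1, 1:] + pCons 0 (pcompose g [:1, 1:]))"
        unfolding f by (simp add: pcompose_pCons)
      also have "pcompose g [:1, 1:] = d + g" by (simp add: d_def)
      finally show ?thesis unfolding f by (simp add: poly_eq_iff coeff_pCons split: nat.splits)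
    qed
    have "degree (pCons 0 d + d + g) \<le> Suc k"
      by (intro degree_add_le) (use d g in \<open>auto simp: degree_pCons_eq_if\<close>)
    moreover have "coeff d (Suc k) = 0" using d(1) by (simp add: coeff_eq_0)
    moreover have "coeff f (Suc (Suc k)) = coeff g (Suc k)" unfolding f by simp
    ultimately show ?case unfolding eq using d(2) by (simp add: algebra_simps)
  qed
  then show "degree (pcompose f [:1, 1:] - f) \<le> k"
    "coeff (pcompose f [:1, 1:] - f) k = of_nat (Suc k) * coeff f (Suc k)" by auto
qed

text \<open>
  The forward difference of an integer-valued polynomial is integer-valued, of degree one less, and its
  leading coefficient is multiplied by the degree.
\<close>

lemma J_difference:
  assumes "c \<in> J (Suc m)"
  shows "of_nat (Suc m) * c \<in> J m"
proof -
  obtain f where f: "f \<in> IV" "degree f \<le> Suc m" "coeff f (Suc m) = c" using assms unfolding J_iff by blast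
  show ?thesis unfolding J_iff
    using forward_difference[OF f(2)] IV_diff[OF IV_shift[OF f(1)] f(1)] f(3)
    by (intro bexI[of _ "pcompose f [:1, 1:] - f"]) auto
qed

lemma fact_mult_lead_coeff:
  assumes "degree P \<le> d" "\<And>i. i \<le> d \<Longrightarrow> poly P (of_nat i) \<in> OK"
  shows "of_nat (fact d) * coeff P d \<in> OK"
  using assms
proof (induction d arbitrary: P)
  case 0
  then obtain c where "P = [:c:]" using degree_eq_zeroE by blast
  then show ?case using 0(2)[of 0] by simp
next
  case (Suc d)
  define Q where "Q = pcompose P [:1, 1:] - P"
  have "of_nat (fact d) * coeff Q d \<in> OK"
  proof (rule Suc.IH)
    show "degree Q \<le> d" unfolding Q_def by (rule forward_difference(1)[OF Suc.prems(1)])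
    show "poly Q (of_nat i) \<in> OK" if "i \<le> d" for i
      using OK_closed(8)[OF Suc.prems(2)[of "Suc i"] Suc.prems(2)[of i]] that
      unfolding Q_def by (simp add: poly_pcompose add.commute)
  qed
  then show ?case unfolding Q_def forward_difference(2)[OF Suc.prems(1)] by (simp add: algebra_simps)
qed

text \<open>
  The falling factorial \<open>X * (X - 1) * \<dots> * (X - m + 1)\<close>.
\<close>

definition falling :: "nat \<Rightarrow> 'a::comm_ring_1 poly" where
  "falling m = (\<Prod>i<m. [:- of_nat i, 1:])"

lemma falling_props:
  shows "degree (falling m :: 'a::{comm_ring_1,idom} poly) = m"
    "coeff (falling m :: 'a poly) m = 1"
    "poly (falling m) x = (\<Prod>i<m. x - of_nat i :: 'a)"
proof -
  show d: "degree (falling m :: 'a poly) = m"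
    unfolding falling_def by (subst degree_prod_eq_sum_degree) auto
  have "lead_coeff (falling m :: 'a poly) = 1" unfolding falling_def lead_coeff_prod by simp
  then show "coeff (falling m :: 'a poly) m = 1" unfolding d .
  show "poly (falling m) x = (\<Prod>i<m. x - of_nat i :: 'a)"
    unfolding falling_def poly_prod by simp
qed

text \<open>
  Newton interpolation at \<open>0, \<dots>, d\<close> has no denominators besides \<open>d!\<close>: subtracting a multiple of a
  falling factorial removes the leading term and leaves the values at smaller nodes unchanged.
\<close>

lemma fact_mult_poly_values:
  assumes "degree P \<le> d" "\<And>i. i \<le> d \<Longrightarrow> poly P (of_nat i) \<in> OK" "x \<in> OK"
  shows "of_nat (fact d) * poly P x \<in> OK"
  using assms(1,2)
proof (induction d arbitrary: P)
  case 0
  then obtain c where "P = [:c:]" using degree_eq_zeroE by blast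
  then show ?case using 0(2)[of 0] by simp
next
  case (Suc d)
  define c where "c = coeff P (Suc d)"
  define Q where "Q = P - smult c (falling (Suc d))"
  have "of_nat (fact d) * poly Q x \<in> OK"
  proof (rule Suc.IH)
    have "degree Q \<le> Suc d" unfolding Q_def
      by (intro degree_diff_le Suc.prems(1) order.trans[OF degree_smult_le]) (simp add: falling_props)
    moreover have "coeff Q (Suc d) = 0" unfolding Q_def c_def by (simp add: falling_props)
    ultimately have "degree Q \<noteq> Suc d \<or> Q = 0" by (metis leading_coeff_0_iff)
    with \<open>degree Q \<le> Suc d\<close> show "degree Q \<le> d" by auto
    show "poly Q (of_nat i) \<in> OK" if "i \<le> d" for i
    proof -
      have "poly (falling (Suc d)) (of_nat i :: complex) = 0"
        unfolding falling_props(3) by (rule prod_zero) (use that in auto)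
      then show ?thesis using Suc.prems(2)[of i] that unfolding Q_def by simp
    qed
  qed
  then have "of_nat (Suc d) * (of_nat (fact d) * poly Q x) \<in> OK"
    by (rule OK_closed(9)[OF OK_closed(4)])
  moreover have "poly (falling (Suc d)) x * (of_nat (fact (Suc d)) * c) \<in> OK"
    unfolding c_def falling_props(3)
    by (intro OK_closed(9) fact_mult_lead_coeff Suc.prems OK_prod OK_closed(8) assms(3)) (auto intro: OK_closed)
  moreover have "of_nat (fact (Suc d)) * poly P x =
      of_nat (Suc d) * (of_nat (fact d) * poly Q x) + poly (falling (Suc d)) x * (of_nat (fact (Suc d)) * c)"
    unfolding Q_def by (simp add: algebra_simps)
  ultimately show ?case using OK_closed(7) by metis
qed

lemma fact_mult_J: "c \<in> J m \<Longrightarrow> of_nat (fact m) * c \<in> OK"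
  unfolding J_iff using fact_mult_lead_coeff[of _ m] IV_D(2) OK_closed(4) by blast

lemma fractional_ideal_J: "fractional_ideal K (J m)"
proof -
  have "\<exists>d\<in>OK. d \<noteq> 0 \<and> (\<forall>x\<in>J m. d * x \<in> OK)"
    using fact_mult_J OK_closed(4)[of "fact m"] by (intro bexI[of _ "of_nat (fact m)"]) auto
  moreover have "J m \<noteq> {0}" using J_closed(2)[of m] by auto
  moreover have "J m \<subseteq> K" using J_closed(3) by blast
  ultimately show ?thesis unfolding fractional_ideal_def using J_closed by simp
qed

lemma OK_subset_J: "OK \<subseteq> J m"
proof
  fix x assume "x \<in> OK"
  then show "x \<in> J m" using J_closed(5)[of x 1 m] J_closed(2) by simp
qed

end

section \<open>Totally ramified primes from Eisenstein polynomials\<close>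

definition eisenstein_at :: "int poly \<Rightarrow> nat \<Rightarrow> bool" where
  "eisenstein_at F q \<longleftrightarrow> prime q \<and> (\<forall>i<degree F. int q dvd coeff F i)
     \<and> \<not> (int q)\<^sup>2 dvd coeff F 0"

text \<open>
  All lower coefficients of \<open>F\<close> are divisible by \<open>q\<close>, and \<open>h\<close> is up to sign the constant coefficient
  divided by \<open>q\<close>.
\<close>

lemma eisenstein_root_power:
  fixes \<eta> :: complex
  assumes eis: "eisenstein_at F q" and monic: "lead_coeff F = 1" and deg: "degree F > 0"
    and root: "poly (map_poly of_int F) \<eta> = 0"
  obtains h :: int and P :: "int poly" where "coprime h (int q)"
    "\<eta> ^ degree F = - of_nat q * (of_int h + \<eta> * poly (map_poly of_int P) \<eta>)"
proof -
  have q: "prime q" "q > 0" using eis unfolding eisenstein_at_def by (auto intro: prime_gt_0_nat)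
  define G where "G = monom 1 (degree F) - F"
  have "int q dvd coeff G i" for i
    using eis monic coeff_eq_0[of F i] unfolding G_def eisenstein_at_def
    by (cases i "degree F" rule: linorder_cases) auto
  then obtain e where e: "\<And>i. coeff G i = int q * e i" unfolding dvd_def by metis
  have "[:int q:] dvd G" unfolding const_poly_dvd_iff using e by auto
  then obtain H where H: "G = [:int q:] * H" by (elim dvdE)
  obtain h P where hP: "H = pCons h P" by (rule pCons_cases)
  have c0: "coeff F 0 = - (int q * h)"
  proof -
    have "coeff G 0 = int q * h" unfolding H hP by simp
    then show ?thesis unfolding G_def using deg by simp
  qed
  have "coprime (int q) (- h)"
  proof (rule prime_imp_coprime)
    show "prime (int q)" using q by simp
    show "\<not> int q dvd - h"
    proof
      assume "int q dvd - h"
      then have "(int q)\<^sup>2 dvd coeff F 0" unfolding c0 power2_eq_square by (simp add: mult_dvd_mono)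
      then show False using eis unfolding eisenstein_at_def by blast
    qed
  qed
  then have "coprime (- h) (int q)" by (rule coprime_commute[THEN iffD1])
  moreover have "\<eta> ^ degree F = - of_nat q * (of_int (- h) + \<eta> * poly (map_poly of_int (- P)) \<eta>)"
  proof -
    have "\<eta> ^ degree F = poly (map_poly of_int (G + F)) \<eta>"
      unfolding G_def by (simp add: map_poly_monom poly_monom)
    also have "\<dots> = poly (map_poly of_int G) \<eta>" using root by (simp add: of_int_poly_hom.hom_add)
    also have "\<dots> = of_nat q * (of_int h + \<eta> * poly (map_poly of_int P) \<eta>)"
      unfolding H hP by (simp add: of_int_hom.map_poly_pCons_hom of_int_hom.map_poly_hom_smult algebra_simps)
    finally show ?thesis by (simp add: of_int_poly_hom.hom_uminus algebra_simps)
  qed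
  ultimately show ?thesis using that by blast
qed

lemma algebraic_int_bezout:
  fixes x :: "'a::field_char_0"
  assumes "coprime a b" "algebraic_int (of_int a * x)" "algebraic_int (of_int b * x)"
  shows "algebraic_int x"
proof -
  obtain u v where "u * a + v * b = 1" using assms(1) bezout_int[of a b] by (auto simp: coprime_iff_gcd_eq_1)
  then have "x = of_int (u * a + v * b) * x" by simp
  also have "\<dots> = of_int u * (of_int a * x) + of_int v * (of_int b * x)" by (simp add: algebra_simps)
  also have "algebraic_int \<dots>" by (intro algebraic_int_plus algebraic_int_times assms) auto
  finally show ?thesis .
qed

lemma algebraic_int_of_int_divide:
  assumes "algebraic_int (of_int a / of_int b :: complex)" "b \<noteq> 0"
  shows "b dvd a"
proof -
  have "(of_int a / of_int b :: complex) \<in> \<int>"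
    by (rule rational_algebraic_int_is_int[OF assms(1)]) auto
  then obtain c where "(of_int a / of_int b :: complex) = of_int c" by (auto elim: Ints_cases)
  then have "(of_int a :: complex) = of_int (b * c)" using assms(2) by (simp add: field_simps)
  then have "a = b * c" by (simp only: of_int_eq_iff)
  then show ?thesis by simp
qed

text \<open>
  The order \<open>\<int>[\<eta>]\<close> is maximal at \<open>q\<close>. Let \<open>c i\<close> be the first coefficient that \<open>q\<close> does not divide, and
  multiply the combination by \<open>\<eta> ^ (n - 1 - i)\<close>. The terms below \<open>i\<close> are divisible by \<open>q\<close>, and so are
  the terms above \<open>i\<close>, because they contain \<open>\<eta> ^ n\<close>. Hence \<open>q\<close> divides \<open>c i * \<eta> ^ (n - 1)\<close> and therefore
  \<open>\<eta> ^ (n - 1)\<close>. Comparison with \<open>\<eta> ^ n = - q * (h + \<eta> * r)\<close> shows that \<open>\<eta>\<close> divides \<open>h\<close>, so \<open>q\<close> divides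
  \<open>h ^ n\<close>, which is impossible.
\<close>

theorem eisenstein_saturated:
  fixes \<eta> :: complex and c :: "nat \<Rightarrow> int"
  assumes eis: "eisenstein_at F q" and monic: "lead_coeff F = 1" and deg: "degree F > 0"
    and root: "poly (map_poly of_int F) \<eta> = 0"
    and int: "algebraic_int ((\<Sum>i<degree F. of_int (c i) * \<eta> ^ i) / of_nat q)"
    and i: "i < degree F"
  shows "int q dvd c i"
  using i
proof (induction i rule: less_induct)
  case (less i)
  define n where "n = degree F"
  have q: "prime q" "q > 0" "of_nat q \<noteq> (0::complex)" using eis unfolding eisenstein_at_def by (auto dest: prime_gt_0_nat)
  have alg_eta: "algebraic_int \<eta>" unfolding algebraic_int_altdef_ipoly using monic root by auto
  obtain h P where h: "coprime h (int q)"
    "\<eta> ^ n = - of_nat q * (of_int h + \<eta> * poly (map_poly of_int P) \<eta>)"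
    using eisenstein_root_power[OF eis monic deg root] unfolding n_def by blast
  define r where "r = poly (map_poly of_int P) \<eta>"
  have r: "algebraic_int r" unfolding r_def by (rule algebraic_int_of_int_poly[OF alg_eta])
  have eta_n: "algebraic_int (\<eta> ^ n / of_nat q)"
  proof -
    have "\<eta> ^ n / of_nat q = - (of_int h + \<eta> * r)" using h(2) q(3) unfolding r_def by (simp add: field_simps)
    moreover have "algebraic_int (- (of_int h + \<eta> * r))"
      by (intro algebraic_int_minus algebraic_int_plus algebraic_int_times alg_eta r) simp
    ultimately show ?thesis by simp
  qed
  show ?case
  proof (rule ccontr)
    assume ndvd: "\<not> int q dvd c i"
    have "i < n" using less.prems by (simp add: n_def)
    define m where "m = n - 1 - i"
    have split: "{..<n} = {..<i} \<union> {i} \<union> {i<..<n}" using \<open>i < n\<close> by auto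
    have "algebraic_int (((\<Sum>j<n. of_int (c j) * \<eta> ^ j) / of_nat q) * \<eta> ^ m)"
      using int unfolding n_def by (intro algebraic_int_times algebraic_int_power alg_eta)
    also have "((\<Sum>j<n. of_int (c j) * \<eta> ^ j) / of_nat q) * \<eta> ^ m
        = (\<Sum>j<n. of_int (c j) * \<eta> ^ (j + m) / of_nat q)"
      by (simp add: sum_distrib_right sum_divide_distrib power_add mult.assoc)
    also have "\<dots> = (\<Sum>j<i. of_int (c j) * \<eta> ^ (j + m) / of_nat q) + of_int (c i) * \<eta> ^ (i + m) / of_nat q
        + (\<Sum>j\<in>{i<..<n}. of_int (c j) * \<eta> ^ (j + m) / of_nat q)"
      unfolding split by (subst sum.union_disjoint, auto)+
    finally have total: "algebraic_int ((\<Sum>j<i. of_int (c j) * \<eta> ^ (j + m) / of_nat q)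
        + of_int (c i) * \<eta> ^ (i + m) / of_nat q
        + (\<Sum>j\<in>{i<..<n}. of_int (c j) * \<eta> ^ (j + m) / of_nat q))" .
    have low: "algebraic_int (\<Sum>j<i. of_int (c j) * \<eta> ^ (j + m) / of_nat q)"
    proof (rule algebraic_int_sum)
      fix j assume "j \<in> {..<i}"
      then have "int q dvd c j" using less.IH[of j] less.prems by auto
      then obtain e where "c j = int q * e" by (elim dvdE)
      then have "of_int (c j) * \<eta> ^ (j + m) / of_nat q = of_int e * \<eta> ^ (j + m)"
        using q(3) by simp
      then show "algebraic_int (of_int (c j) * \<eta> ^ (j + m) / of_nat q)"
        using alg_eta by (auto intro: algebraic_int_times algebraic_int_power)
    qed
    have high: "algebraic_int (\<Sum>j\<in>{i<..<n}. of_int (c j) * \<eta> ^ (j + m) / of_nat q)"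
    proof (rule algebraic_int_sum)
      fix j assume "j \<in> {i<..<n}"
      then have "j + m = n + (j - Suc i)" using \<open>i < n\<close> unfolding m_def by auto
      then have eq: "of_int (c j) * \<eta> ^ (j + m) / of_nat q = of_int (c j) * \<eta> ^ (j - Suc i) * (\<eta> ^ n / of_nat q)"
        by (simp add: power_add)
      show "algebraic_int (of_int (c j) * \<eta> ^ (j + m) / of_nat q)"
        unfolding eq by (intro algebraic_int_times algebraic_int_power alg_eta eta_n) simp
    qed
    have "algebraic_int (of_int (c i) * (\<eta> ^ (n - 1) / of_nat q))"
    proof -
      have "i + m = n - 1" using \<open>i < n\<close> unfolding m_def by auto
      then show ?thesis using algebraic_int_diff[OF algebraic_int_diff[OF total high] low]
        by (simp add: algebra_simps)
    qed
    moreover have "algebraic_int (of_int (int q) * (\<eta> ^ (n - 1) / of_nat q))"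
      using q(3) alg_eta by (simp add: algebraic_int_power)
    moreover have "coprime (c i) (int q)"
      using ndvd q(1) prime_imp_coprime[of "int q" "c i"] by (simp add: coprime_commute)
    ultimately have z: "algebraic_int (\<eta> ^ (n - 1) / of_nat q)" using algebraic_int_bezout by blast
    define z where "z = \<eta> ^ (n - 1) / of_nat q"
    have "\<eta> ^ n = of_nat q * (\<eta> * z)"
      unfolding z_def using q(3) deg by (simp add: n_def power_eq_if)
    with h(2) have "of_nat q * (\<eta> * z) = of_nat q * (- of_int h - \<eta> * r)" by (simp add: r_def algebra_simps)
    then have "\<eta> * z = - of_int h - \<eta> * r" using q(3) mult_left_cancel by blast
    then have "of_int h = - (\<eta> * (z + r))" by (simp add: algebra_simps)
    then have "of_int h ^ n = \<eta> ^ n * (- (z + r)) ^ n"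
      by (metis mult_minus_right power_mult_distrib)
    then have "of_int (h ^ n) / of_int (int q) = (\<eta> ^ n / of_nat q) * (- (z + r)) ^ n" by simp
    moreover have "algebraic_int \<dots>"
      using eta_n z r unfolding z_def
      by (intro algebraic_int_times algebraic_int_power algebraic_int_minus algebraic_int_plus)
    ultimately have "int q dvd h ^ n" using algebraic_int_of_int_divide[of "h ^ n" "int q"] q(2) by simp
    moreover have "coprime (h ^ n) (int q)" using h(1) by simp
    ultimately have "is_unit (int q)" by (meson coprime_common_divisor dvd_refl)
    then show False using q(1) by (metis not_prime_unit prime_nat_int_transfer)
  qed
qed

text \<open>
  By saturation the coefficients of a vanishing integer combination of \<open>1, \<dots>, \<eta> ^ (n - 1)\<close> are all
  divisible by \<open>q\<close>, and dividing them by \<open>q\<close> gives another such combination.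
\<close>

lemma eisenstein_minimal:
  fixes \<eta> :: complex and R :: "rat poly"
  assumes eis: "eisenstein_at F q" and monic: "lead_coeff F = 1"
    and root: "poly (map_poly of_int F) \<eta> = 0"
    and R: "degree R < degree F" "ev \<eta> R = 0"
  shows "R = 0"
proof (rule ccontr)
  assume "R \<noteq> 0"
  have deg: "degree F > 0" using R by simp
  have q: "prime q" using eis unfolding eisenstein_at_def by simp
  obtain d P where d: "d > 0" "map_poly of_int P = smult (of_int d) R"
    using common_denominator by blast
  have P0: "P \<noteq> 0" using d \<open>R \<noteq> 0\<close> by auto
  have "degree (map_poly rat_of_int P) = degree R" unfolding d(2) using d(1) by simp
  then have dP: "degree P = degree R" by (simp add: degree_map_poly)
  have Peta: "poly (map_poly of_int P) \<eta> = 0"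
    using R(2) d(2) ev_of_int[of \<eta> P] by simp
  have "Q = 0" if "degree Q < degree F" "poly (map_poly of_int Q) \<eta> = 0" for Q :: "int poly"
    using that
  proof (induction "nat \<bar>lead_coeff Q\<bar>" arbitrary: Q rule: less_induct)
    case less
    have "poly (map_poly of_int Q) \<eta> = (\<Sum>i\<le>degree Q. of_int (coeff Q i) * \<eta> ^ i)"
      by (simp add: poly_altdef degree_map_poly coeff_map_poly)
    also have "\<dots> = (\<Sum>i<degree F. of_int (coeff Q i) * \<eta> ^ i)"
      by (rule sum.mono_neutral_left) (use less.prems in \<open>auto simp: coeff_eq_0\<close>)
    finally have "(\<Sum>i<degree F. of_int (coeff Q i) * \<eta> ^ i) = 0" using less.prems by simp
    then have "int q dvd coeff Q i" if "i < degree F" for i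
      using eisenstein_saturated[OF eis monic deg root _ that, of "coeff Q"] by simp
    then have "\<forall>i. int q dvd coeff Q i"
      using less.prems(1) by (metis coeff_eq_0 dvd_0_right le_less_trans not_le)
    then have "[:int q:] dvd Q" by (simp add: const_poly_dvd_iff)
    then obtain S where S: "Q = [:int q:] * S" by (elim dvdE)
    show "Q = 0"
    proof (rule ccontr)
      assume "Q \<noteq> 0"
      have "degree S = degree Q" "lead_coeff Q = int q * lead_coeff S"
        unfolding S using q prime_gt_0_nat[OF q] by auto
      moreover have "lead_coeff S \<noteq> 0" using \<open>Q \<noteq> 0\<close> S by auto
      moreover have "poly (map_poly of_int S) \<eta> = 0"
        using less.prems(2) prime_gt_0_nat[OF q] unfolding S by (simp add: of_int_hom.map_poly_hom_smult)
      moreover have "nat \<bar>lead_coeff S\<bar> < nat \<bar>int q * lead_coeff S\<bar>"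
        using prime_gt_1_nat[OF q] \<open>lead_coeff S \<noteq> 0\<close> by (simp add: abs_mult nat_mult_distrib)
      ultimately have "S = 0" using less.hyps[of S] less.prems(1) by simp
      then show False using \<open>Q \<noteq> 0\<close> S by simp
    qed
  qed
  then show False using P0 Peta dP R(1) by simp
qed

context number_field_root
begin

text \<open>
  The ideal generated by \<open>q\<close> and \<open>\<eta>\<close>. If \<open>F\<close> is Eisenstein at \<open>q\<close>, it is the unique prime above \<open>q\<close>.
\<close>

definition ramified_ideal :: "nat \<Rightarrow> complex set" where
  "ramified_ideal q = {of_nat q * x + \<eta> * y | x y. x \<in> OK \<and> y \<in> OK}"

abbreviation ideal_pow :: "complex set \<Rightarrow> nat \<Rightarrow> complex set" where
  "ideal_pow I k \<equiv> I [^]\<^bsub>FI\<^esub> k"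

lemma ideal_pow_simps [simp]: "ideal_pow I 0 = OK" "ideal_pow I (Suc k) = ideal_pow I k \<star> I"
  by (simp_all add: nat_pow_def)

lemma fractional_ideal_pow: "fractional_ideal K I \<Longrightarrow> fractional_ideal K (ideal_pow I k)"
  by (induction k) (auto intro: fractional_ideal_OK fractional_ideal_mult)

lemma ramified_idealI:
  "x \<in> OK \<Longrightarrow> y \<in> OK \<Longrightarrow> of_nat q * x + \<eta> * y \<in> ramified_ideal q"
  unfolding ramified_ideal_def by blast

lemma ramified_ideal_closed:
  shows "0 \<in> ramified_ideal q" "of_nat q \<in> ramified_ideal q" "\<eta> \<in> ramified_ideal q"
    "ramified_ideal q \<subseteq> OK"
    "x \<in> ramified_ideal q \<Longrightarrow> y \<in> ramified_ideal q \<Longrightarrow> x + y \<in> ramified_ideal q"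
    "a \<in> OK \<Longrightarrow> x \<in> ramified_ideal q \<Longrightarrow> a * x \<in> ramified_ideal q"
proof -
  show "0 \<in> ramified_ideal q" "of_nat q \<in> ramified_ideal q" "\<eta> \<in> ramified_ideal q"
    using ramified_idealI[of 0 0 q] ramified_idealI[of 1 0 q] ramified_idealI[of 0 1 q] OK_closed(1,2) by simp_all
  show "ramified_ideal q \<subseteq> OK"
    unfolding ramified_ideal_def using OK_closed(4,5,7,9) by blast
  show "a * x \<in> ramified_ideal q" if a: "a \<in> OK" and x: "x \<in> ramified_ideal q"
  proof -
    obtain u v where "x = of_nat q * u + \<eta> * v" "u \<in> OK" "v \<in> OK" using x unfolding ramified_ideal_def by blast
    then have "a * x = of_nat q * (a * u) + \<eta> * (a * v)" "a * u \<in> OK" "a * v \<in> OK"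
      using a by (auto simp: algebra_simps intro: OK_closed)
    then show ?thesis using ramified_idealI by simp
  qed
  assume "x \<in> ramified_ideal q" "y \<in> ramified_ideal q"
  then obtain u v u' v' where "x = of_nat q * u + \<eta> * v" "u \<in> OK" "v \<in> OK"
    "y = of_nat q * u' + \<eta> * v'" "u' \<in> OK" "v' \<in> OK" unfolding ramified_ideal_def by blast
  then have "x + y = of_nat q * (u + u') + \<eta> * (v + v')" "u + u' \<in> OK" "v + v' \<in> OK"
    by (auto simp: algebra_simps intro: OK_closed)
  then show "x + y \<in> ramified_ideal q" using ramified_idealI by simp
qed

lemma fractional_ideal_ramified:
  assumes "q > 0"
  shows "fractional_ideal K (ramified_ideal q)"
proof -
  have "ramified_ideal q \<noteq> {0}" using ramified_ideal_closed(2)[of q] assms by auto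
  moreover have "\<exists>d\<in>OK. d \<noteq> 0 \<and> (\<forall>x\<in>ramified_ideal q. d * x \<in> OK)"
    using OK_closed(2) ramified_ideal_closed(4) by (intro bexI[of _ 1]) auto
  moreover have "ramified_ideal q \<subseteq> K" using ramified_ideal_closed(4) OK_subset_K by blast
  ultimately show ?thesis
    unfolding fractional_ideal_def using ramified_ideal_closed by simp
qed

context
  fixes q :: nat
  assumes eis: "eisenstein_at F q"
begin

lemma prime_q: "prime q" using eis unfolding eisenstein_at_def by simp

lemma q_pos: "q > 0" using prime_q by (rule prime_gt_0_nat)

lemma fractional_ideal_QQ: "fractional_ideal K (ramified_ideal q)"
  using fractional_ideal_ramified[OF q_pos] .

lemma eta_power:
  obtains h :: int and r where "coprime h (int q)" "r \<in> OK" "\<eta> ^ n = - of_nat q * (of_int h + \<eta> * r)"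
  using eisenstein_root_power[OF eis monic degree_pos root] OK_int_poly[OF OK_closed(5)] by metis

lemma eta_power_divisible: "\<exists>t\<in>OK. \<eta> ^ n = of_nat q * t"
proof -
  obtain h r where h: "r \<in> OK" "\<eta> ^ n = - of_nat q * (of_int h + \<eta> * r)" using eta_power by metis
  have "- (of_int h + \<eta> * r) \<in> OK" by (intro OK_closed h)
  moreover have "\<eta> ^ n = of_nat q * (- (of_int h + \<eta> * r))" using h(2) by (simp add: algebra_simps)
  ultimately show ?thesis by blast
qed

lemma difference_of_powers_divisible:
  assumes "a \<in> OK" "b \<in> OK"
  shows "\<exists>t\<in>OK. a ^ m - b ^ m = (a - b) * t"
proof -
  have "a ^ m - b ^ m = (a - b) * (\<Sum>i<m. b ^ (m - Suc i) * a ^ i)"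
    using power_diff_sumr2[of a m b] by simp
  moreover have "(\<Sum>i<m. b ^ (m - Suc i) * a ^ i) \<in> OK"
    by (intro OK_sum OK_closed(9,10) assms)
  ultimately show ?thesis by blast
qed

text \<open>
  One inclusion holds because \<open>q\<close> divides \<open>\<eta> ^ n\<close>. For the other, the ideal on the left contains
  \<open>q ^ n\<close>, \<open>q * \<eta> ^ (n - 1)\<close> and \<open>\<eta> ^ n = - q * (h + \<eta> * r)\<close>. Multiplying the last element by the
  cofactor of \<open>h + \<eta> * r\<close> in \<open>h ^ (n - 1) - (- \<eta> * r) ^ (n - 1)\<close> gives \<open>q * h ^ (n - 1)\<close>, and \<open>h\<close> is
  prime to \<open>q\<close>.
\<close>

theorem ramified_ideal_power: "ideal_pow (ramified_ideal q) n = principal (of_nat q)"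
proof
  let ?Q = "ramified_ideal q"
  have up: "\<exists>u\<in>OK. \<exists>v\<in>OK. x = of_nat q * u + \<eta> ^ k * v" if "x \<in> ideal_pow ?Q k" for x k
    using that
  proof (induction k arbitrary: x)
    case 0
    then show ?case using OK_closed(1) by (intro bexI[of _ 0] bexI[of _ x]) auto
  next
    case (Suc k)
    from Suc.prems have "x \<in> ideal_pow ?Q k \<star> ?Q" by simp
    then show ?case
    proof (induction rule: ideal_mult_induct)
      case (mult i j)
      obtain u v where i: "i = of_nat q * u + \<eta> ^ k * v" "u \<in> OK" "v \<in> OK" using Suc.IH[OF mult(1)] by blast
      obtain a b where j: "j = of_nat q * a + \<eta> * b" "a \<in> OK" "b \<in> OK"
        using mult(2) unfolding ramified_ideal_def by blast
      have "i * j = of_nat q * (u * j + \<eta> ^ k * v * a) + \<eta> ^ Suc k * (v * b)"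
        unfolding i(1) j(1) by (simp add: algebra_simps)
      moreover have "u * j + \<eta> ^ k * v * a \<in> OK" "v * b \<in> OK"
        unfolding j(1) by (intro OK_closed i j)+
      ultimately show ?case by blast
    next
      case (add x y)
      then obtain u v u' v' where "u \<in> OK" "v \<in> OK" "x = of_nat q * u + \<eta> ^ Suc k * v"
        "u' \<in> OK" "v' \<in> OK" "y = of_nat q * u' + \<eta> ^ Suc k * v'" by blast
      then have "x + y = of_nat q * (u + u') + \<eta> ^ Suc k * (v + v')" "u + u' \<in> OK" "v + v' \<in> OK"
        by (auto simp: algebra_simps intro: OK_closed)
      then show ?case by blast
    qed
  qed
  obtain t where t: "t \<in> OK" "\<eta> ^ n = of_nat q * t" using eta_power_divisible by blast
  show "ideal_pow ?Q n \<subseteq> principal (of_nat q)"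
  proof
    fix x assume "x \<in> ideal_pow ?Q n"
    then obtain u v where "u \<in> OK" "v \<in> OK" "x = of_nat q * u + \<eta> ^ n * v" using up by blast
    then have "x = of_nat q * (u + t * v)" "u + t * v \<in> OK" using t by (auto simp: algebra_simps intro: OK_closed)
    then show "x \<in> principal (of_nat q)" unfolding principal_def by blast
  qed
  have Qn: "fractional_ideal K (ideal_pow ?Q n)" by (rule fractional_ideal_pow[OF fractional_ideal_QQ])
  have pow: "x ^ k \<in> ideal_pow ?Q k" if "x \<in> ?Q" for x k
  proof (induction k)
    case (Suc k)
    then show ?case using ideal_mult_intro[OF Suc that] by (simp add: mult.commute)
  qed (simp add: OK_closed)
  obtain n' where n': "n = Suc n'" using degree_pos by (cases n) auto
  have mixed: "of_nat q * \<eta> ^ n' \<in> ideal_pow ?Q n"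
    unfolding n' using ideal_mult_intro[OF pow[OF ramified_ideal_closed(3)] ramified_ideal_closed(2), of n']
    by (simp add: mult.commute)
  obtain h r where h: "coprime h (int q)" "r \<in> OK" "\<eta> ^ n = - of_nat q * (of_int h + \<eta> * r)"
    using eta_power by metis
  obtain T where T: "T \<in> OK" "of_int h ^ n' - (- \<eta> * r) ^ n' = (of_int h - (- \<eta> * r)) * T"
    using difference_of_powers_divisible[OF OK_closed(3) OK_closed(9)[OF OK_closed(6)[OF OK_closed(5)] h(2)], of h n']
    by blast
  have "of_int (h ^ n') * of_nat q = (- T) * \<eta> ^ n + ((- 1) ^ n' * r ^ n') * (of_nat q * \<eta> ^ n')"
  proof -
    have "(- \<eta> * r) ^ n' = (- 1) ^ n' * r ^ n' * \<eta> ^ n'"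
      by (simp add: power_mult_distrib[symmetric] mult_ac)
    then have "of_int h ^ n' = (of_int h + \<eta> * r) * T + (- 1) ^ n' * r ^ n' * \<eta> ^ n'"
      using T(2) by (simp add: algebra_simps)
    then show ?thesis unfolding h(3) by (simp add: algebra_simps)
  qed
  also have "\<dots> \<in> ideal_pow ?Q n"
    using h(2) T(1) by (intro fractional_idealD(4,5)[OF Qn] mixed pow ramified_ideal_closed(3) OK_closed(6,9,10,2)) auto
  finally have 1: "of_int (h ^ n') * of_nat q \<in> ideal_pow ?Q n" .
  have "of_int (int q ^ n') * of_nat q = (of_nat q :: complex) ^ n" unfolding n' by simp
  also have "\<dots> \<in> ideal_pow ?Q n" by (rule pow[OF ramified_ideal_closed(2)])
  finally have 2: "of_int (int q ^ n') * of_nat q \<in> ideal_pow ?Q n" .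
  have "of_nat q \<in> ideal_pow ?Q n"
    by (rule fractional_ideal_bezout[OF Qn _ 1 2]) (use h(1) in simp)
  then show "principal (of_nat q) \<subseteq> ideal_pow ?Q n" using principal_subset_iff[OF Qn] by simp
qed

text \<open>
  The residue field has \<open>q\<close> elements: by saturation an integer of \<open>K\<close> can be written with a denominator
  prime to \<open>q\<close> in terms of the powers of \<open>\<eta>\<close>, and these vanish modulo the ideal except for \<open>\<eta> ^ 0\<close>.
\<close>

lemma congruent_integer:
  assumes "x \<in> OK"
  shows "\<exists>k::int. x - of_int k \<in> ramified_ideal q"
proof -
  have "\<exists>k::int. x - of_int k \<in> ramified_ideal q"
    if "d > 0" "of_int d * x = (\<Sum>i<n. of_int (c i) * \<eta> ^ i)" for d :: int and c :: "nat \<Rightarrow> int"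
    using that
  proof (induction "nat d" arbitrary: d c rule: less_induct)
    case less
    show ?case
    proof (cases "int q dvd d")
      case True
      then obtain e where e: "d = int q * e" by (elim dvdE)
      have "(\<Sum>i<n. of_int (c i) * \<eta> ^ i) / of_nat q = of_int e * x"
        unfolding less.prems(2)[symmetric] e using q_pos by simp
      moreover have "algebraic_int (of_int e * x)" using assms OK_iff by (auto intro: algebraic_int_times)
      ultimately have int: "algebraic_int ((\<Sum>i<n. of_int (c i) * \<eta> ^ i) / of_nat q)" by simp
      have "\<forall>i<n. int q dvd c i"
        using eisenstein_saturated[OF eis monic degree_pos root int] by blast
      then have c: "c i = int q * (c i div int q)" if "i < n" for i using that by simp
      have "of_nat q * (of_int e * x) = of_int d * x" unfolding e by simp
      also have "\<dots> = (\<Sum>i<n. of_nat q * (of_int (c i div int q) * \<eta> ^ i))"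
        unfolding less.prems(2)
      proof (rule sum.cong)
        fix i assume "i \<in> {..<n}"
        then have "of_int (c i) = of_nat q * (of_int (c i div int q) :: complex)"
          using c[of i] by (metis lessThan_iff of_int_mult of_int_of_nat_eq)
        then show "of_int (c i) * \<eta> ^ i = of_nat q * (of_int (c i div int q) * \<eta> ^ i)" by simp
      qed simp
      finally have ex: "of_int e * x = (\<Sum>i<n. of_int (c i div int q) * \<eta> ^ i)"
        using q_pos by (simp add: sum_distrib_left[symmetric])
      have "e > 0" using less.prems(1) q_pos unfolding e by (simp add: zero_less_mult_iff)
      have "nat e < nat d"
        unfolding e using prime_gt_1_nat[OF prime_q] \<open>e > 0\<close> by (simp add: nat_mult_distrib)
      then show ?thesis by (rule less.hyps[OF _ \<open>e > 0\<close> ex])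
    next
      case False
      then have "coprime (int q) d" using prime_q by (intro prime_imp_coprime) auto
      then obtain u v where uv: "u * int q + v * d = 1"
        using bezout_int[of "int q" d] by (auto simp: coprime_iff_gcd_eq_1)
      obtain n' where n': "n = Suc n'" using degree_pos by (cases n) auto
      define w where "w = (\<Sum>i<n'. of_int (c (Suc i)) * \<eta> ^ i)"
      have w: "w \<in> OK" unfolding w_def by (intro OK_sum OK_closed)
      have dx: "of_int d * x = of_int (c 0) + \<eta> * w"
        unfolding less.prems(2) n' w_def sum.lessThan_Suc_shift
        by (simp add: sum_distrib_left mult_ac)
      have "x = of_int (u * int q + v * d) * x" using uv by simp
      also have "\<dots> = of_nat q * (of_int u * x) + of_int v * (of_int d * x)" by (simp add: algebra_simps)
      also have "\<dots> = of_nat q * (of_int u * x) + \<eta> * (of_int v * w) + of_int (v * c 0)"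
        unfolding dx by (simp add: algebra_simps)
      finally have "x - of_int (v * c 0) = of_nat q * (of_int u * x) + \<eta> * (of_int v * w)"
        by (simp only: diff_eq_eq)
      also have "\<dots> \<in> ramified_ideal q" by (intro ramified_idealI OK_closed assms w)
      finally show ?thesis by blast
    qed
  qed
  then show ?thesis using OK_integer_coordinates assms by blast
qed

text \<open>
  One of the \<open>q\<close> factors \<open>x - i\<close> lies in the ideal.
\<close>

lemma falling_value_in_ramified_ideal:
  assumes "x \<in> OK"
  shows "poly (falling q) x \<in> ramified_ideal q"
proof -
  obtain k :: int where k: "x - of_int k \<in> ramified_ideal q" using congruent_integer[OF assms] by blast
  define i where "i = nat (k mod int q)"
  have i: "i < q" "int i = k mod int q" unfolding i_def using q_pos by (auto simp: nat_less_iff)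
  obtain e where e: "k - int i = int q * e" using i(2) by (metis dvd_minus_mod dvdE)
  have "x - of_nat i = (x - of_int k) + of_int (k - int i)" by simp
  also have "\<dots> = (x - of_int k) + of_int e * of_nat q" unfolding e by simp
  also have "\<dots> \<in> ramified_ideal q"
    by (intro ramified_ideal_closed(5,6) k OK_closed ramified_ideal_closed(2))
  finally have xi: "x - of_nat i \<in> ramified_ideal q" .
  have "poly (falling q) x = (\<Prod>j\<in>{..<q} - {i}. x - of_nat j) * (x - of_nat i)"
    unfolding falling_props(3) using i(1) by (subst prod.remove[of _ i]) auto
  then show ?thesis
    using xi assms by (auto intro!: ramified_ideal_closed(6) OK_prod OK_closed)
qed

lemma coprime_fact_q: "coprime (int (fact (q - 1))) (int q)"
proof -
  have "\<not> q dvd fact (q - 1)" using prime_q q_pos by (subst prime_dvd_fact_iff) auto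
  then have "coprime q (fact (q - 1))" using prime_q prime_imp_coprime by blast
  from coprime_commute[THEN iffD1, OF this] show ?thesis by (simp only: coprime_int_iff)
qed

text \<open>
  Let \<open>c\<close> be the leading coefficient of \<open>f\<close> of degree \<open>q\<close>. Interpolation at \<open>0, \<dots>, q - 1\<close> shows that
  \<open>(q - 1)! * c * \<eta> * (\<eta> - 1) * \<dots> * (\<eta> - (q - 1))\<close> is integral. The factors other than \<open>\<eta>\<close> multiply to
  \<open>g + \<eta> * r\<close> with an integer \<open>g\<close> prime to \<open>q\<close>; this divides \<open>g ^ n\<close> modulo \<open>\<eta> ^ n\<close>, hence modulo \<open>q\<close>. So
  an integer prime to \<open>q\<close> multiplies \<open>\<eta> * c\<close> into \<open>J (q - 1)\<close>, and so does \<open>q\<close>, by \<open>J_difference\<close>.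
\<close>

lemma eta_mult_J:
  assumes c: "c \<in> J q"
  shows "\<eta> * c \<in> J (q - 1)"
proof -
  obtain q' where q': "q = Suc q'" using q_pos by (cases q) auto
  have J': "fractional_ideal K (J q')" by (rule fractional_ideal_J)
  have qc: "of_nat q * c \<in> J q'" using J_difference c unfolding q' by blast
  obtain f where f: "f \<in> IV" "degree f \<le> q" "coeff f q = c" using c unfolding J_iff by blast
  define P where "P = f - smult c (falling q)"
  have "degree P \<le> q" unfolding P_def
    by (intro degree_diff_le f(2) order.trans[OF degree_smult_le]) (simp add: falling_props)
  moreover have "coeff P q = 0" unfolding P_def using f(3) by (simp add: falling_props)
  ultimately have "degree P \<noteq> q \<or> P = 0" by (metis leading_coeff_0_iff)
  with \<open>degree P \<le> q\<close> have dP: "degree P \<le> q'" unfolding q' by auto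
  have "poly P (of_nat i) \<in> OK" if "i \<le> q'" for i
  proof -
    have "poly (falling q) (of_nat i :: complex) = 0"
      unfolding falling_props(3) by (rule prod_zero) (use that q' in auto)
    then show ?thesis unfolding P_def using IV_D(2)[OF f(1) OK_closed(4)] by simp
  qed
  from fact_mult_poly_values[OF dP this OK_closed(5)]
  have mP: "of_nat (fact q') * poly P \<eta> \<in> OK" .
  have "of_nat (fact q') * poly f \<eta> - of_nat (fact q') * poly P \<eta> \<in> OK"
    by (rule OK_closed(8)[OF OK_closed(9)[OF OK_closed(4) IV_D(2)[OF f(1) OK_closed(5)]] mP])
  then have v: "of_nat (fact q') * c * poly (falling q) \<eta> \<in> OK"
    unfolding P_def by (simp add: algebra_simps)
  define G :: "int poly" where "G = (\<Prod>i<q'. [:- int (Suc i), 1:])"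
  obtain g H where gH: "G = pCons g H" by (rule pCons_cases)
  define r where "r = poly (map_poly of_int H) \<eta>"
  have r: "r \<in> OK" unfolding r_def by (rule OK_int_poly[OF OK_closed(5)])
  have fall: "poly (falling q) \<eta> = \<eta> * (of_int g + \<eta> * r)"
  proof -
    have "poly (falling q) \<eta> = \<eta> * (\<Prod>i<q'. \<eta> - of_nat (Suc i))"
      unfolding falling_props(3) q' prod.lessThan_Suc_shift by simp
    also have "(\<Prod>i<q'. \<eta> - of_nat (Suc i)) = poly (map_poly of_int G) \<eta>"
      unfolding G_def of_int_poly_hom.hom_prod poly_prod
      by (rule prod.cong) (simp_all add: of_int_hom.map_poly_pCons_hom)
    also have "\<dots> = of_int g + \<eta> * r" unfolding gH r_def by (simp add: of_int_hom.map_poly_pCons_hom)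
    finally show ?thesis .
  qed
  have g: "g = (- 1) ^ q' * int (fact q')"
  proof -
    have "g = poly G 0" unfolding gH by simp
    also have "\<dots> = (\<Prod>i<q'. - int (Suc i))" unfolding G_def poly_prod by simp
    also have "\<dots> = (- 1) ^ q' * int (fact q')"
    proof (induction q')
      case (Suc m)
      then show ?case by (simp add: algebra_simps)
    qed simp
    finally show ?thesis .
  qed
  have cop: "coprime (int (fact q')) (int q)" using coprime_fact_q unfolding q' by simp
  have copg: "coprime g (int q)" unfolding g using cop by simp
  obtain T where T: "T \<in> OK" "of_int g ^ n - (- \<eta> * r) ^ n = (of_int g - (- \<eta> * r)) * T"
    using difference_of_powers_divisible[OF OK_closed(3) OK_closed(9)[OF OK_closed(6)[OF OK_closed(5)] r], of g n]
    by blast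
  obtain t where t: "t \<in> OK" "\<eta> ^ n = of_nat q * t" using eta_power_divisible by blast
  define y where "y = of_nat (fact q') * c * \<eta>"
  have y1: "y * (of_int g + \<eta> * r) \<in> OK" using v unfolding fall y_def by (simp add: mult_ac)
  have pw: "(- \<eta> * r) ^ n = of_nat q * (t * (- r) ^ n)"
  proof -
    have "(- \<eta> * r) ^ n = \<eta> ^ n * (- r) ^ n" by (simp add: power_mult_distrib[symmetric])
    then show ?thesis unfolding t(2) by simp
  qed
  have tt: "t * (- r) ^ n * of_nat (fact q') * \<eta> \<in> OK"
    by (intro OK_closed(5,6,9,10) OK_closed(4)[of "fact q'"] t(1) r)
  have "of_int (g ^ n * int (fact q')) * (\<eta> * c) = of_int g ^ n * y" unfolding y_def by (simp add: mult_ac)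
  also have "of_int g ^ n = (of_int g + \<eta> * r) * T + of_nat q * (t * (- r) ^ n)"
    using T(2) unfolding pw by (simp add: algebra_simps)
  also have "\<dots> * y = T * (y * (of_int g + \<eta> * r))
      + (t * (- r) ^ n * of_nat (fact q') * \<eta>) * (of_nat q * c)"
    unfolding y_def by (simp add: algebra_simps)
  also have "\<dots> \<in> J q'"
    by (rule fractional_idealD(4)[OF J' subsetD[OF OK_subset_J OK_closed(9)[OF T(1) y1]] fractional_idealD(5)[OF J' tt qc]])
  finally have 1: "of_int (g ^ n * int (fact q')) * (\<eta> * c) \<in> J q'" .
  have 2: "of_int (int q) * (\<eta> * c) \<in> J q'"
    using fractional_idealD(5)[OF J' OK_closed(5) qc] by (simp add: mult.left_commute)
  have "\<eta> * c \<in> J q'"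
    by (rule fractional_ideal_bezout[OF J' _ 1 2]) (use cop copg in simp)
  then show ?thesis unfolding q' by simp
qed

text \<open>
  The generators \<open>q\<close> and \<open>\<eta>\<close> map \<open>J q\<close> into \<open>J (q - 1)\<close> by \<open>J_difference\<close> and \<open>eta_mult_J\<close>. Conversely,
  if \<open>p\<close> lies in the inverse of the ramified ideal, then \<open>p * X * (X - 1) * \<dots> * (X - q + 1)\<close> is
  integer-valued, so \<open>p\<close> lies in \<open>J q\<close>; passing from \<open>OK\<close> to \<open>J (q - 1)\<close> only involves the denominator
  \<open>(q - 1)!\<close>, which is prime to \<open>q\<close>.
\<close>

theorem ramified_ideal_mult_J: "ramified_ideal q \<star> J q = J (q - 1)"
proof
  let ?Q = "ramified_ideal q"
  obtain q' where q': "q = Suc q'" using q_pos by (cases q) auto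
  have Jq: "fractional_ideal K (J q)" and J': "fractional_ideal K (J (q - 1))" by (rule fractional_ideal_J)+
  show "?Q \<star> J q \<subseteq> J (q - 1)"
  proof
    fix x assume "x \<in> ?Q \<star> J q"
    then show "x \<in> J (q - 1)"
    proof (induction rule: ideal_mult_induct)
      case (mult i c)
      obtain a b where ab: "i = of_nat q * a + \<eta> * b" "a \<in> OK" "b \<in> OK"
        using mult(1) unfolding ramified_ideal_def by blast
      have "i * c = a * (of_nat q * c) + b * (\<eta> * c)" unfolding ab(1) by (simp add: algebra_simps)
      moreover have "of_nat q * c \<in> J (q - 1)" using J_difference[of c q'] mult(2) unfolding q' by simp
      ultimately show ?case
        using eta_mult_J[OF mult(2)] fractional_idealD(4,5)[OF J'] ab(2,3) by simp
    next
      case (add x y)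
      then show ?case by (rule fractional_idealD(4)[OF J'])
    qed
  qed
  obtain I where I: "fractional_ideal K I" "?Q \<star> I = OK"
    using fractional_ideal_invertible[OF fractional_ideal_QQ] by blast
  have IJ: "I \<subseteq> J q"
  proof
    fix p assume p: "p \<in> I"
    have "smult p (falling q) \<in> IV"
    proof -
      have "coeff (falling m) i \<in> K" for m i
      proof -
        have "falling m = (map_poly of_int (\<Prod>i<m. [:- int i, 1:]) :: complex poly)"
          unfolding falling_def of_int_poly_hom.hom_prod by (simp add: of_int_hom.map_poly_pCons_hom)
        then show ?thesis by (simp add: coeff_map_poly K_closed)
      qed
      moreover have "p * poly (falling q) x \<in> OK" if "x \<in> OK" for x
        using ideal_mult_intro[OF falling_value_in_ramified_ideal[OF that] p] I(2) by (simp add: mult.commute)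
      ultimately show ?thesis
        using fractional_idealD(1)[OF I(1) p] by (auto simp: int_valued_polys_def intro: K_closed)
    qed
    then show "p \<in> J q" unfolding J_iff
      by (intro bexI[of _ "smult p (falling q)"] conjI order.trans[OF degree_smult_le])
         (auto simp: falling_props)
  qed
  have "I \<star> J (q - 1) \<subseteq> J q"
  proof
    fix x assume "x \<in> I \<star> J (q - 1)"
    then show "x \<in> J q"
    proof (induction rule: ideal_mult_induct)
      case (mult p a)
      have "(of_nat (fact (q - 1)) * a) * p \<in> J q"
        using fact_mult_J[OF mult(2)] IJ mult(1) by (intro fractional_idealD(5)[OF Jq]) auto
      then have 1: "of_int (int (fact (q - 1))) * (p * a) \<in> J q" by (simp add: mult_ac)
      have "of_nat q * p \<in> OK" using ideal_mult_intro[OF ramified_ideal_closed(2)[of q] mult(1)] I(2) by simp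
      then have "(of_nat q * p) * a \<in> J (q - 1)" using mult(2) by (rule fractional_idealD(5)[OF J'])
      then have "(of_nat q * p) * a \<in> J q" using J_mono[of q'] unfolding q' by auto
      then have 2: "of_int (int q) * (p * a) \<in> J q" by (simp add: mult_ac)
      show ?case by (rule fractional_ideal_bezout[OF Jq coprime_fact_q 1 2])
    next
      case (add x y)
      then show ?case by (rule fractional_idealD(4)[OF Jq])
    qed
  qed
  then have "?Q \<star> (I \<star> J (q - 1)) \<subseteq> ?Q \<star> J q" by (rule ideal_mult_mono[OF order.refl])
  then show "J (q - 1) \<subseteq> ?Q \<star> J q"
    unfolding ideal_mult_assoc[symmetric] I(2) OK_mult[OF J'] .
qed

theorem ramified_class_in_polya_group: "cls (ramified_ideal q) \<in> carrier Po"
proof -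
  interpret Cl: comm_group Cl by (rule comm_group_Cl)
  define S where "S = {cls (J m) | m. m \<ge> 1}"
  have gen: "cls (J m) \<in> generate Cl (carrier Cl \<inter> S)" if "m \<ge> 1" for m
    using that cls_carrier[OF fractional_ideal_J] by (intro generate.incl) (auto simp: S_def)
  have q1: "q - 1 \<ge> 1" using prime_ge_2_nat[OF prime_q] by simp
  have "cls (ramified_ideal q) \<otimes>\<^bsub>Cl\<^esub> cls (J q) = cls (J (q - 1))"
    using cls_mult[OF fractional_ideal_QQ fractional_ideal_J, of q] unfolding ramified_ideal_mult_J by simp
  then have "cls (ramified_ideal q) = cls (J (q - 1)) \<otimes>\<^bsub>Cl\<^esub> inv\<^bsub>Cl\<^esub> (cls (J q))"
    using Cl.inv_solve_right[of "cls (ramified_ideal q)" "cls (J (q - 1))" "cls (J q)"]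
      cls_carrier[OF fractional_ideal_J] cls_carrier[OF fractional_ideal_QQ] by simp
  also have "\<dots> \<in> generate Cl (carrier Cl \<inter> S)"
  proof (rule generate.eng)
    show "inv\<^bsub>Cl\<^esub> cls (J q) \<in> generate Cl (carrier Cl \<inter> S)"
      using q_pos cls_carrier[OF fractional_ideal_J] by (intro generate.inv) (auto simp: S_def)
  qed (rule gen[OF q1])
  finally show ?thesis unfolding polya_group_def S_def carrier_subgroup_generated .
qed

end

end

section \<open>Multiplicative relations between units\<close>

context number_field_root
begin

lemma embed_prod:
  assumes "z \<in> Z" "\<And>i. i \<in> I \<Longrightarrow> f i \<in> K"
  shows "embed z (\<Prod>i\<in>I. f i) = (\<Prod>i\<in>I. embed z (f i))"
  using assms(2)
proof (induction I rule: infinite_finite_induct)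
  case (insert i I)
  then show ?case using embed_hom(2)[OF assms(1)] K_prod[of I f] by simp
qed (simp_all add: embed_1 assms(1))

lemma embed_power: "z \<in> Z \<Longrightarrow> x \<in> K \<Longrightarrow> embed z (x ^ k) = embed z x ^ k"
  by (induction k) (simp_all add: embed_1 embed_hom(2) K_closed)

lemma K_power_int: "x \<in> K \<Longrightarrow> x powi k \<in> K"
  unfolding power_int_def by (simp add: K_closed K_inverse)

text \<open>
  The upper bound in Dirichlet's unit theorem, in the form needed here. Among the \<open>(M + 1) ^ card I\<close>
  products of the units with exponents at most \<open>M\<close>, the logarithms of the conjugates fall into
  \<open>O(M ^ n)\<close> unit boxes. Two products in one box have a quotient from a finite set \<open>W\<close> that does not depend on
  \<open>M\<close>. For large \<open>M\<close> a box therefore contains two equal products with different exponents.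
\<close>

theorem unit_relation:
  fixes u :: "'i \<Rightarrow> complex"
  assumes fin: "finite I" and card: "card I > n"
    and u: "\<And>i. i \<in> I \<Longrightarrow> u i \<in> OK" "\<And>i. i \<in> I \<Longrightarrow> inverse (u i) \<in> OK" "\<And>i. i \<in> I \<Longrightarrow> u i \<noteq> 0"
  shows "\<exists>x :: 'i \<Rightarrow> int. (\<exists>i\<in>I. x i \<noteq> 0) \<and> (\<Prod>i\<in>I. u i powi x i) = 1"
proof -
  define L where "L = (\<lambda>z i. ln (cmod (embed z (u i))))"
  obtain C :: nat where C: "(\<Sum>z\<in>Z. \<Sum>i\<in>I. \<bar>L z i\<bar>) \<le> real C" using real_arch_simple by blast
  define W where "W = {w \<in> OK. \<forall>z\<in>Z. cmod (embed z w) \<le> exp 1}"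
  have finW: "finite W" unfolding W_def by (rule finite_bounded_integers)
  define N where "N = card W"
  \<comment> \<open>This \<open>M\<close> makes \<open>(M + 1) ^ (n + 1)\<close> exceed \<open>N\<close> times the number of boxes.\<close>
  define M where "M = N * (2 * C + 1) ^ n"
  define V where "V = I \<rightarrow>\<^sub>E {..M}"
  define U where "U = (\<lambda>x. \<Prod>i\<in>I. u i ^ x i)"
  define S where "S = (\<lambda>x z. \<Sum>i\<in>I. real (x i) * L z i)"
  define B where "B = (\<lambda>x. restrict (\<lambda>z. \<lfloor>S x z\<rfloor>) Z)"
  have finV: "finite V" unfolding V_def using fin by (intro finite_PiE) auto
  have cardV: "card V = (M + 1) ^ card I" unfolding V_def using fin by (simp add: card_PiE)
  have uK: "i \<in> I \<Longrightarrow> u i \<in> K" for i using u(1) OK_subset_K by blast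
  have UOK: "U x \<in> OK" "inverse (U x) \<in> OK" "U x \<noteq> 0" for x
  proof -
    show "U x \<in> OK" unfolding U_def by (intro OK_prod OK_closed(10) u(1))
    have "inverse (U x) = (\<Prod>i\<in>I. inverse (u i) ^ x i)"
      unfolding U_def by (simp add: prod_inversef[symmetric] power_inverse)
    then show "inverse (U x) \<in> OK" using OK_prod[of I "\<lambda>i. inverse (u i) ^ x i"] OK_closed(10) u(2) by simp
    show "U x \<noteq> 0" unfolding U_def using u(3) fin by simp
  qed
  have norm_embed: "cmod (embed z (U x)) = exp (S x z)" if z: "z \<in> Z" for z x
  proof -
    have "cmod (embed z (U x)) = (\<Prod>i\<in>I. cmod (embed z (u i)) ^ x i)"
      unfolding U_def by (subst embed_prod[OF z]) (use uK in \<open>auto intro: K_closed simp: embed_power z prod_norm[symmetric] norm_power\<close>)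
    also have "\<dots> = (\<Prod>i\<in>I. exp (real (x i) * L z i))"
    proof (rule prod.cong)
      fix i assume "i \<in> I"
      then have "cmod (embed z (u i)) > 0" using embed_nonzero[OF z uK u(3)] by simp
      then show "cmod (embed z (u i)) ^ x i = exp (real (x i) * L z i)"
        unfolding L_def by (simp add: exp_of_nat_mult)
    qed simp
    also have "\<dots> = exp (S x z)" unfolding S_def using fin by (simp add: exp_sum)
    finally show ?thesis .
  qed
  have "\<not> inj_on U V"
  proof
    assume inj: "inj_on U V"
    have fiber: "card {x \<in> V. B x = b} \<le> N" if b: "b \<in> B ` V" for b
    proof -
      obtain y where y: "y \<in> V" "B y = b" using b by blast
      have "card {x \<in> V. B x = b} = card ((\<lambda>x. U x * inverse (U y)) ` {x \<in> V. B x = b})"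
        by (rule card_image[symmetric], rule inj_onI) (use inj UOK(3)[of y] in \<open>auto dest: inj_onD\<close>)
      also have "\<dots> \<le> card W"
      proof (rule card_mono[OF finW], rule subsetI)
        fix w assume "w \<in> (\<lambda>x. U x * inverse (U y)) ` {x \<in> V. B x = b}"
        then obtain x where x: "w = U x * inverse (U y)" "B x = b" by blast
        have wOK: "w \<in> OK" unfolding x(1) by (intro OK_closed(9) UOK)
        moreover have "cmod (embed z w) \<le> exp 1" if z: "z \<in> Z" for z
        proof -
          have UK: "U x \<in> K" "U y \<in> K" "inverse (U y) \<in> K" using UOK OK_subset_K by blast+
          have "embed z w = embed z (U x) * inverse (embed z (U y))"
            unfolding x(1) embed_hom(2)[OF z UK(1,3)] embed_inverse[OF z UK(2) UOK(3)] ..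
          then have "cmod (embed z w) = exp (S x z - S y z)"
            using norm_embed[OF z] by (simp add: norm_mult norm_inverse exp_diff divide_inverse)
          moreover have "\<lfloor>S x z\<rfloor> = \<lfloor>S y z\<rfloor>"
            using x(2) y(2) z unfolding B_def by (metis restrict_apply')
          then have "S x z - S y z \<le> 1" by linarith
          ultimately show ?thesis by simp
        qed
        ultimately show "w \<in> W" unfolding W_def by blast
      qed
      finally show ?thesis unfolding N_def .
    qed
    have "B ` V \<subseteq> Z \<rightarrow>\<^sub>E {- int (C * M)..int (C * M)}"
    proof (rule image_subsetI)
      fix x assume x: "x \<in> V"
      have "\<lfloor>S x z\<rfloor> \<in> {- int (C * M)..int (C * M)}" if z: "z \<in> Z" for z
      proof -
        have "\<bar>S x z\<bar> \<le> (\<Sum>i\<in>I. \<bar>real (x i) * L z i\<bar>)" unfolding S_def by (rule sum_abs)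
        also have "\<dots> \<le> (\<Sum>i\<in>I. real M * \<bar>L z i\<bar>)"
          using x unfolding V_def by (intro sum_mono) (auto simp: abs_mult intro!: mult_right_mono)
        also have "\<dots> = real M * (\<Sum>i\<in>I. \<bar>L z i\<bar>)" by (simp add: sum_distrib_left)
        also have "\<dots> \<le> real M * (\<Sum>z\<in>Z. \<Sum>i\<in>I. \<bar>L z i\<bar>)"
          using z finite_Z by (intro mult_left_mono member_le_sum) (auto intro: sum_nonneg)
        also have "\<dots> \<le> real M * real C" using C by (intro mult_left_mono) auto
        finally have b: "\<bar>S x z\<bar> \<le> real (C * M)" by (simp add: mult.commute)
        then have "real_of_int (- int (C * M)) \<le> S x z" "S x z \<le> real_of_int (int (C * M))"
          by (simp_all add: abs_le_iff)
        then have "- int (C * M) \<le> \<lfloor>S x z\<rfloor>" "\<lfloor>S x z\<rfloor> \<le> int (C * M)"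
          by (simp_all only: le_floor_iff floor_le_iff)
        then show ?thesis by simp
      qed
      then show "B x \<in> Z \<rightarrow>\<^sub>E {- int (C * M)..int (C * M)}" unfolding B_def by auto
    qed
    then have "card (B ` V) \<le> card (Z \<rightarrow>\<^sub>E {- int (C * M)..int (C * M)})"
      by (rule card_mono[rotated]) (use finite_Z in \<open>auto intro: finite_PiE\<close>)
    also have "\<dots> = (2 * (C * M) + 1) ^ n"
    proof -
      have "card {- int k..int k} = 2 * k + 1" for k
        by (simp only: card_atLeastAtMost_int)
      then show ?thesis unfolding card_PiE[OF finite_Z] by (simp only: prod_constant card_Z)
    qed
    finally have cB: "card (B ` V) \<le> (2 * (C * M) + 1) ^ n" .
    have "V = (\<Union>b\<in>B ` V. {x \<in> V. B x = b})" by auto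
    then have "card V \<le> (\<Sum>b\<in>B ` V. card {x \<in> V. B x = b})"
      using card_UN_le[of "B ` V" "\<lambda>b. {x \<in> V. B x = b}"] finV by simp
    also have "\<dots> \<le> (\<Sum>b\<in>B ` V. N)" using fiber by (rule sum_mono)
    also have "\<dots> \<le> (2 * (C * M) + 1) ^ n * N" using cB by simp
    also have "\<dots> \<le> ((2 * C + 1) * (M + 1)) ^ n * N"
      by (intro mult_right_mono power_mono) auto
    also have "\<dots> = M * (M + 1) ^ n" unfolding power_mult_distrib by (simp only: M_def mult_ac)
    also have "\<dots> < (M + 1) ^ Suc n" by simp
    also have "\<dots> \<le> (M + 1) ^ card I" using card by (intro power_increasing) auto
    finally show False unfolding cardV by simp
  qed
  then obtain x y where xy: "x \<in> V" "y \<in> V" "x \<noteq> y" "U x = U y" unfolding inj_on_def by blast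
  define d where "d = (\<lambda>i. int (x i) - int (y i))"
  have "\<exists>i\<in>I. d i \<noteq> 0"
  proof (rule ccontr)
    assume "\<not> ?thesis"
    then have "x = y" using xy(1,2) unfolding V_def d_def by (intro PiE_ext[of x I _ y]) auto
    then show False using xy(3) by simp
  qed
  moreover have "(\<Prod>i\<in>I. u i powi d i) = 1"
  proof -
    have "(\<Prod>i\<in>I. u i powi d i) = (\<Prod>i\<in>I. u i ^ x i / u i ^ y i)"
      unfolding d_def using u(3) by (intro prod.cong) (auto simp: power_int_diff)
    also have "\<dots> = U x / U y" unfolding U_def by (simp add: prod_dividef)
    finally show ?thesis using xy(4) UOK(3)[of y] by simp
  qed
  ultimately show ?thesis by blast
qed

lemma odd_root_of_unity_trivial:
  assumes "Z \<subseteq> \<real>" "odd p" "w \<in> K" "w ^ p = 1"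
  shows "w = 1"
proof -
  have "w \<in> \<rat>" using odd_root_of_rational[OF assms(1-3), of 1] assms(4) by simp
  then obtain r where r: "w = of_rat r" by (auto elim: Rats_cases)
  then have "(of_rat (r ^ p) :: complex) = of_rat 1" using assms(4) by (simp add: of_rat_power)
  then have "r ^ p = 1" by (simp only: of_rat_eq_iff)
  then have "(real_of_rat r) ^ p = 1 ^ p" by (metis of_rat_1 of_rat_power power_one)
  then have "real_of_rat r = 1" using assms(2) by (metis odd_real_root_power_cancel)
  then have "r = 1" by simp
  then show ?thesis using r by simp
qed

text \<open>
  Write \<open>\<alpha> i ^ p = Q i * u i\<close> with units \<open>u i\<close>, and take a relation between the \<open>u i\<close> with exponents of
  minimal size. They are not all divisible by \<open>p\<close>, since otherwise the relation could be divided by \<open>p\<close>, as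
  \<open>K\<close> has no nontrivial \<open>p\<close>-th roots of unity. Then \<open>\<beta> = \<Prod> \<alpha> i powi x i\<close> has the rational \<open>p\<close>-th power
  \<open>\<Prod> Q i powi x i\<close>, so \<open>\<beta>\<close> is rational. Reducing the exponents modulo \<open>p\<close> changes both sides by \<open>p\<close>-th
  powers.
\<close>

theorem radical_relation:
  fixes \<alpha> :: "'i \<Rightarrow> complex" and Q :: "'i \<Rightarrow> nat"
  assumes real: "Z \<subseteq> \<real>" and p: "odd p" "p > 1" and fin: "finite I" and card: "card I > n"
    and a: "\<And>i. i \<in> I \<Longrightarrow> \<alpha> i \<in> K" "\<And>i. i \<in> I \<Longrightarrow> \<alpha> i \<noteq> 0"
    and Q: "\<And>i. i \<in> I \<Longrightarrow> Q i > 0"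
    and assoc: "\<And>i. i \<in> I \<Longrightarrow> principal (\<alpha> i ^ p) = principal (of_nat (Q i))"
  shows "\<exists>x :: 'i \<Rightarrow> nat. (\<forall>i\<in>I. x i < p) \<and> (\<exists>i\<in>I. x i \<noteq> 0) \<and> (\<exists>b. (\<Prod>i\<in>I. Q i ^ x i) = b ^ p)"
proof -
  define u where "u = (\<lambda>i. \<alpha> i ^ p / of_nat (Q i))"
  have u: "u i \<in> OK" "inverse (u i) \<in> OK" "u i \<noteq> 0" if "i \<in> I" for i
    using principal_eq_imp_unit[OF assoc[OF that]] a(2)[OF that] Q[OF that] unfolding u_def by simp_all
  have au: "\<alpha> i ^ p = of_nat (Q i) * u i" if "i \<in> I" for i
    using Q[OF that] unfolding u_def by simp
  define rel where "rel = (\<lambda>x :: 'i \<Rightarrow> int. (\<exists>i\<in>I. x i \<noteq> 0) \<and> (\<Prod>i\<in>I. u i powi x i) = 1)"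
  have "\<exists>x. rel x" unfolding rel_def by (rule unit_relation[OF fin card u])
  then obtain x where x: "rel x" "\<And>y. rel y \<Longrightarrow> (\<Sum>i\<in>I. nat \<bar>x i\<bar>) \<le> (\<Sum>i\<in>I. nat \<bar>y i\<bar>)"
    using ex_has_least_nat[of rel _ "\<lambda>x. \<Sum>i\<in>I. nat \<bar>x i\<bar>"] by blast
  have "\<exists>i\<in>I. \<not> int p dvd x i"
  proof (rule ccontr)
    assume "\<not> ?thesis"
    then have dvd: "int p dvd x i" if "i \<in> I" for i using that by blast
    define y where "y = (\<lambda>i. x i div int p)"
    have xy: "x i = y i * int p" if "i \<in> I" for i using dvd[OF that] unfolding y_def by simp
    define w where "w = (\<Prod>i\<in>I. u i powi y i)"
    have "w ^ p = (\<Prod>i\<in>I. u i powi x i)"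
      unfolding w_def prod_power_distrib
      by (rule prod.cong) (auto simp: xy power_int_mult)
    then have "w ^ p = 1" using x(1) unfolding rel_def by simp
    moreover have "w \<in> K" unfolding w_def using u(1) OK_subset_K by (intro K_prod K_power_int) blast
    ultimately have "w = 1" using odd_root_of_unity_trivial[OF real p(1)] by blast
    moreover have nz: "\<exists>i\<in>I. y i \<noteq> 0" using x(1) xy unfolding rel_def by (metis mult_zero_left)
    ultimately have "rel y" unfolding rel_def w_def by simp
    moreover have "(\<Sum>i\<in>I. nat \<bar>y i\<bar>) < (\<Sum>i\<in>I. nat \<bar>x i\<bar>)"
    proof (rule sum_strict_mono_ex1[OF fin])
      have "nat \<bar>x i\<bar> = nat \<bar>y i\<bar> * p" if "i \<in> I" for i
        using xy[OF that] by (simp add: abs_mult nat_mult_distrib)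
      then show "\<forall>i\<in>I. nat \<bar>y i\<bar> \<le> nat \<bar>x i\<bar>" "\<exists>i\<in>I. nat \<bar>y i\<bar> < nat \<bar>x i\<bar>"
        using p(2) nz by auto
    qed
    ultimately show False using x(2) by fastforce
  qed
  then obtain j where j: "j \<in> I" "\<not> int p dvd x j" by blast
  define \<beta> where "\<beta> = (\<Prod>i\<in>I. \<alpha> i powi x i)"
  have bK: "\<beta> \<in> K" unfolding \<beta>_def using a(1) by (intro K_prod K_power_int) blast
  have bp: "\<beta> ^ p = (\<Prod>i\<in>I. of_nat (Q i) powi x i)"
  proof -
    have "\<beta> ^ p = (\<Prod>i\<in>I. (\<alpha> i ^ p) powi x i)"
      unfolding \<beta>_def prod_power_distrib by (simp add: power_int_power power_int_power' mult.commute)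
    also have "\<dots> = (\<Prod>i\<in>I. of_nat (Q i) powi x i * u i powi x i)"
      by (rule prod.cong) (simp_all add: au power_int_mult_distrib)
    also have "\<dots> = (\<Prod>i\<in>I. of_nat (Q i) powi x i)"
      using x(1) unfolding rel_def prod.distrib by simp
    finally show ?thesis .
  qed
  define y where "y = (\<lambda>i. x i div int p)"
  define r where "r = (\<lambda>i. nat (x i mod int p))"
  have r: "int (r i) = x i mod int p" for i unfolding r_def using p(2) by simp
  have xr: "x i = int (r i) + y i * int p" for i unfolding r y_def by simp
  define q where "q = (\<Prod>i\<in>I. of_nat (Q i) powi y i :: complex)"
  have q: "q \<in> K" "q \<noteq> 0" unfolding q_def using Q fin by (auto intro!: K_prod K_power_int K_closed)
  have "\<beta> ^ p = of_nat (\<Prod>i\<in>I. Q i ^ r i) * q ^ p"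
  proof -
    have "\<beta> ^ p = (\<Prod>i\<in>I. of_nat (Q i) ^ r i * (of_nat (Q i) powi y i) ^ p)"
      unfolding bp
    proof (rule prod.cong)
      fix i assume "i \<in> I"
      then have nz: "(of_nat (Q i) :: complex) \<noteq> 0" using Q by auto
      have "(of_nat (Q i) :: complex) powi x i = of_nat (Q i) powi (int (r i) + y i * int p)" using xr by simp
      also have "\<dots> = of_nat (Q i) ^ r i * (of_nat (Q i) powi y i) ^ p"
        using nz by (simp add: power_int_add power_int_mult)
      finally show "(of_nat (Q i) :: complex) powi x i = of_nat (Q i) ^ r i * (of_nat (Q i) powi y i) ^ p" .
    qed simp
    then show ?thesis unfolding q_def prod.distrib prod_power_distrib by simp
  qed
  moreover define m where "m = (\<Prod>i\<in>I. Q i ^ r i)"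
  ultimately have gp: "(\<beta> / q) ^ p = of_nat m" using q(2) by (simp add: power_divide)
  have "\<beta> / q \<in> \<rat>"
    using odd_root_of_rational[OF real p(1) K_divide[OF bK q(1)], of "of_nat m"] gp by simp
  moreover have "algebraic_int (\<beta> / q)"
  proof (rule algebraic_int_root)
    show "algebraic_int (of_nat m :: complex)" by simp
    show "poly (monom 1 p) (\<beta> / q) = of_nat m" unfolding poly_monom gp by simp
    show "lead_coeff (monom (1::complex) p) = 1" "degree (monom (1::complex) p) > 0"
      using p(2) by (simp_all add: degree_monom_eq)
  qed simp
  ultimately obtain c where c: "\<beta> / q = of_int c" using rational_algebraic_int_is_int by (auto elim: Ints_cases)
  have "(of_int (c ^ p) :: complex) = of_int (int m)" using gp unfolding c by simp
  then have "c ^ p = int m" by (simp only: of_int_eq_iff)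
  then have "nat \<bar>c\<bar> ^ p = m" by (metis abs_of_nat nat_int nat_power_eq abs_ge_zero power_abs)
  moreover have "\<forall>i\<in>I. r i < p" using p(2) unfolding r_def by (simp add: nat_less_iff)
  moreover have "r j \<noteq> 0" using j(2) r[of j] by (metis dvd_eq_mod_eq_0 of_nat_0)
  ultimately show ?thesis using j(1) unfolding m_def by metis
qed

end

section \<open>Elementary abelian subgroups\<close>

text \<open>
  For elements whose \<open>p\<close>-th powers are trivial, this is linear independence over the field with \<open>p\<close>
  elements.
\<close>

definition pow_independent :: "('a, 'b) monoid_scheme \<Rightarrow> nat \<Rightarrow> ('i \<Rightarrow> 'a) \<Rightarrow> 'i set \<Rightarrow> bool" where
  "pow_independent G p x T \<longleftrightarrow>
     (\<forall>a :: 'i \<Rightarrow> nat. (\<forall>t\<in>T. a t < p) \<longrightarrow> finprod G (\<lambda>t. x t [^]\<^bsub>G\<^esub> a t) T = \<one>\<^bsub>G\<^esub> \<longrightarrow> (\<forall>t\<in>T. a t = 0))"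

context comm_group
begin

lemma pow_independent_subset:
  assumes "pow_independent G p x T" "U \<subseteq> T" "finite T" "\<And>t. t \<in> T \<Longrightarrow> x t \<in> carrier G" "p > 0"
  shows "pow_independent G p x U"
  unfolding pow_independent_def
proof (intro allI impI)
  fix a :: "'c \<Rightarrow> nat" assume a: "\<forall>t\<in>U. a t < p" "finprod G (\<lambda>t. x t [^] a t) U = \<one>"
  define b where "b = (\<lambda>t. if t \<in> U then a t else 0)"
  have "finprod G (\<lambda>t. x t [^] b t) T = finprod G (\<lambda>t. x t [^] a t) U"
    by (rule finprod_mono_neutral_cong_right) (use assms in \<open>auto simp: b_def\<close>)
  then have "finprod G (\<lambda>t. x t [^] b t) T = \<one>" using a(2) by simp
  moreover have "\<forall>t\<in>T. b t < p" using a(1) assms(5) unfolding b_def by auto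
  ultimately have "\<forall>t\<in>T. b t = 0" using assms(1) unfolding pow_independent_def by blast
  then show "\<forall>t\<in>U. a t = 0" using assms(2) unfolding b_def by (metis subsetD)
qed

lemma maximal_pow_independent:
  assumes fin: "finite I" and x: "\<And>i. i \<in> I \<Longrightarrow> x i \<in> carrier G"
  shows "\<exists>T\<subseteq>I. pow_independent G p x T \<and>
    (\<forall>j\<in>I - T. \<exists>a. (\<forall>t\<in>insert j T. a t < p) \<and> a j \<noteq> 0 \<and>
       finprod G (\<lambda>t. x t [^] a t) (insert j T) = \<one>)"
proof -
  define A where "A = {T. T \<subseteq> I \<and> pow_independent G p x T}"
  have "finite A" unfolding A_def using fin by simp
  moreover have "{} \<in> A" unfolding A_def pow_independent_def by simp
  ultimately obtain T where T: "T \<in> A" "\<And>U. U \<in> A \<Longrightarrow> T \<subseteq> U \<Longrightarrow> T = U"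
    using finite_has_maximal[of A] by (metis empty_iff)
  have TI: "T \<subseteq> I" and ind: "pow_independent G p x T" using T(1) unfolding A_def by auto
  have "\<exists>a. (\<forall>t\<in>insert j T. a t < p) \<and> a j \<noteq> 0 \<and> finprod G (\<lambda>t. x t [^] a t) (insert j T) = \<one>"
    if j: "j \<in> I - T" for j
  proof -
    have "insert j T \<notin> A" using T(2)[of "insert j T"] j by auto
    then have "\<not> pow_independent G p x (insert j T)" using j TI unfolding A_def by auto
    then obtain a where a: "\<forall>t\<in>insert j T. a t < p" "finprod G (\<lambda>t. x t [^] a t) (insert j T) = \<one>"
      "\<not> (\<forall>t\<in>insert j T. a t = 0)"
      unfolding pow_independent_def not_all not_imp by (elim exE conjE) (rule that)
    have "a j \<noteq> 0"
    proof
      assume 0: "a j = 0"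
      have xT: "(\<lambda>t. x t [^] a t) \<in> T \<rightarrow> carrier G" using x TI by auto
      have "finprod G (\<lambda>t. x t [^] a t) (insert j T) = finprod G (\<lambda>t. x t [^] a t) T"
        using finprod_insert[of T j "\<lambda>t. x t [^] a t"] finite_subset[OF TI fin] j xT x 0 by simp
      then have "finprod G (\<lambda>t. x t [^] a t) T = \<one>" using a(2) by simp
      moreover have "\<forall>t\<in>T. a t < p" using a(1) by blast
      ultimately have "\<forall>t\<in>T. a t = 0" using ind unfolding pow_independent_def by blast
      then show False using a(3) 0 by blast
    qed
    then show ?thesis using a by blast
  qed
  then show ?thesis using TI ind by (intro exI[of _ T] conjI ballI) simp_all
qed

lemma int_pow_mod:
  assumes "y \<in> carrier G" "y [^] p = \<one>" "p > 0"
  shows "y [^] (nat (z mod int p)) = y [^] (z :: int)"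
proof -
  have "y [^] z = y [^] (z mod int p + int p * (z div int p))" by simp
  also have "\<dots> = y [^] (z mod int p) \<otimes> y [^] (int p * (z div int p))"
    using assms(1) by (rule int_pow_mult)
  also have "y [^] (int p * (z div int p)) = (y [^] int p) [^] (z div int p)"
    using assms(1) by (simp add: int_pow_pow)
  also have "\<dots> = \<one>" using assms(2) by (simp add: int_pow_int)
  also have "y [^] (z mod int p) \<otimes> \<one> = y [^] (nat (z mod int p))"
    using assms(1,3) by (simp add: int_pow_int[symmetric])
  finally show ?thesis by simp
qed

theorem has_subgroup_elementary_abelian:
  assumes fin: "finite T" and card: "card T = k" and p: "p > 0"
    and x: "\<And>t. t \<in> T \<Longrightarrow> x t \<in> carrier G" "\<And>t. t \<in> T \<Longrightarrow> x t [^] p = \<one>"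
    and ind: "pow_independent G p x T"
  shows "has_subgroup_isomorphic_to G (product_group {..<k} (\<lambda>_. integer_mod_group p))"
proof -
  let ?P = "product_group {..<k} (\<lambda>_. integer_mod_group p)"
  obtain g where g: "bij_betw g T {..<k}"
    using ex_bij_betw_finite_nat[OF fin] card by (auto simp: atLeast0LessThan)
  have gk: "g t < k" if "t \<in> T" for t using g that by (auto simp: bij_betw_def)
  define \<phi> where "\<phi> = (\<lambda>a :: nat \<Rightarrow> int. finprod G (\<lambda>t. x t [^] nat (a (g t))) T)"
  have groupP: "group ?P" by (rule product_group) simp
  have carr: "carrier (integer_mod_group p) = {0..<int p}" using p by (simp add: carrier_integer_mod_group)
  have hom: "\<phi> \<in> hom ?P G"
  proof (rule homI)
    fix a show "\<phi> a \<in> carrier G" unfolding \<phi>_def using x(1) by (intro finprod_closed) auto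
  next
    fix a b assume a: "a \<in> carrier ?P" and b: "b \<in> carrier ?P"
    have ab: "a (g t) \<ge> 0" "b (g t) \<ge> 0" if "t \<in> T" for t
      using a b gk[OF that] unfolding carrier_product_group carr by (auto simp: PiE_iff)
    have "\<phi> (a \<otimes>\<^bsub>?P\<^esub> b) = finprod G (\<lambda>t. x t [^] nat (a (g t)) \<otimes> x t [^] nat (b (g t))) T"
      unfolding \<phi>_def
    proof (rule finprod_cong')
      fix t assume t: "t \<in> T"
      have "x t [^] nat ((a \<otimes>\<^bsub>?P\<^esub> b) (g t)) = x t [^] nat ((a (g t) + b (g t)) mod int p)"
        using gk[OF t] by simp
      also have "\<dots> = x t [^] (a (g t) + b (g t))" by (rule int_pow_mod[OF x(1)[OF t] x(2)[OF t] p])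
      also have "\<dots> = x t [^] (int (nat (a (g t)) + nat (b (g t))))" using ab[OF t] by simp
      also have "\<dots> = x t [^] (nat (a (g t)) + nat (b (g t)))" by (rule int_pow_int)
      also have "\<dots> = x t [^] nat (a (g t)) \<otimes> x t [^] nat (b (g t))"
        using x(1)[OF t] by (simp add: nat_pow_mult)
      finally show "x t [^] nat ((a \<otimes>\<^bsub>?P\<^esub> b) (g t)) = x t [^] nat (a (g t)) \<otimes> x t [^] nat (b (g t))" .
    qed (use x(1) in auto)
    also have "\<dots> = \<phi> a \<otimes> \<phi> b" unfolding \<phi>_def using x(1) by (intro finprod_multf) auto
    finally show "\<phi> (a \<otimes>\<^bsub>?P\<^esub> b) = \<phi> a \<otimes> \<phi> b" .
  qed
  interpret gh: group_hom ?P G \<phi>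
    by (intro group_hom.intro group_hom_axioms.intro groupP hom is_group)
  have "inj_on \<phi> (carrier ?P)"
  proof (subst gh.inj_iff_trivial_ker, rule equalityI, rule subsetI)
    fix a assume "a \<in> kernel ?P G \<phi>"
    then have a: "a \<in> carrier ?P" "\<phi> a = \<one>" by (auto simp: kernel_def)
    have aPi: "a \<in> {..<k} \<rightarrow>\<^sub>E {0..<int p}" using a(1) by (simp add: carr)
    have ar: "a i \<in> {0..<int p}" if "i < k" for i by (rule PiE_mem[OF aPi]) (use that in simp)
    then have "\<forall>t\<in>T. nat (a (g t)) < p" using gk by (simp add: nat_less_iff)
    then have "\<forall>t\<in>T. nat (a (g t)) = 0"
      using spec[OF ind[unfolded pow_independent_def], of "\<lambda>t. nat (a (g t))"] a(2)
      unfolding \<phi>_def by simp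
    then have "a (g t) = 0" if "t \<in> T" for t using ar[OF gk[OF that]] that by auto
    then have a0: "a i = 0" if "i < k" for i using g that unfolding bij_betw_def by (metis imageE lessThan_iff)
    have "a = \<one>\<^bsub>?P\<^esub>"
    proof (rule PiE_ext)
      show "a \<in> {..<k} \<rightarrow>\<^sub>E carrier (integer_mod_group p)" using a(1) by simp
      show "\<one>\<^bsub>?P\<^esub> \<in> {..<k} \<rightarrow>\<^sub>E carrier (integer_mod_group p)" by simp
      show "a i = \<one>\<^bsub>?P\<^esub> i" if "i \<in> {..<k}" for i using that a0 by simp
    qed
    then show "a \<in> {\<one>\<^bsub>?P\<^esub>}" by simp
  next
    show "{\<one>\<^bsub>?P\<^esub>} \<subseteq> kernel ?P G \<phi>"
      using gh.hom_one group.is_monoid[OF groupP] monoid.one_closed unfolding kernel_def by fastforce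
  qed
  moreover define H where "H = \<phi> ` carrier ?P"
  ultimately have "\<phi> \<in> iso ?P (G\<lparr>carrier := H\<rparr>)"
    using hom unfolding iso_def bij_betw_def hom_def H_def by auto
  then have "?P \<cong> G\<lparr>carrier := H\<rparr>" unfolding is_iso_def by blast
  then have "G\<lparr>carrier := H\<rparr> \<cong> ?P" by (rule group.iso_sym[OF groupP])
  moreover have "subgroup H G" unfolding H_def by (rule gh.img_is_subgroup)
  ultimately show ?thesis unfolding has_subgroup_isomorphic_to_def by blast
qed

end

context number_field_root
begin

lemma principal_pow: "a \<in> K \<Longrightarrow> a \<noteq> 0 \<Longrightarrow> ideal_pow (principal a) m = principal (a ^ m)"
  by (induction m) (simp_all add: principal_1 principal_mult_principal mult.commute)

lemma cls_pow: "fractional_ideal K I \<Longrightarrow> cls (ideal_pow I m) = cls I [^]\<^bsub>Po\<^esub> m"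
proof (induction m)
  case 0
  then show ?case by (simp add: cls_OK nat_pow_def)
next
  case (Suc m)
  have "cls I [^]\<^bsub>Po\<^esub> Suc m = cls I [^]\<^bsub>Po\<^esub> m \<otimes>\<^bsub>Cl\<^esub> cls I" by (simp add: nat_pow_def)
  moreover have "cls (ideal_pow I (Suc m)) = cls (ideal_pow I m) \<otimes>\<^bsub>Cl\<^esub> cls I"
    unfolding ideal_pow_simps by (rule cls_mult[OF fractional_ideal_pow[OF Suc.prems] Suc.prems])
  ultimately show ?case using Suc by simp
qed

lemma cls_finprod:
  assumes "finite T" "\<And>q. q \<in> T \<Longrightarrow> fractional_ideal K (I q)" "\<And>q. q \<in> T \<Longrightarrow> cls (I q) \<in> carrier Po"
  shows "finprod Po (\<lambda>q. cls (I q)) T = cls (finprod FI I T)" "fractional_ideal K (finprod FI I T)"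
proof -
  interpret Po: comm_group Po by (rule comm_group_Po)
  interpret FI: comm_group FI by (rule comm_group_FI)
  have "finprod Po (\<lambda>q. cls (I q)) T = cls (finprod FI I T) \<and> fractional_ideal K (finprod FI I T)"
    using assms
  proof (induction T rule: finite_induct)
    case empty
    show ?case by (simp add: cls_OK fractional_ideal_OK)
  next
    case (insert q T)
    have "finprod FI I (insert q T) = I q \<star> finprod FI I T"
      using FI.finprod_insert[OF insert(1,2), of I] insert.prems by auto
    moreover have "finprod Po (\<lambda>q. cls (I q)) (insert q T) = cls (I q) \<otimes>\<^bsub>Cl\<^esub> finprod Po (\<lambda>q. cls (I q)) T"
      using Po.finprod_insert[OF insert(1,2), of "\<lambda>q. cls (I q)"] insert.prems by auto
    ultimately show ?case using insert by (simp add: cls_mult fractional_ideal_mult)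
  qed
  then show "finprod Po (\<lambda>q. cls (I q)) T = cls (finprod FI I T)" "fractional_ideal K (finprod FI I T)" by auto
qed

text \<open>
  The \<open>n\<close>-th power of a product of ramified primes is generated by a rational integer, which forgets the
  class and keeps the exponents.
\<close>

lemma ramified_product_power:
  assumes "finite T" "\<And>q. q \<in> T \<Longrightarrow> eisenstein_at F q"
  shows "ideal_pow (finprod FI (\<lambda>q. ideal_pow (ramified_ideal q) (a q)) T) n
    = principal (of_nat (\<Prod>q\<in>T. q ^ a q))"
  using assms
proof (induction T rule: finite_induct)
  case empty
  interpret FI: comm_group FI by (rule comm_group_FI)
  show ?case using FI.nat_pow_one[of n] by (simp add: principal_1)
next
  case (insert q T)
  interpret FI: comm_group FI by (rule comm_group_FI)
  have QQ: "ramified_ideal r \<in> carrier FI" if "r \<in> insert q T" for r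
    using fractional_ideal_QQ insert.prems that by simp
  then have pows: "(\<lambda>q. ideal_pow (ramified_ideal q) (a q)) \<in> T \<rightarrow> carrier FI" by (auto intro: fractional_ideal_pow)
  have q0: "r > 0" if "r \<in> insert q T" for r
    using insert.prems[OF that] unfolding eisenstein_at_def by (simp add: prime_gt_0_nat)
  have "finprod FI (\<lambda>q. ideal_pow (ramified_ideal q) (a q)) (insert q T)
      = ideal_pow (ramified_ideal q) (a q) \<otimes>\<^bsub>FI\<^esub> finprod FI (\<lambda>q. ideal_pow (ramified_ideal q) (a q)) T"
    using FI.finprod_insert[OF insert(1,2) pows] QQ by (simp add: fractional_ideal_pow)
  then have "ideal_pow (finprod FI (\<lambda>q. ideal_pow (ramified_ideal q) (a q)) (insert q T)) n
      = ideal_pow (ideal_pow (ramified_ideal q) (a q)) n \<star> principal (of_nat (\<Prod>q\<in>T. q ^ a q))"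
    using FI.nat_pow_distrib[of "ideal_pow (ramified_ideal q) (a q)" "finprod FI (\<lambda>q. ideal_pow (ramified_ideal q) (a q)) T" n]
      FI.finprod_closed[OF pows] QQ[of q] insert by (simp add: fractional_ideal_pow)
  also have "ideal_pow (ideal_pow (ramified_ideal q) (a q)) n = ideal_pow (ideal_pow (ramified_ideal q) n) (a q)"
    using QQ[of q] by (simp add: FI.nat_pow_pow mult.commute)
  also have "\<dots> = principal (of_nat (q ^ a q))"
    using ramified_ideal_power[of q] insert.prems q0[of q] by (simp add: principal_pow K_closed)
  also have "\<dots> \<star> principal (of_nat (\<Prod>q\<in>T. q ^ a q)) = principal (of_nat (q ^ a q) * of_nat (\<Prod>q\<in>T. q ^ a q))"
  proof (rule principal_mult_principal)
    have "(\<Prod>q\<in>T. q ^ a q) \<noteq> 0" using insert(1) q0 by auto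
    then show "(of_nat (\<Prod>q\<in>T. q ^ a q) :: complex) \<noteq> 0" unfolding of_nat_eq_0_iff .
  qed (rule K_closed)
  also have "of_nat (q ^ a q) * of_nat (\<Prod>q\<in>T. q ^ a q) = (of_nat (\<Prod>q\<in>insert q T. q ^ a q) :: complex)"
    using insert(1,2) by simp
  finally show ?case .
qed

text \<open>
  Let \<open>T\<close> be a maximal independent set among the classes of the ramified primes. Each prime \<open>j\<close> outside
  \<open>T\<close> gives a principal ideal generated by some \<open>\<alpha> j\<close>, a product of powers of \<open>j\<close> and of elements of \<open>T\<close>
  in which the exponent of \<open>j\<close> is nonzero modulo \<open>n\<close>. If more than \<open>n\<close> primes were outside \<open>T\<close>,
  \<open>radical_relation\<close> would make a product of these ideals the \<open>n\<close>-th power of an integer, although some \<open>j\<close>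
  occurs in it with an exponent prime to \<open>n\<close>.
\<close>

theorem polya_group_large:
  assumes real: "Z \<subseteq> \<real>" and n: "prime n" "odd n"
    and S: "finite S" "\<And>q. q \<in> S \<Longrightarrow> eisenstein_at F q" "card S \<ge> k + n"
  shows "has_subgroup_isomorphic_to Po (product_group {..<k} (\<lambda>_. integer_mod_group n))"
proof -
  interpret Po: comm_group Po by (rule comm_group_Po)
  define x where "x = (\<lambda>q. cls (ramified_ideal q))"
  have frac: "fractional_ideal K (ramified_ideal q)" if "q \<in> S" for q
    using fractional_ideal_QQ[OF S(2)[OF that]] .
  have qprime: "prime q" if "q \<in> S" for q using S(2)[OF that] unfolding eisenstein_at_def by simp
  have xPo: "x q \<in> carrier Po" if "q \<in> S" for q
    unfolding x_def by (rule ramified_class_in_polya_group[OF S(2)[OF that]])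
  have xn: "x q [^]\<^bsub>Po\<^esub> n = \<one>\<^bsub>Po\<^esub>" if "q \<in> S" for q
  proof -
    have "x q [^]\<^bsub>Po\<^esub> n = cls (principal (of_nat q))"
      unfolding x_def cls_pow[OF frac[OF that], symmetric] ramified_ideal_power[OF S(2)[OF that]] ..
    then show ?thesis using qprime[OF that] by (simp add: cls_principal K_closed)
  qed
  obtain T where T': "T \<subseteq> S \<and> pow_independent Po n x T \<and>
    (\<forall>j\<in>S - T. \<exists>a. (\<forall>t\<in>insert j T. a t < n) \<and> a j \<noteq> 0 \<and>
       finprod Po (\<lambda>t. x t [^]\<^bsub>Po\<^esub> a t) (insert j T) = \<one>\<^bsub>Po\<^esub>)"
    using Po.maximal_pow_independent[of S x n, OF S(1) xPo] by (rule exE)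
  note T = conjunct1[OF T'] conjunct1[OF conjunct2[OF T']] bspec[OF conjunct2[OF conjunct2[OF T']]]
  have finT: "finite T" using T(1) S(1) by (rule finite_subset)
  have "card (S - T) \<le> n"
  proof (rule ccontr)
    assume big: "\<not> card (S - T) \<le> n"
    obtain a where a: "\<And>j. j \<in> S - T \<Longrightarrow> \<forall>t\<in>insert j T. a j t < n" "\<And>j. j \<in> S - T \<Longrightarrow> a j j \<noteq> 0"
      "\<And>j. j \<in> S - T \<Longrightarrow> finprod Po (\<lambda>t. x t [^]\<^bsub>Po\<^esub> a j t) (insert j T) = \<one>\<^bsub>Po\<^esub>"
      using T(3) by metis
    define Q where "Q = (\<lambda>j. \<Prod>t\<in>insert j T. t ^ a j t)"
    have "\<exists>\<alpha>\<in>K. \<alpha> \<noteq> 0 \<and> principal (\<alpha> ^ n) = principal (of_nat (Q j))" if j: "j \<in> S - T" for j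
    proof -
      define I where "I = finprod FI (\<lambda>t. ideal_pow (ramified_ideal t) (a j t)) (insert j T)"
      have sub: "insert j T \<subseteq> S" and fin: "finite (insert j T)" using j T(1) finT by auto
      have fr: "fractional_ideal K (ideal_pow (ramified_ideal t) m)" if "t \<in> insert j T" for t m
        using frac that sub by (intro fractional_ideal_pow) blast
      have cp: "cls (ideal_pow (ramified_ideal t) m) = x t [^]\<^bsub>Po\<^esub> m" if "t \<in> insert j T" for t m
        unfolding x_def by (rule cls_pow) (use frac that sub in blast)
      have cP: "cls (ideal_pow (ramified_ideal t) m) \<in> carrier Po" if "t \<in> insert j T" for t m
        unfolding cp[OF that] using xPo that sub by (intro Po.nat_pow_closed) blast
      note fp = cls_finprod[where I = "\<lambda>t. ideal_pow (ramified_ideal t) (a j t)", OF fin fr cP]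
      have "cls I = finprod Po (\<lambda>t. cls (ideal_pow (ramified_ideal t) (a j t))) (insert j T)"
        unfolding I_def by (rule fp(1)[symmetric])
      also have "\<dots> = finprod Po (\<lambda>t. x t [^]\<^bsub>Po\<^esub> a j t) (insert j T)"
        by (rule Po.finprod_cong') (use cp xPo sub in \<open>auto intro!: Po.nat_pow_closed\<close>)
      finally have "cls I = \<one>\<^bsub>Cl\<^esub>" using a(3)[OF j] by simp
      then obtain \<alpha> where al: "\<alpha> \<in> K" "\<alpha> \<noteq> 0" "I = principal \<alpha>"
        using cls_trivial[of I] fp(2)[folded I_def] by blast
      have "principal (\<alpha> ^ n) = ideal_pow I n" unfolding al(3) using al by (simp add: principal_pow)
      also have "\<dots> = principal (of_nat (Q j))"
        unfolding I_def Q_def by (rule ramified_product_power[OF fin]) (use S(2) sub in blast)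
      finally show ?thesis using al by blast
    qed
    then obtain \<alpha> where al: "\<And>j. j \<in> S - T \<Longrightarrow> \<alpha> j \<in> K" "\<And>j. j \<in> S - T \<Longrightarrow> \<alpha> j \<noteq> 0"
      "\<And>j. j \<in> S - T \<Longrightarrow> principal (\<alpha> j ^ n) = principal (of_nat (Q j))" by metis
    have Qpos: "Q j > 0" if "j \<in> S - T" for j
      unfolding Q_def using finT that T(1) by (auto intro!: prod_pos prime_gt_0_nat qprime)
    have "finite (S - T)" "card (S - T) > n" using S(1) big by auto
    from radical_relation[where \<alpha> = \<alpha> and Q = Q, OF real n(2) prime_gt_1_nat[OF n(1)] this al(1,2) Qpos al(3)]
    obtain e b j where e: "\<forall>i\<in>S - T. e i < n" "j \<in> S - T" "e j \<noteq> 0" "(\<Prod>i\<in>S - T. Q i ^ e i) = b ^ n" by blast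
    have jp: "prime j" using e(2) qprime by blast
    have multQ: "multiplicity j (Q i) = (if i = j then a j j else 0)" if i: "i \<in> S - T" for i
    proof -
      have "0 \<notin> (\<lambda>t. t ^ a i t) ` insert i T"
      proof
        assume "0 \<in> (\<lambda>t. t ^ a i t) ` insert i T"
        then obtain t where "t \<in> insert i T" "0 = t ^ a i t" by (elim imageE)
        then have "t \<in> S" "t = 0" using i T(1) by auto
        then show False using qprime[of t] by simp
      qed
      then have "multiplicity j (Q i) = (\<Sum>t\<in>insert i T. multiplicity j (t ^ a i t))"
        unfolding Q_def
        by (intro prime_elem_multiplicity_prod_distrib) (use jp finT in auto)
      also have "\<dots> = (\<Sum>t\<in>insert i T. if t = j then a i t else 0)"
      proof (rule sum.cong)
        fix t assume "t \<in> insert i T"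
        then have "prime t" using i T(1) qprime by blast
        then show "multiplicity j (t ^ a i t) = (if t = j then a i t else 0)"
          using jp multiplicity_distinct_prime_power[of j t] by (cases "t = j") auto
      qed simp
      also have "\<dots> = (if i = j then a j j else 0)"
        using finT i e(2) by (auto simp: sum.delta)
      finally show ?thesis .
    qed
    have "n * multiplicity j b = multiplicity j (b ^ n)"
    proof -
      have "(\<Prod>i\<in>S - T. Q i ^ e i) > 0" using Qpos by (intro prod_pos) auto
      then have "b \<noteq> 0" using e(4) prime_gt_0_nat[OF n(1)] by (cases "b = 0") (auto simp: power_0_left)
      then show ?thesis using jp by (simp add: prime_elem_multiplicity_power_distrib)
    qed
    also have "\<dots> = (\<Sum>i\<in>S - T. multiplicity j (Q i ^ e i))"
      unfolding e(4)[symmetric]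
    proof (rule prime_elem_multiplicity_prod_distrib)
      show "0 \<notin> (\<lambda>i. Q i ^ e i) ` (S - T)"
      proof
        assume "0 \<in> (\<lambda>i. Q i ^ e i) ` (S - T)"
        then obtain i where i: "i \<in> S - T" "0 = Q i ^ e i" by (elim imageE)
        have "Q i ^ e i > 0" using Qpos[OF i(1)] by simp
        then show False using i(2) by simp
      qed
    qed (use jp S(1) in auto)
    also have "\<dots> = (\<Sum>i\<in>S - T. if i = j then e j * a j j else 0)"
    proof (rule sum.cong)
      fix i assume i: "i \<in> S - T"
      then show "multiplicity j (Q i ^ e i) = (if i = j then e j * a j j else 0)"
        using jp Qpos[OF i] multQ[OF i] by (auto simp: prime_elem_multiplicity_power_distrib)
    qed simp
    also have "\<dots> = e j * a j j" using S(1) e(2) by simp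
    finally have "n dvd e j * a j j" by (metis dvd_triv_left)
    then have "n dvd e j \<or> n dvd a j j" using n(1) by (simp add: prime_dvd_mult_iff)
    moreover have "e j < n" "e j > 0" "a j j < n" "a j j > 0" using e(1-3) a(1,2)[OF e(2)] by auto
    ultimately show False using nat_dvd_not_less by blast
  qed
  then have "k \<le> card T" using S(1,3) T(1) finT by (simp add: card_Diff_subset)
  then obtain U where U: "U \<subseteq> T" "card U = k" by (meson obtain_subset_with_card_n)
  have finU: "finite U" using U(1) finT by (rule finite_subset)
  have n0: "n > 0" using n(1) by (rule prime_gt_0_nat)
  show ?thesis
  proof (rule Po.has_subgroup_elementary_abelian[OF finU U(2) n0])
    show "x t \<in> carrier Po" "x t [^]\<^bsub>Po\<^esub> n = \<one>\<^bsub>Po\<^esub>" if "t \<in> U" for t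
      using that U(1) T(1) xPo xn by auto
    show "pow_independent Po n x U"
      by (rule Po.pow_independent_subset[OF T(2) U(1) finT _ n0]) (use xPo T(1) in blast)
  qed
qed

end

section \<open>The Lecacheux family\<close>

text \<open>
  The coefficients are defined over an arbitrary commutative ring, so that one identity serves integers, real
  numbers and complex numbers.
\<close>

definition lec4 :: "'a::comm_ring_1 \<Rightarrow> 'a" where "lec4 s = s^5 - 3"
definition lec3 :: "'a::comm_ring_1 \<Rightarrow> 'a" where
  "lec3 s = - (s^9) - 2*s^8 - 3*s^7 - 5*s^6 - 6*s^5 - 2*s^4 + s^3 - s^2 + 3"
definition lec2 :: "'a::comm_ring_1 \<Rightarrow> 'a" where
  "lec2 s = s^10 + 2*s^9 + 4*s^8 + 6*s^7 + 10*s^6 + 9*s^5 + 4*s^4 - 2*s^3 + 2*s^2 - 1"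
definition lec1 :: "'a::comm_ring_1 \<Rightarrow> 'a" where
  "lec1 s = - (s^2 * (s^7 + 2*s^6 + 3*s^5 + 5*s^4 + 5*s^3 + 2*s^2 - s + 1))"

definition lec :: "'a::comm_ring_1 \<Rightarrow> 'a \<Rightarrow> 'a" where
  "lec s x = x^5 + lec4 s * x^4 + lec3 s * x^3 + lec2 s * x^2 + lec1 s * x + s^5"

text \<open>
  This quartic divides all lower coefficients of the depressed quintic, with the cofactors below. Its
  product with \<open>cofactor0\<close> is the constant coefficient, and the two are coprime outside \<open>5\<close>. So the depressed
  quintic is Eisenstein at the primes other than \<open>5\<close> that divide the value of the quartic exactly once.
\<close>

definition ramified_factor :: "'a::comm_ring_1 \<Rightarrow> 'a" where
  "ramified_factor s = s^4 - 2*s^3 + 4*s^2 - 3*s + 1"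
definition cofactor0 :: "'a::comm_ring_1 \<Rightarrow> 'a" where
  "cofactor0 s = 4*s^21 + 33*s^20 + 100*s^19 + 155*s^18 + 130*s^17 + 122*s^16 + 164*s^15 + 100*s^14 -
      120*s^13 - 145*s^12 - 364*s^11 - 758*s^10 - 800*s^9 - 90*s^8 + 110*s^7 - 42*s^6 - 694*s^5 - 1200*s^4
      - 960*s^3 - 660*s^2 - 216*s - 72"
definition cofactor1 :: "'a::comm_ring_1 \<Rightarrow> 'a" where
  "cofactor1 s = - 15*s^16 - 105*s^15 - 300*s^14 - 450*s^13 - 375*s^12 - 265*s^11 - 280*s^10 - 200*s^9 +
      75*s^8 + 125*s^7 + 245*s^6 + 515*s^5 + 800*s^4 + 700*s^3 + 500*s^2 + 180*s + 60"
definition cofactor2 :: "'a::comm_ring_1 \<Rightarrow> 'a" where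
  "cofactor2 s = 20*s^11 + 115*s^10 + 300*s^9 + 425*s^8 + 350*s^7 + 180*s^6 + 110*s^5 + 100*s^4 + 100*s^3 +
      75*s^2 + 30*s + 10"
definition cofactor3 :: "'a::comm_ring_1 \<Rightarrow> 'a" where
  "cofactor3 s = - 10*s^6 - 45*s^5 - 100*s^4 - 125*s^3 - 100*s^2 - 45*s - 15"

text \<open>
  The substitution \<open>y = 5 * x + a\<close> removes the term of degree four without introducing denominators.
\<close>

lemma depressed_quintic:
  fixes a b c d e x :: "'a::idom"
  shows "(5*x + a)^5 + (25* b - 10* a^2) * (5*x + a)^3 + (20* a^3 - 75* a* b + 125* c) * (5*x + a)^2
      + (75* a^2* b - 15* a^4 - 250* a* c + 625* d) * (5*x + a)
      + (4* a^5 - 25* a^3* b + 125* a^2* c - 625* a* d + 3125* e)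
    = 3125 * (x^5 + a*x^4 + b*x^3 + c*x^2 + d*x + e)"
  by (simp add: power_numeral_reduce algebra_simps)

lemma depressed_coefficients:
  fixes s :: "'a::idom"
  shows "25 * lec3 s - 10 * lec4 s ^ 2 = ramified_factor s * cofactor3 s"
    "20 * lec4 s ^ 3 - 75 * lec4 s * lec3 s + 125 * lec2 s = ramified_factor s * cofactor2 s"
    "75 * lec4 s ^ 2 * lec3 s - 15 * lec4 s ^ 4 - 250 * lec4 s * lec2 s + 625 * lec1 s
      = ramified_factor s * cofactor1 s"
    "4 * lec4 s ^ 5 - 25 * lec4 s ^ 3 * lec3 s + 125 * lec4 s ^ 2 * lec2 s - 625 * lec4 s * lec1 s
      + 3125 * s ^ 5 = ramified_factor s * cofactor0 s"
  unfolding lec4_def lec3_def lec2_def lec1_def ramified_factor_def cofactor3_def cofactor2_def cofactor1_def cofactor0_def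
  by (simp_all add: power_numeral_reduce algebra_simps)

lemma ramified_factor_cof0_coprime:
  fixes s :: "'a::idom"
  shows "(- 608*s^20 - 5320*s^19 - 17780*s^18 - 31710*s^17 - 32905*s^16 - 29464*s^15 - 32545*s^14 -
      24005*s^13 + 14265*s^12 + 36295*s^11 + 75108*s^10 + 148910*s^9 + 184465*s^8 + 80455*s^7 - 14210*s^6
      - 30831*s^5 + 77940*s^4 + 222085*s^3 + 247045*s^2 + 182535*s + 63797) * ramified_factor s
    + (152*s^3 - 228*s^2 + 474*s - 199) * cofactor0 s = 78125"
  unfolding ramified_factor_def cofactor0_def by (simp add: power_numeral_reduce algebra_simps)

text \<open>
  In terms of \<open>t = s ^ 5\<close> the right-hand side is \<open>t ^ 2 - 11 * t - 1\<close>, whose discriminant is \<open>125\<close>. This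
  shows that the quartic has no multiple zeros modulo primes other than \<open>5\<close>.
\<close>

lemma ramified_factor_mult:
  fixes s :: "'a::idom"
  shows "ramified_factor s * (s^6 + 2*s^5 - 5*s^3 - 5*s^2 - 3*s - 1) = s^10 - 11*s^5 - 1"
  unfolding ramified_factor_def by (simp add: power_numeral_reduce algebra_simps)

definition depressed_poly :: "int \<Rightarrow> int poly" where
  "depressed_poly s = [:ramified_factor s * cofactor0 s, ramified_factor s * cofactor1 s, ramified_factor s * cofactor2 s, ramified_factor s * cofactor3 s, 0, 1:]"

lemma degree_depressed: "degree (depressed_poly s) = 5" and lead_depressed: "lead_coeff (depressed_poly s) = 1"
  by (simp_all add: depressed_poly_def)

lemma of_int_lec:
  "of_int (lec4 s) = lec4 (of_int s :: 'a::idom)" "of_int (lec3 s) = lec3 (of_int s :: 'a)"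
  "of_int (lec2 s) = lec2 (of_int s :: 'a)" "of_int (lec1 s) = lec1 (of_int s :: 'a)"
  "of_int (ramified_factor s) = ramified_factor (of_int s :: 'a)"
  "of_int (cofactor0 s) = cofactor0 (of_int s :: 'a)" "of_int (cofactor1 s) = cofactor1 (of_int s :: 'a)"
  "of_int (cofactor2 s) = cofactor2 (of_int s :: 'a)" "of_int (cofactor3 s) = cofactor3 (of_int s :: 'a)"
  by (simp_all add: lec4_def lec3_def lec2_def lec1_def ramified_factor_def cofactor0_def cofactor1_def cofactor2_def cofactor3_def)

lemma depressed_poly_value:
  fixes x :: complex
  shows "poly (map_poly of_int (depressed_poly s)) (5 * x + lec4 (of_int s)) = 3125 * lec (of_int s) x"
proof -
  have horner: "c0 + y * (c1 + y * (c2 + y * (c3 + y * (0 + y * 1)))) = y^5 + c3 * y^3 + c2 * y^2 + c1 * y + c0"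
    for y c0 c1 c2 c3 :: complex by (simp add: power_numeral_reduce algebra_simps)
  define y where "y = 5 * x + lec4 (of_int s)"
  have "poly (map_poly of_int (depressed_poly s)) y = y^5 + ramified_factor (of_int s) * cofactor3 (of_int s) * y^3
      + ramified_factor (of_int s) * cofactor2 (of_int s) * y^2 + ramified_factor (of_int s) * cofactor1 (of_int s) * y + ramified_factor (of_int s) * cofactor0 (of_int s)"
    unfolding horner[symmetric] depressed_poly_def
    by (simp add: of_int_hom.map_poly_pCons_hom of_int_lec)
  also have "\<dots> = 3125 * lec (of_int s) x"
    unfolding y_def lec_def depressed_quintic[symmetric] depressed_coefficients[symmetric] ..
  finally show ?thesis unfolding y_def .
qed

lemma eisenstein_depressed:
  assumes q: "prime q" "q \<noteq> 5" and dvd: "int q dvd ramified_factor s" "\<not> (int q)\<^sup>2 dvd ramified_factor s"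
  shows "eisenstein_at (depressed_poly s) q"
proof -
  have pq: "prime (int q)" using q(1) by simp
  have "\<not> int q dvd cofactor0 s"
  proof
    assume "int q dvd cofactor0 s"
    then have "int q dvd 78125"
      using dvd(1) ramified_factor_cof0_coprime[of s] by (metis dvd_add dvd_mult)
    then have "int q dvd 5 ^ 7" by simp
    then have "int q dvd 5" using pq prime_dvd_power by blast
    then have "q dvd 5" by (metis int_dvd_int_iff of_nat_numeral)
    moreover have "prime (5::nat)" by (simp add: prime_nat_numeral_eq)
    ultimately show False using q by (metis primes_dvd_imp_eq)
  qed
  then have "coprime (int q) (cofactor0 s)" using pq prime_imp_coprime by blast
  then have "coprime ((int q)\<^sup>2) (cofactor0 s)" by simp
  then have "\<not> (int q)\<^sup>2 dvd ramified_factor s * cofactor0 s" using dvd(2) by (simp add: coprime_dvd_mult_left_iff)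
  moreover have "int q dvd coeff (depressed_poly s) i" if "i < 5" for i
  proof -
    have "i \<in> {0, 1, 2, 3, 4}" using that by auto
    then show ?thesis using dvd(1) by (auto simp: depressed_poly_def numeral_eq_Suc)
  qed
  ultimately show ?thesis unfolding eisenstein_at_def degree_depressed using q(1) by (simp add: depressed_poly_def)
qed

subsection \<open>The quintics are totally real\<close>

text \<open>
  In Horner's scheme every intermediate value stays at least \<open>1\<close>: it is multiplied by at least \<open>100\<close> and
  then decreased by at most \<open>99\<close>. This decides the sign of explicit polynomials with small coefficients.
\<close>

lemma horner_positive:
  fixes s :: real
  assumes "s \<ge> 100" "v \<ge> 1" "\<forall>c\<in>set cs. c \<ge> - 99"
  shows "foldl (\<lambda>v c. v * s + c) v cs \<ge> 1"
  using assms(2,3)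
proof (induction cs arbitrary: v)
  case (Cons c cs)
  have "v * s \<ge> 1 * 100" using assms(1) Cons.prems(1) by (intro mult_mono) auto
  then show ?case using Cons by auto
qed simp

text \<open>
  The roots of the quintic have approximate sizes \<open>- s ^ 5\<close>, \<open>s ^ (- 4)\<close>, \<open>s ^ (- 1)\<close>, \<open>s\<close> and \<open>s ^ 4\<close>. The
  six evaluation points separate them.
\<close>

lemma lec_signs:
  fixes s :: real
  assumes s: "s \<ge> 100"
  shows "lec s (- 2 * s^5) < 0" "lec s 0 > 0" "lec s (1 / s^2) < 0" "lec s 1 > 0" "lec s (s^2) < 0" "lec s (s^5) > 0"
proof -
  note defs = lec_def lec4_def lec3_def lec2_def lec1_def
  have pos: "s > 0" using s by simp
  have "- lec s (- 2 * s^5) = foldl (\<lambda>v c. v * s + c) 16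
      [-8, -16, -24, -40, -4, -24, -8, -32, -40, -12, -18, 4, -14, -10, -6, -4, 2, -2, 0, -1, 0, 0, 0, 0, 0]"
    unfolding defs by (simp add: power_numeral_reduce algebra_simps)
  moreover have "\<dots> \<ge> 1" by (rule horner_positive[OF s]) auto
  ultimately show "lec s (- 2 * s^5) < 0" by linarith
  show "lec s 0 > 0" using pos by (simp add: defs)
  \<comment> \<open>The factor \<open>s ^ 10\<close> clears the denominators.\<close>
  have "- (s ^ 10 * lec s (1 / s^2)) = foldl (\<lambda>v c. v * s + c) 1
      [1, 0, 1, 0, -6, -7, 2, 8, 0, -2, 2, 0, -3, 0, 3, 0, -1]"
  proof -
    define r where "r = 1 / s"
    have "1 / s^2 = r^2" "s * r = 1" unfolding r_def using pos by (simp_all add: power_divide)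
    have rk: "s ^ (m + k) * r ^ k = s ^ m" for m k
      by (simp only: power_add mult.assoc power_mult_distrib[symmetric] \<open>s * r = 1\<close> power_one mult_1_right)
    have rks: "s^10 * r^10 = 1" "s^10 * r^8 = s^2" "s^10 * r^6 = s^4" "s^10 * r^4 = s^6" "s^10 * r^2 = s^8"
      using rk[of 0 10] rk[of 2 8] rk[of 4 6] rk[of 6 4] rk[of 8 2] by simp_all
    have "s^10 * lec s (r^2) = s^10 * r^10 + lec4 s * (s^10 * r^8) + lec3 s * (s^10 * r^6)
        + lec2 s * (s^10 * r^4) + lec1 s * (s^10 * r^2) + s^10 * s^5"
      unfolding lec_def power_mult[symmetric] by (simp add: algebra_simps)
    then have "s^10 * lec s (r^2) = 1 + lec4 s * s^2 + lec3 s * s^4 + lec2 s * s^6 + lec1 s * s^8 + s^10 * s^5"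
      unfolding rks .
    then show ?thesis unfolding \<open>1 / s^2 = r^2\<close> lec4_def lec3_def lec2_def lec1_def
      by (simp add: power_numeral_reduce algebra_simps)
  qed
  moreover have "\<dots> \<ge> 1" by (rule horner_positive[OF s]) auto
  ultimately have "s ^ 10 * lec s (1 / s^2) < 0" by linarith
  then show "lec s (1 / s^2) < 0" using pos by (simp add: mult_less_0_iff zero_less_power less_not_sym)
  have "lec s 1 = s ^ 10" unfolding defs by (simp add: power_numeral_reduce algebra_simps)
  then show "lec s 1 > 0" using pos by simp
  have "- lec s (s^2) = foldl (\<lambda>v c. v * s + c) 1 [1, 0, 1, 1, -7, -7, 5, 7, -3, -2, 2, 0, 0, 0, 0]"
    unfolding defs by (simp add: power_numeral_reduce algebra_simps)
  moreover have "\<dots> \<ge> 1" by (rule horner_positive[OF s]) auto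
  ultimately show "lec s (s^2) < 0" by linarith
  have "lec s (s^5) = foldl (\<lambda>v c. v * s + c) 2
      [-1, -2, -3, -5, -8, 0, 5, 5, 10, 12, 3, -4, -1, -5, -6, -2, 1, -1, 0, 1, 0, 0, 0, 0, 0]"
    unfolding defs by (simp add: power_numeral_reduce algebra_simps)
  moreover have "\<dots> \<ge> 1" by (rule horner_positive[OF s]) auto
  ultimately show "lec s (s^5) > 0" by linarith
qed

lemma lec_sign_change:
  fixes s a b :: real
  assumes "a < b" "lec s a < 0 \<and> lec s b > 0 \<or> lec s a > 0 \<and> lec s b < 0"
  shows "\<exists>x. a < x \<and> x < b \<and> lec s x = 0"
proof -
  have cont: "continuous_on {a..b} (lec s)" unfolding lec_def by (intro continuous_intros)
  have "\<exists>x\<ge>a. x \<le> b \<and> lec s x = 0"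
    using assms(2) IVT'[of "lec s" a 0 b] IVT2'[of "lec s" b 0 a] cont assms(1) by fastforce
  then obtain x where "a \<le> x" "x \<le> b" "lec s x = 0" by blast
  moreover from this have "x \<noteq> a" "x \<noteq> b" using assms(2) by auto
  ultimately show ?thesis by (intro exI[of _ x]) auto
qed

lemma lec_five_real_roots:
  fixes s :: real
  assumes s: "s \<ge> 100"
  shows "\<exists>A. card A = 5 \<and> (\<forall>x\<in>A. lec s x = 0)"
proof -
  note sg = lec_signs[OF s]
  have o1: "- 2 * s^5 < 0" using s by simp
  have o2: "0 < 1 / s^2" using s by simp
  have o3: "1 / s^2 < 1" using s by (simp add: one_less_power)
  have o4: "1 < s^2" using s by (simp add: one_less_power)
  have o5: "s^2 < s^5" using s by (intro power_strict_increasing) auto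
  obtain x1 where x1: "- 2 * s^5 < x1" "x1 < 0" "lec s x1 = 0" using lec_sign_change[OF o1] sg by blast
  obtain x2 where x2: "0 < x2" "x2 < 1 / s^2" "lec s x2 = 0" using lec_sign_change[OF o2] sg by blast
  obtain x3 where x3: "1 / s^2 < x3" "x3 < 1" "lec s x3 = 0" using lec_sign_change[OF o3] sg by blast
  obtain x4 where x4: "1 < x4" "x4 < s^2" "lec s x4 = 0" using lec_sign_change[OF o4] sg by blast
  obtain x5 where x5: "s^2 < x5" "x5 < s^5" "lec s x5 = 0" using lec_sign_change[OF o5] sg by blast
  have "x1 < x2" "x2 < x3" "x3 < x4" "x4 < x5" using x1 x2 x3 x4 x5 by linarith+
  then have "card {x1, x2, x3, x4, x5} = 5" by auto
  moreover have "\<forall>x\<in>{x1, x2, x3, x4, x5}. lec s x = 0" using x1 x2 x3 x4 x5 by auto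
  ultimately show ?thesis by blast
qed

lemma lec_of_real: "lec (of_real s) (of_real x) = (of_real (lec s x) :: complex)"
  by (simp add: lec_def lec4_def lec3_def lec2_def lec1_def)

lemma depressed_totally_real:
  assumes s: "s \<ge> 100"
  shows "card {z::complex. poly (map_poly of_int (depressed_poly s)) z = 0} = 5"
    "{z::complex. poly (map_poly of_int (depressed_poly s)) z = 0} \<subseteq> \<real>"
proof -
  let ?Z = "{z::complex. poly (map_poly of_int (depressed_poly s)) z = 0}"
  obtain A where A: "card A = 5" "\<forall>x\<in>A. lec (real_of_int s) x = 0"
    using lec_five_real_roots[of "real_of_int s"] s by auto
  define h where "h = (\<lambda>x. complex_of_real (5 * x + lec4 (real_of_int s)))"
  have inj: "inj_on h A" 
  proof (rule inj_onI)
    fix x y assume "h x = h y"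
    then have "5 * x + lec4 (real_of_int s) = 5 * y + lec4 (real_of_int s)"
      unfolding h_def of_real_eq_iff .
    then show "x = y" by simp
  qed
  have "h x \<in> ?Z" if "x \<in> A" for x
  proof -
    have "h x = 5 * complex_of_real x + lec4 (of_int s)" unfolding h_def by (simp add: lec4_def)
    moreover have "lec (of_int s) (complex_of_real x) = 0"
      using lec_of_real[of "real_of_int s" x] A(2) that by simp
    ultimately show ?thesis using depressed_poly_value[of s "complex_of_real x"] by simp
  qed
  then have sub: "h ` A \<subseteq> ?Z" by blast
  have nz: "(map_poly of_int (depressed_poly s) :: complex poly) \<noteq> 0"
    using lead_depressed[of s] by auto
  have fin: "finite ?Z" using nz by (rule poly_roots_finite)
  have le: "card ?Z \<le> 5"
    using card_poly_roots_bound[OF nz] by (simp add: degree_map_poly degree_depressed)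
  have "card (h ` A) = 5" using card_image[OF inj] A(1) by simp
  then have eq: "h ` A = ?Z" using card_subset_eq[OF fin sub] card_mono[OF fin sub] le by simp
  then show "card ?Z = 5" using \<open>card (h ` A) = 5\<close> by simp
  show "?Z \<subseteq> \<real>" unfolding eq[symmetric] h_def by auto
qed

subsection \<open>The Polya groups of the family\<close>

lemma lecacheux_poly_value:
  "poly (map_poly of_rat (lecacheux_poly (of_int s))) z = lec (of_int s) (z::complex)"
proof -
  have horner: "a0 + z * (d1 + z * (d2 + z * (d3 + z * (d4 + z * 1)))) = z^5 + d4 * z^4 + d3 * z^3 + d2 * z^2 + d1 * z + a0"
    for a0 d1 d2 d3 d4 :: complex by (simp add: power_numeral_reduce algebra_simps)
  show ?thesis
    unfolding lec_def lec4_def lec3_def lec2_def lec1_def lecacheux_poly_def horner[symmetric]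
    by (simp add: of_rat_hom.map_poly_pCons_hom of_rat_add of_rat_diff of_rat_mult of_rat_power of_rat_minus)
qed

text \<open>
  The field is generated by \<open>5 * \<theta> + a\<^sub>4(s)\<close>, a root of the depressed quintic. That polynomial is totally
  real, and Eisenstein at each prime of \<open>S\<close>.
\<close>

theorem lecacheux_polya_group:
  assumes s: "s \<ge> 100" and S: "finite S" "card S \<ge> k + 5"
    "\<And>q. q \<in> S \<Longrightarrow> prime q \<and> q \<noteq> 5 \<and> int q dvd ramified_factor s \<and> \<not> (int q)\<^sup>2 dvd ramified_factor s"
    and root: "poly (map_poly of_rat (lecacheux_poly (of_int s))) \<theta> = 0"
  shows "has_subgroup_isomorphic_to (polya_group (rat_adjoin \<theta>)) (product_group {..<k} (\<lambda>_. integer_mod_group 5))"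
proof -
  let ?F = "depressed_poly s"
  define \<eta> where "\<eta> = 5 * \<theta> + lec4 (of_int s)"
  have eis: "eisenstein_at ?F q" if "q \<in> S" for q using S(3)[OF that] eisenstein_depressed by blast
  have "S \<noteq> {}" using S(2) by auto
  then obtain q0 where q0: "q0 \<in> S" by blast
  have rt: "poly (map_poly of_int ?F) \<eta> = 0"
    using root unfolding \<eta>_def depressed_poly_value lecacheux_poly_value by simp
  interpret number_field_root ?F \<eta>
  proof
    show "lead_coeff ?F = 1" by (rule lead_depressed)
    show "poly (map_poly of_int ?F) \<eta> = 0" by (rule rt)
    show "R = 0" if "degree R < degree ?F" "ev \<eta> R = 0" for R
      by (rule eisenstein_minimal[OF eis[OF q0] lead_depressed rt that])
    show "card {z::complex. poly (map_poly of_int ?F) z = 0} = degree ?F"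
      using depressed_totally_real(1)[OF s] unfolding degree_depressed .
  qed
  have n5: "n = 5" by (rule degree_depressed)
  have "lec4 (of_int s :: complex) = of_int (lec4 s)" by (simp add: of_int_lec)
  then have th: "\<theta> = (\<eta> - of_int (lec4 s)) / 5" "\<eta> = 5 * \<theta> + of_int (lec4 s)" unfolding \<eta>_def by simp_all
  have "(5::complex) \<in> K" using K_closed(4)[of 5] by simp
  then have thK: "\<theta> \<in> K" unfolding th(1) by (intro K_divide K_closed)
  have "rat_adjoin \<theta> = K"
  proof
    show "rat_adjoin \<theta> \<subseteq> K" by (rule rat_adjoin_subset[OF thK])
    have "of_rat 5 * \<theta> + of_rat (of_int (lec4 s)) \<in> rat_adjoin \<theta>"
      by (intro rat_adjoin_closed rat_adjoin_of_rat)
    then have "\<eta> \<in> rat_adjoin \<theta>" unfolding th(2) by simp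
    then show "K \<subseteq> rat_adjoin \<theta>" by (rule K_subset_rat_adjoin)
  qed
  moreover have "has_subgroup_isomorphic_to (polya_group K) (product_group {..<k} (\<lambda>_. integer_mod_group n))"
  proof (rule polya_group_large)
    show "Z \<subseteq> \<real>" unfolding Z_def by (rule depressed_totally_real(2)[OF s])
    show "prime n" "odd n" "k + n \<le> card S" unfolding n5 using S(2) by (simp_all add: prime_nat_numeral_eq)
  qed (use S(1) eis in auto)
  ultimately show ?thesis unfolding n5 by simp
qed

section \<open>Ramified primes in residue classes\<close>

lemma ramified_factor_cong: "[s = t] (mod m) \<Longrightarrow> [ramified_factor s = ramified_factor t] (mod (m::int))"
  unfolding ramified_factor_def by (intro cong_add cong_diff cong_mult cong_pow cong_refl)

lemma power_add_mod_square:
  fixes s q :: int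
  shows "\<exists>r. (s + q) ^ Suc m = s ^ Suc m + int (Suc m) * s ^ m * q + q\<^sup>2 * r"
proof (induction m)
  case (Suc m)
  then obtain r where r: "(s + q) ^ Suc m = s ^ Suc m + int (Suc m) * s ^ m * q + q\<^sup>2 * r" by blast
  have "(s + q) ^ Suc (Suc m) = (s + q) * (s ^ Suc m + int (Suc m) * s ^ m * q + q\<^sup>2 * r)"
    unfolding power_Suc[of "s + q" "Suc m"] r ..
  also have "\<dots> = s ^ Suc (Suc m) + int (Suc (Suc m)) * s ^ Suc m * q + q\<^sup>2 * (int (Suc m) * s ^ m + (s + q) * r)"
    by (simp add: algebra_simps power2_eq_square)
  finally show ?case by blast
qed (auto intro: exI[of _ 0])

text \<open>
  If all zeros modulo \<open>q\<close> were zeros modulo \<open>q ^ 2\<close>, in particular \<open>s\<close> and \<open>s + q\<close>, then \<open>q\<close> would divide the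
  derivative \<open>5 * s ^ 4 * (2 * s ^ 5 - 11)\<close> of \<open>G(s) = s ^ 10 - 11 * s ^ 5 - 1\<close>. But \<open>q\<close> does not divide \<open>s\<close>
  because \<open>G(0) = - 1\<close>, and \<open>(2 * s ^ 5 - 11) ^ 2 = 4 * G(s) + 125\<close>.
\<close>

lemma ramified_factor_simple_zero:
  fixes s :: int
  assumes q: "prime q" "q \<noteq> 5" and dvd: "int q dvd ramified_factor s"
  shows "\<exists>t. int q dvd ramified_factor t \<and> \<not> (int q)\<^sup>2 dvd ramified_factor t"
proof (rule ccontr)
  assume no: "\<not> ?thesis"
  have pq: "prime (int q)" using q(1) by simp
  define G where "G = (\<lambda>s::int. s^10 - 11*s^5 - 1)"
  have Gd: "ramified_factor t dvd G t" for t unfolding G_def ramified_factor_mult[symmetric] by simp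
  have "[s + int q = s] (mod int q)" by (simp add: cong_def)
  then have "int q dvd ramified_factor (s + int q)" using dvd ramified_factor_cong cong_dvd_iff by blast
  then have "(int q)\<^sup>2 dvd ramified_factor s" "(int q)\<^sup>2 dvd ramified_factor (s + int q)" using no dvd by blast+
  then have sq: "(int q)\<^sup>2 dvd G (s + int q) - G s" using Gd by (meson dvd_diff dvd_trans)
  obtain a where a: "(s + int q) ^ 10 = s ^ 10 + 10 * s ^ 9 * int q + (int q)\<^sup>2 * a"
    using power_add_mod_square[of s "int q" 9] by auto
  obtain b where b: "(s + int q) ^ 5 = s ^ 5 + 5 * s ^ 4 * int q + (int q)\<^sup>2 * b"
    using power_add_mod_square[of s "int q" 4] by auto
  have "G (s + int q) - G s = int q * (5 * s^4 * (2 * s^5 - 11)) + (int q)\<^sup>2 * (a - 11 * b)"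
    unfolding G_def a b by (simp add: algebra_simps flip: power_add)
  then have "(int q)\<^sup>2 dvd int q * (5 * s^4 * (2 * s^5 - 11))"
    using sq by (metis dvd_add_times_triv_right_iff mult.commute)
  then have "int q dvd 5 * s^4 * (2 * s^5 - 11)"
    unfolding power2_eq_square using prime_gt_0_nat[OF q(1)] by simp
  then have "int q dvd 5 \<or> int q dvd s ^ 4 \<or> int q dvd 2 * s^5 - 11"
    unfolding prime_dvd_mult_iff[OF pq] by blast
  then have "int q dvd 5 \<or> int q dvd s \<or> int q dvd 2 * s^5 - 11"
    using prime_dvd_power[OF pq] by blast
  moreover have q5: "\<not> int q dvd 5"
  proof
    assume "int q dvd 5"
    then have "q dvd 5" by (metis int_dvd_int_iff of_nat_numeral)
    moreover have "prime (5::nat)" by (simp add: prime_nat_numeral_eq)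
    ultimately show False using q by (metis primes_dvd_imp_eq)
  qed
  moreover have qG: "int q dvd G s" using dvd Gd by (rule dvd_trans)
  moreover have "\<not> int q dvd s"
  proof
    assume "int q dvd s"
    then have "int q dvd s * (s^9 - 11 * s^4) - G s" using qG by (intro dvd_diff dvd_mult2)
    also have "s * (s^9 - 11 * s^4) - G s = 1" unfolding G_def by (simp add: algebra_simps flip: power_Suc power_Suc2)
    finally show False using pq by (meson not_prime_unit)
  qed
  moreover have "\<not> int q dvd 2 * s^5 - 11"
  proof
    assume "int q dvd 2 * s^5 - 11"
    from dvd_diff[OF dvd_mult2[OF this] dvd_mult[OF qG]]
    have "int q dvd (2 * s^5 - 11) * (2 * s^5 - 11) - 4 * G s" .
    also have "(2 * s^5 - 11) * (2 * s^5 - 11) - 4 * G s = 5 ^ 3"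
      unfolding G_def by (simp add: algebra_simps flip: power_add)
    finally have "int q dvd 5" using pq prime_dvd_power by blast
    then show False using q5 by blast
  qed
  ultimately show False by blast
qed

lemma ramified_factor_minus_one: "s dvd ramified_factor s - (1::int)"
proof -
  have "ramified_factor s - 1 = s * (s^3 - 2*s^2 + 4*s - 3)"
    unfolding ramified_factor_def by (simp add: power_numeral_reduce algebra_simps)
  then show ?thesis by simp
qed

text \<open>
  Euclid's argument: at a multiple \<open>N\<close> of all primes to be avoided, the quartic has a value that is
  congruent to \<open>1\<close> modulo \<open>N\<close>.
\<close>

lemma new_prime_divisor:
  fixes P :: "nat set"
  assumes P: "finite P" "\<And>q. q \<in> P \<Longrightarrow> prime q"
  obtains q where "prime q" "q \<notin> P" "q \<noteq> 2" "q \<noteq> 5" "\<exists>s. int q dvd ramified_factor s \<and> \<not> (int q)\<^sup>2 dvd ramified_factor s"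
proof -
  define N where "N = 10 * (\<Prod>q\<in>P. q)"
  have "N > 0" unfolding N_def using P by (auto intro!: prod_pos prime_gt_0_nat)
  moreover have "10 dvd N" unfolding N_def by simp
  ultimately have N10: "N \<ge> 10" by (simp add: dvd_imp_le)
  have c: "ramified_factor (int N) > 1"
  proof -
    have "ramified_factor (int N) = 1 + int N * ((int N - 2) * ((int N)\<^sup>2) + 4 * int N - 3)"
      unfolding ramified_factor_def by (simp add: power_numeral_reduce algebra_simps)
    moreover have "(int N - 2) * ((int N)\<^sup>2) \<ge> 0" using N10 by (intro mult_nonneg_nonneg) auto
    then have "(int N - 2) * ((int N)\<^sup>2) + 4 * int N - 3 > 0" using N10 by linarith
    then have "int N * ((int N - 2) * ((int N)\<^sup>2) + 4 * int N - 3) > 0" using N10 by simp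
    ultimately show ?thesis by linarith
  qed
  then have "nat (ramified_factor (int N)) \<noteq> 1" by linarith
  then obtain q where q: "prime q" "q dvd nat (ramified_factor (int N))" using prime_factor_nat by blast
  have qd: "int q dvd ramified_factor (int N)" 
  proof -
    have "int q dvd int (nat (ramified_factor (int N)))" using q(2) by (simp only: int_dvd_int_iff)
    then show ?thesis using c by simp
  qed
  have ndvd: "\<not> q dvd N"
  proof
    assume "q dvd N"
    then have "int q dvd int N" by (simp only: int_dvd_int_iff)
    then have "int q dvd ramified_factor (int N) - 1" using ramified_factor_minus_one by (rule dvd_trans)
    from dvd_diff[OF qd this] have "int q dvd int 1" by simp
    then have "q dvd 1" by (simp only: int_dvd_int_iff)
    then show False using q(1) by simp
  qed
  have "q \<notin> P"
  proof
    assume "q \<in> P"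
    then have "q dvd (\<Prod>q\<in>P. q)" using P(1) by (rule dvd_prodI[rotated])
    then show False using ndvd unfolding N_def by (simp add: dvd_mult)
  qed
  moreover have "q \<noteq> 2" "q \<noteq> 5" using ndvd unfolding N_def by auto
  moreover have "\<exists>s. int q dvd ramified_factor s \<and> \<not> (int q)\<^sup>2 dvd ramified_factor s"
    by (rule ramified_factor_simple_zero[OF q(1) \<open>q \<noteq> 5\<close> qd])
  ultimately show ?thesis using that q(1) by blast
qed

lemma many_prime_divisors:
  "\<exists>S. finite S \<and> card S = m \<and> (\<forall>q\<in>S. prime q \<and> q \<noteq> 2 \<and> q \<noteq> 5 \<and> (\<exists>s. int q dvd ramified_factor s \<and> \<not> (int q)\<^sup>2 dvd ramified_factor s))"
proof (induction m)
  case 0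
  show ?case by (intro exI[of _ "{}"]) auto
next
  case (Suc m)
  then obtain S where S: "finite S" "card S = m"
    "\<forall>q\<in>S. prime q \<and> q \<noteq> 2 \<and> q \<noteq> 5 \<and> (\<exists>s. int q dvd ramified_factor s \<and> \<not> (int q)\<^sup>2 dvd ramified_factor s)" by blast
  obtain q where q: "prime q" "q \<notin> S" "q \<noteq> 2" "q \<noteq> 5" "\<exists>s. int q dvd ramified_factor s \<and> \<not> (int q)\<^sup>2 dvd ramified_factor s"
    using new_prime_divisor[of S] S by blast
  show ?case by (rule exI[of _ "insert q S"]) (use S q in auto)
qed

text \<open>
  Divisibility by \<open>q\<close> but not by \<open>q ^ 2\<close> depends on \<open>s\<close> modulo \<open>q ^ 2\<close> only, so the Chinese remainder theorem
  imposes it for all \<open>q\<close> at once.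
\<close>

lemma residue_class_with_ramified_primes:
  "\<exists>S (M::int) a. finite S \<and> card S = m \<and> M > 0 \<and>
    (\<forall>s. [s = a] (mod M) \<longrightarrow> odd s \<and>
      (\<forall>q\<in>S. prime q \<and> q \<noteq> 5 \<and> int q dvd ramified_factor s \<and> \<not> (int q)\<^sup>2 dvd ramified_factor s))"
proof -
  obtain S where S: "finite S" "card S = m"
    "\<forall>q\<in>S. prime q \<and> q \<noteq> 2 \<and> q \<noteq> 5 \<and> (\<exists>s. int q dvd ramified_factor s \<and> \<not> (int q)\<^sup>2 dvd ramified_factor s)"
    using many_prime_divisors[of m] by blast
  then obtain t where t: "\<And>q. q \<in> S \<Longrightarrow> int q dvd ramified_factor (t q) \<and> \<not> (int q)\<^sup>2 dvd ramified_factor (t q)" by metis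
  \<comment> \<open>The modulus \<open>2\<^sup>2\<close> is added to the squares of the primes to force \<open>s\<close> to be odd.\<close>
  define u where "u = (\<lambda>q. if q = 2 then 1 else nat (t q mod (int q)\<^sup>2))"
  define A where "A = insert 2 S"
  have prA: "prime q" if "q \<in> A" for q using that S(3) unfolding A_def by auto
  have "\<forall>i\<in>A. \<forall>j\<in>A. i \<noteq> j \<longrightarrow> coprime (i\<^sup>2) (j\<^sup>2)"
    using prA by (auto simp: primes_coprime)
  then obtain x where x: "\<forall>i\<in>A. [x = u i] (mod i\<^sup>2)"
    using chinese_remainder_nat[of A "\<lambda>i. i\<^sup>2" u] S(1) unfolding A_def by auto
  define M where "M = int (\<Prod>i\<in>A. i\<^sup>2)"
  have "M > 0" unfolding M_def using prA by (auto intro!: prod_pos prime_gt_0_nat)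
  moreover have "odd s \<and> (\<forall>q\<in>S. prime q \<and> q \<noteq> 5 \<and> int q dvd ramified_factor s \<and> \<not> (int q)\<^sup>2 dvd ramified_factor s)"
    if s: "[s = int x] (mod M)" for s
  proof -
    have sx: "[s = int (u i)] (mod int (i\<^sup>2))" if i: "i \<in> A" for i
    proof -
      have "i\<^sup>2 dvd (\<Prod>i\<in>A. i\<^sup>2)" using i S(1) unfolding A_def by (intro dvd_prodI) auto
      then have "int (i\<^sup>2) dvd M" unfolding M_def by (simp only: int_dvd_int_iff)
      then have "[s = int x] (mod int (i\<^sup>2))" using s cong_dvd_modulus by blast
      moreover have "[int x = int (u i)] (mod int (i\<^sup>2))" using x i by (simp only: cong_int_iff)
      ultimately show ?thesis by (rule cong_trans)
    qed
    have "[s = 1] (mod 4)" using sx[of 2] by (simp add: A_def u_def)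
    then have "4 dvd s - 1" by (simp only: cong_iff_dvd_diff)
    then have "odd s" by presburger
    moreover have "prime q \<and> q \<noteq> 5 \<and> int q dvd ramified_factor s \<and> \<not> (int q)\<^sup>2 dvd ramified_factor s" if q: "q \<in> S" for q
    proof -
      have q2: "q \<noteq> 2" "q > 0" using S(3) q prA by (auto simp: A_def prime_gt_0_nat)
      have "int (u q) = t q mod (int q)\<^sup>2" unfolding u_def using q2 by simp
      then have "[s = t q] (mod (int q)\<^sup>2)" using sx[of q] q by (simp add: A_def cong_def)
      then have c2: "[ramified_factor s = ramified_factor (t q)] (mod (int q)\<^sup>2)" by (rule ramified_factor_cong)
      then have "[ramified_factor s = ramified_factor (t q)] (mod int q)" by (rule cong_dvd_modulus) simp
      then show ?thesis using t[OF q] c2 S(3) q cong_dvd_iff by blast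
    qed
    ultimately show ?thesis by blast
  qed
  ultimately show ?thesis using S(1,2) by blast
qed

section \<open>Positive density\<close>

lemma liminf_residue_class_pos:
  fixes A :: "int set" and M a b :: int
  assumes M: "M > 0" and A: "\<And>s. s \<ge> b \<Longrightarrow> [s = a] (mod M) \<Longrightarrow> s \<in> A"
  shows "Liminf at_top (\<lambda>x::real. ereal (real (card {s. 1 \<le> s \<and> real_of_int s \<le> x \<and> s \<in> A}) / x)) > 0"
proof -
  define r where "r = a mod M"
  define c where "c = max b 1"
  \<comment> \<open>Beyond \<open>2 * C\<close> the loss from the first \<open>c\<close> members of the class is at most half of the count.\<close>
  define C where "C = real_of_int (r + M * (c + 2))"
  have r: "0 \<le> r" "r < M" using M by (auto simp: r_def)
  have bound: "real (card {s. 1 \<le> s \<and> real_of_int s \<le> x \<and> s \<in> A}) / x \<ge> 1 / (2 * real_of_int M)"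
    if x: "x \<ge> 2 * C" for x
  proof -
    have C0: "C > 0" unfolding C_def c_def using r M by (simp add: add_nonneg_pos)
    define J where "J = \<lfloor>(x - real_of_int r) / real_of_int M\<rfloor>"
    have J: "real_of_int J \<le> (x - real_of_int r) / real_of_int M" "(x - real_of_int r) / real_of_int M < real_of_int J + 1"
      unfolding J_def by linarith+
    have fin: "finite {s. 1 \<le> s \<and> real_of_int s \<le> x \<and> s \<in> A}"
      by (rule finite_subset[of _ "{1..\<lfloor>x\<rfloor>}"]) (auto simp: le_floor_iff)
    have "(\<lambda>j. r + M * j) ` {c..J} \<subseteq> {s. 1 \<le> s \<and> real_of_int s \<le> x \<and> s \<in> A}"
    proof (rule image_subsetI)
      fix j assume j: "j \<in> {c..J}"
      have "j \<ge> 1" "j \<ge> b" using j by (auto simp: c_def)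
      then have "M * j \<ge> 1 * j" using M by (intro mult_right_mono) auto
      then have ge: "r + M * j \<ge> b" "r + M * j \<ge> 1" using \<open>j \<ge> 1\<close> \<open>j \<ge> b\<close> r by linarith+
      have "real_of_int j \<le> (x - real_of_int r) / real_of_int M" using j J(1) by (simp add: order_trans[OF _ J(1)])
      then have "real_of_int (r + M * j) \<le> x" using M by (simp add: field_simps)
      moreover have "[r + M * j = a] (mod M)" by (simp add: cong_def r_def)
      ultimately show "r + M * j \<in> {s. 1 \<le> s \<and> real_of_int s \<le> x \<and> s \<in> A}" using ge A by blast
    qed
    then have "card ((\<lambda>j. r + M * j) ` {c..J}) \<le> card {s. 1 \<le> s \<and> real_of_int s \<le> x \<and> s \<in> A}"
      by (rule card_mono[OF fin])
    moreover have "card ((\<lambda>j. r + M * j) ` {c..J}) = card {c..J}"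
      using M by (intro card_image inj_onI) auto
    ultimately have "real_of_int (J - c + 1) \<le> real (card {s. 1 \<le> s \<and> real_of_int s \<le> x \<and> s \<in> A})" by simp
    moreover have "x / (2 * real_of_int M) \<le> real_of_int (J - c + 1)"
    proof -
      have "(x - real_of_int r) / real_of_int M - real_of_int c \<le> real_of_int (J - c + 1)" using J(2) by simp
      moreover have "x / (2 * real_of_int M) \<le> (x - real_of_int r) / real_of_int M - real_of_int c"
      proof -
        have "x / 2 \<le> x - (real_of_int r + real_of_int M * real_of_int c)"
          using x M unfolding C_def by (simp add: algebra_simps)
        then have "x / 2 / real_of_int M \<le> (x - (real_of_int r + real_of_int M * real_of_int c)) / real_of_int M"
          using M by (intro divide_right_mono) auto
        then show ?thesis using M by (simp add: field_simps)
      qed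
      ultimately show ?thesis by linarith
    qed
    ultimately have "x / (2 * real_of_int M) \<le> real (card {s. 1 \<le> s \<and> real_of_int s \<le> x \<and> s \<in> A})" by linarith
    then show ?thesis using x C0 M by (simp add: field_simps)
  qed
  have "ereal (1 / (2 * real_of_int M)) \<le> Liminf at_top (\<lambda>x::real. ereal (real (card {s. 1 \<le> s \<and> real_of_int s \<le> x \<and> s \<in> A}) / x))"
    by (rule Liminf_bounded) (rule eventually_mono[OF eventually_ge_at_top[of "2 * C"]], simp add: bound)
  moreover have "(0::ereal) < ereal (1 / (2 * real_of_int M))" using M by simp
  ultimately show ?thesis by (rule less_le_trans[rotated])
qed

text \<open>
  Choose \<open>k + 5\<close> primes that ramify for all \<open>s\<close> in one residue class; five of them account for the units.
\<close>

theorem theorem1p1: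
  fixes k :: nat and \<theta> :: "int \<Rightarrow> complex"
  assumes "k \<ge> 1"
    and "\<And>s. odd s \<Longrightarrow> poly (map_poly of_rat (lecacheux_poly (of_int s))) (\<theta> s) = 0"
  shows "Liminf at_top (\<lambda>x::real. ereal (real (card
           {s::int. 1 \<le> s \<and> real_of_int s \<le> x \<and> odd s \<and>
              has_subgroup_isomorphic_to (polya_group (rat_adjoin (\<theta> s)))
                (product_group {..<k} (\<lambda>_. integer_mod_group 5))}) / x)) > 0"
proof -
  define A where "A = {s. odd s \<and> has_subgroup_isomorphic_to (polya_group (rat_adjoin (\<theta> s)))
                (product_group {..<k} (\<lambda>_. integer_mod_group 5))}"
  obtain S M a where S: "finite S" "card S = k + 5" "M > 0"
    "\<And>s. [s = a] (mod M) \<Longrightarrow> odd s \<and>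
      (\<forall>q\<in>S. prime q \<and> q \<noteq> 5 \<and> int q dvd ramified_factor s \<and> \<not> (int q)\<^sup>2 dvd ramified_factor s)"
    using residue_class_with_ramified_primes[of "k + 5"] by blast
  have "s \<in> A" if "s \<ge> 100" "[s = a] (mod M)" for s
  proof -
    have "odd s" using S(4)[OF that(2)] by blast
    then show ?thesis unfolding A_def
      using lecacheux_polya_group[OF that(1) S(1), of k "\<theta> s"] S(2) S(4)[OF that(2)] assms(2) by simp
  qed
  from liminf_residue_class_pos[OF S(3) this] show ?thesis unfolding A_def by simp
qed

end
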